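(* Let $\alpha\in(0,1)$. For each $n$, let $f=f_n$ be a probability density with distribution $F_n$, and let $\mathcal{I}_n$ be a collection of nonoverlapping bounded open intervals such that for each $I\in\mathcal{I}_n$, $$H(f_n,I)\ge C\left(\sqrt{\log(e/F_n(I))}+b_n\right)/\sqrt n,$$ with constants $0\le b_n\to\infty$ and $C\ge\sqrt{24}$. Let $\delta_n:=\min_{I\in\mathcal{I}_n}F_n(I)$. Then, as $n\to\infty$, $$\mathbb{P}_{f_n}\bigl(\text{for each }I\in\mathcal{I}_n,\ \mathcal{D}^+(\alpha)\text{ contains an interval }J\subset I\bigr)\to1$$ in each of the following three settings: (i) $C\ge34$; (ii) $C>2\sqrt{24}$ and $n\delta_n/\log(e\,\#\mathcal{I}_n)\to\infty$; (iii) $C=\sqrt{24}$ and $n\delta_n/\log(e\,\#\mathcal{I}_n)\to\infty$, $\log\#\mathcal{I}_n=o(b_n^2)$.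
   Context: Data: $Y_1,\ldots,Y_m$ are independent with common distribution function $F$ and Lebesgue density $f$ on $\mathbb{R}$; $\mathbb{P}_f$ denotes probability when the density is $f$. If $F$ is known to be supported by $[a,\infty)$, $(-\infty,b]$ or $[a,b]$, one adds $a$, $b$, or both, respectively, to the order statistics $Y_{(1)}<\cdots<Y_{(m)}$. The resulting ordered vector is relabelled $\mathbf{X}=(X_{(i)})_{i=0}^{n+1}$, $X_{(0)}<\cdots<X_{(n+1)}$, so $n\in\{m-2,m-1,m\}$. Write $\mathcal{I}_{jk}:=(X_{(j)},X_{(k)})$. Let $\beta(x):=1\{x\in(0,1)\}(2x-1)$, $\Gamma(\delta):=(2\log(e/\delta))^{1/2}$, and for a vector $\mathbf{V}=(V_{(i)})_{i=0}^{n+1}$ with strictly increasing components and $0\le j<k\le n+1$, $k-j>1$, $$T_{jk}(\mathbf{V}):=\sum_{i=j+1}^{k-1}\beta\left(\frac{V_{(i)}-V_{(j)}}{V_{(k)}-V_{(j)}}\right),\qquad T_n(\mathbf{V}):=\max_{j,k:\,k-j>1}\left(\sqrt{\tfrac{3}{k-j-1}}|T_{jk}(\mathbf{V})|-\Gamma\left(\tfrac{k-j}{n+1}\right)\right).$$ Let $\mathbf{U}=(U_{(i)})_{i=0}^{n+1}$ with $U_{(0)}=0$, $U_{(n+1)}=1$ and $U_{(1)}<\cdots<U_{(n)}$ the order statistics of $n$ i.i.d. uniform variables on $[0,1]$. Let $\kappa_n(\alpha)$ be the $(1-\alpha)$-quantile of the distribution of $T_n(\mathbf{U})$, and $$c_{jk}(\alpha):=\sqrt{\tfrac{k-j-1}{3}}\left(\Gamma\left(\tfrac{k-j}{n+1}\right)+\kappa_n(\alpha)\right),\qquad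 \mathcal{D}^{+}(\alpha):=\{\mathcal{I}_{jk}: k-j>1,\ T_{jk}(\mathbf{X})>c_{jk}(\alpha)\}.$$ For a bounded open interval $I\subset\mathbb{R}$ of length $|I|$ let $$\inf_I f':=\inf_{x,y\in I:\,x<y}\frac{f(y)-f(x)}{y-x},\qquad H(f,I):=\inf_I f'\cdot|I|^2/\sqrt{F(I)},$$ where $F(I)=\int_I f(x)\,dx$. $\#\mathcal{I}_n$ denotes the number of intervals in $\mathcal{I}_n$; nonoverlapping means pairwise disjoint. *)

theory Defs
  imports "HOL-Probability.Probability" "HOL-Library.Landau_Symbols"
    "HOL-Library.Disjoint_Sets"
begin

(* Prior knowledge about the support is a pair of options: lo = Some a means that F is known
   to be supported by [a, infinity), hi = Some b that it is known to be supported by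
   (-infinity, b]; both together give [a,b]. *)

fun support_set :: "real option \<Rightarrow> real option \<Rightarrow> real set" where
  "support_set None None = UNIV"
| "support_set (Some a) None = {a..}"
| "support_set None (Some b) = {..b}"
| "support_set (Some a) (Some b) = {a..b}"

(* The number m of observations for which the extended vector has length n + 2. *)

definition sample_size :: "nat \<Rightarrow> real option \<Rightarrow> real option \<Rightarrow> nat" where
  "sample_size n lo hi = n + (if lo = None then 1 else 0) + (if hi = None then 1 else 0)"

(* Extended order statistics of y 0, ..., y (m - 1).  The components are strictly increasing
   only almost surely when y is random, and indices beyond the length of the list are
   never used. *)

definition ext_order_stats ::
    "real option \<Rightarrow> real option \<Rightarrow> nat \<Rightarrow> (nat \<Rightarrow> real) \<Rightarrow> nat \<Rightarrow> real" where
  "ext_order_stats lo hi m y i =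
     ((case lo of None \<Rightarrow> [] | Some a \<Rightarrow> [a]) @ sort (map y [0..<m]) @
      (case hi of None \<Rightarrow> [] | Some b \<Rightarrow> [b])) ! i"

definition beta_fun :: "real \<Rightarrow> real" where
  "beta_fun x = (if x \<in> {0<..<1} then 2 * x - 1 else 0)"

definition Gamma_fun :: "real \<Rightarrow> real" where
  "Gamma_fun \<delta> = sqrt (2 * ln (exp 1 / \<delta>))"

definition local_stat :: "nat \<Rightarrow> nat \<Rightarrow> (nat \<Rightarrow> real) \<Rightarrow> real" where
  "local_stat j k V = (\<Sum>i=j+1..k-1. beta_fun ((V i - V j) / (V k - V j)))"

definition index_pairs :: "nat \<Rightarrow> (nat \<times> nat) set" where
  "index_pairs n = {(j, k). j < k \<and> k \<le> n + 1 \<and> k - j > 1}"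

(* Intended for n \<ge> 1: for n = 0 there are no index pairs and the maximum is over the
   empty set. *)

definition multiscale_stat :: "nat \<Rightarrow> (nat \<Rightarrow> real) \<Rightarrow> real" where
  "multiscale_stat n V = Max ((\<lambda>(j, k).
     sqrt (3 / real (k - j - 1)) * \<bar>local_stat j k V\<bar>
       - Gamma_fun (real (k - j) / real (n + 1))) ` index_pairs n)"

definition quantile :: "'a measure \<Rightarrow> ('a \<Rightarrow> real) \<Rightarrow> real \<Rightarrow> real" where
  "quantile M X p = Inf {q. p \<le> measure M {\<omega> \<in> space M. X \<omega> \<le> q}}"

definition uniform_sample :: "nat \<Rightarrow> (nat \<Rightarrow> real) measure" where
  "uniform_sample n = PiM {..<n} (\<lambda>_. uniform_measure lborel {0..1})"

definition kappa :: "nat \<Rightarrow> real \<Rightarrow> real" where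
  "kappa n \<alpha> = quantile (uniform_sample n)
     (\<lambda>u. multiscale_stat n (ext_order_stats (Some 0) (Some 1) n u)) (1 - \<alpha>)"

definition crit_val :: "nat \<Rightarrow> real \<Rightarrow> nat \<Rightarrow> nat \<Rightarrow> real" where
  "crit_val n \<alpha> j k =
     sqrt (real (k - j - 1) / 3) * (Gamma_fun (real (k - j) / real (n + 1)) + kappa n \<alpha>)"

definition D_plus :: "nat \<Rightarrow> real \<Rightarrow> (nat \<Rightarrow> real) \<Rightarrow> real set set" where
  "D_plus n \<alpha> X =
     {{X j<..<X k} | j k. (j, k) \<in> index_pairs n \<and> local_stat j k X > crit_val n \<alpha> j k}"

definition mass :: "(real \<Rightarrow> real) \<Rightarrow> real set \<Rightarrow> real" where
  "mass f A = (LBINT x:A. f x)"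

(* The infimum is taken in the extended reals, since it equals -infinity whenever the
   difference quotients are unbounded below; Inf on type real would be unspecified there. *)

definition inf_slope :: "(real \<Rightarrow> real) \<Rightarrow> real set \<Rightarrow> ereal" where
  "inf_slope f I =
     (INF (x, y) \<in> {(x, y). x \<in> I \<and> y \<in> I \<and> x < y}. ereal ((f y - f x) / (y - x)))"

definition H_fun :: "(real \<Rightarrow> real) \<Rightarrow> real set \<Rightarrow> ereal" where
  "H_fun f I = inf_slope f I * ereal ((measure lborel I)\<^sup>2 / sqrt (mass f I))"

definition bounded_open_interval :: "real set \<Rightarrow> bool" where
  "bounded_open_interval I \<longleftrightarrow> (\<exists>a b. a < b \<and> I = {a<..<b})"

end

theory Submission
  imports Defs "HOL-Real_Asymp.Real_Asymp"
begin

text \<open>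
  The probability that some interval of \<open>\<I> n\<close> contains no interval of \<open>D_plus\<close> is at most
  \<open>6 * exp (- b n)\<close> for all large \<open>n\<close>.  This is a union bound over \<open>\<I> n\<close>, and two facts feed it.

  One is that \<open>kappa n \<alpha>\<close> is bounded above for large \<open>n\<close> (\<open>kappa_bounded\<close>), so that a critical value
  is \<open>sqrt ((k - j - 1) / 3)\<close> times \<open>sqrt (2 * ln (e * (n + 1) / (k - j)))\<close>, up to a constant.  The other
  concerns a single interval \<open>I = (a, c)\<close> of mass \<open>F\<close> on which \<open>f\<close> has slope at least \<open>s\<close>
  (\<open>interval_detected\<close>).  Among densities with this mass and slope bound the linear one has its
  mass furthest to the left, so the sum of \<open>2 x - 1\<close> over the relative positions \<open>x\<close> of the
  observations in \<open>I\<close> has mean at least \<open>n * s * (c - a)\<^sup>2 / 6\<close>, and the lower tail is no heavier than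
  that of a variable with this mean and with standard deviation about \<open>sqrt (n * F / 3)\<close>.  The
  hypothesis on \<open>H_fun\<close> makes this mean at least \<open>sqrt (n * F)\<close> times
  \<open>C * (sqrt (ln (e / F)) + b n) / 6\<close>, whereas the critical value is about \<open>sqrt (n * F)\<close> times
  \<open>sqrt (2 / 3) * sqrt (ln (e / F))\<close>.  Since \<open>sqrt 24 / 6 = sqrt (2 / 3)\<close>, the constant \<open>sqrt 24\<close> is
  where the two balance; what \<open>b n\<close> contributes is left to absorb the noise.

  The noise may be kept below \<open>u\<close> standard deviations except with probability about \<open>exp (- u\<^sup>2)\<close>.
  As the intervals are disjoint, their masses have sum at most one, and \<open>u\<^sup>2 = ln (1 / F) + b n\<close> makes
  the failure probabilities summable.  Such a level is nearly as large as the critical value; this is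
  why the constant doubles to \<open>2 * sqrt 24\<close>, and why only a crude constant such as 34 survives
  when \<open>n * F\<close> need not be large compared with \<open>u\<^sup>2\<close>.  The
  levels \<open>u\<^sup>2 = min (ln (1 / F)) (ln #\<I>) + b n\<close> serve as well, because the reciprocals of the number of
  intervals add up to one; if \<open>ln #\<I> = o (b\<^sup>2)\<close>, then \<open>u\<close> is negligible against \<open>b n\<close> and
  \<open>sqrt 24\<close> itself is enough.

  The ends of \<open>I\<close> are not order statistics.  An initial piece \<open>(a, a']\<close> is cut off which is just long
  enough to contain an observation, and the last observation in it and the last one before \<open>c\<close> serve as
  end points; this costs a factor close to one and a summand 1 (\<open>local_stat_inner_interval\<close>).

  For \<open>kappa_bounded\<close>, observe that given \<open>U (j)\<close> and \<open>U (k)\<close> the uniform order statistics between them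
  are those of independent uniform variables on \<open>(U (j), U (k))\<close>, so that \<open>local_stat j k\<close> has subgaussian
  tails with the variance of the limit (\<open>local_stat_uniform_tail\<close>).  The term \<open>Gamma_fun\<close> makes the
  exceedance probability of a pair proportional to \<open>(k - j) / (n + 1)\<close>.  A union bound over all pairs
  would still diverge.  It converges over all pairs with very small \<open>k - j\<close>, together with the
  pairs on grids which on each dyadic scale are finer than \<open>k - j\<close> only by a power of the
  logarithm of \<open>(n + 1) / (k - j)\<close>.  Every other pair is compared with the largest grid pair inside it;
  the modulus of continuity of the uniform empirical process bounds the difference of the two local
  statistics by a multiple of \<open>sqrt (k - j)\<close> (\<open>not_exceeds_from_grid\<close>).
\<close>

section \<open>Exponential bounds for sums and counts of independent observations\<close>

text \<open>
  The factor \<open>1 + \<bar>x\<bar>\<close> tends to one as \<open>x\<close> tends to zero, so that the Chernoff bounds derived from this have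
  the correct variance term.
\<close>

lemma exp_le_quadratic:
  fixes x :: real assumes "\<bar>x\<bar> \<le> 1"
  shows "exp x \<le> 1 + x + x\<^sup>2 / 2 * (1 + \<bar>x\<bar>)"
proof -
  obtain t where t: "\<bar>t\<bar> \<le> \<bar>x\<bar>" "exp x = (\<Sum>m<3. x ^ m / fact m) + exp t / fact 3 * x ^ 3"
    using Maclaurin_exp_le[of x 3] by auto
  have "exp t \<le> exp 1" using t(1) assms by auto
  also have "\<dots> \<le> 3" by (rule exp_le)
  finally have et: "exp t / fact 3 \<le> 1/2" by (simp add: fact_numeral)
  have "exp t / fact 3 * x ^ 3 \<le> exp t / fact 3 * \<bar>x\<bar> ^ 3"
    by (intro mult_left_mono) (auto simp flip: power_abs)
  also have "\<dots> \<le> 1/2 * \<bar>x\<bar> ^ 3" using et by (rule mult_right_mono) simp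
  finally have "exp t / fact 3 * x ^ 3 \<le> 1/2 * \<bar>x\<bar> ^ 3" .
  moreover have "(\<Sum>m<3. x ^ m / fact m) = 1 + x + x\<^sup>2 / 2"
    by (simp add: eval_nat_numeral)
  moreover have cube: "\<bar>x\<bar> ^ 3 = x\<^sup>2 * \<bar>x\<bar>"
    by (simp add: power3_eq_cube power2_eq_square)
  ultimately show ?thesis using t(2)
    by (simp add: algebra_simps)
qed

lemma (in prob_space) exp_markov_indep_sum:
  fixes Y :: "'i \<Rightarrow> 'a \<Rightarrow> real" and g :: "real \<Rightarrow> real"
  assumes I: "finite I" "indep_vars (\<lambda>_. borel) Y I"
    and g [measurable]: "g \<in> borel_measurable borel"
    and B: "\<And>i. i \<in> I \<Longrightarrow> (\<integral>\<^sup>+\<omega>. ennreal (exp (g (Y i \<omega>))) \<partial>M) \<le> ennreal (exp B)"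
  shows "prob {\<omega> \<in> space M. x \<le> (\<Sum>i\<in>I. g (Y i \<omega>))} \<le> exp (real (card I) * B - x)"
proof -
  have Ym [measurable]: "Y i \<in> borel_measurable M" if "i \<in> I" for i
    using I that by (auto simp: indep_vars_def)
  have "indep_vars (\<lambda>_. borel) (\<lambda>i \<omega>. ennreal (exp (g (Y i \<omega>)))) I"
    by (rule indep_vars_compose2[OF I(2)]) simp
  then have "(\<integral>\<^sup>+\<omega>. (\<Prod>i\<in>I. ennreal (exp (g (Y i \<omega>)))) \<partial>M)
      = (\<Prod>i\<in>I. \<integral>\<^sup>+\<omega>. ennreal (exp (g (Y i \<omega>))) \<partial>M)"
    by (intro indep_vars_nn_integral I) auto
  also have "\<dots> \<le> (\<Prod>i\<in>I. ennreal (exp B))"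
    using B by (induction I rule: infinite_finite_induct) (auto intro!: mult_mono)
  also have "\<dots> = ennreal (exp (real (card I) * B))"
    by (simp add: ennreal_power flip: exp_of_nat_mult)
  finally have *: "(\<integral>\<^sup>+\<omega>. ennreal (exp (\<Sum>i\<in>I. g (Y i \<omega>))) \<partial>M) \<le> ennreal (exp (real (card I) * B))"
    using I(1) by (simp add: exp_sum prod_ennreal)
  have "emeasure M {\<omega> \<in> space M. x \<le> (\<Sum>i\<in>I. g (Y i \<omega>))}
      \<le> (\<integral>\<^sup>+\<omega>. ennreal (exp (-x)) * ennreal (exp (\<Sum>i\<in>I. g (Y i \<omega>))) \<partial>M)"
    by (subst nn_integral_indicator[symmetric], measurable, intro nn_integral_mono)
       (auto simp: indicator_def simp flip: ennreal_mult' exp_add ennreal_1 split: if_splits)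
  also have "\<dots> \<le> ennreal (exp (-x)) * ennreal (exp (real (card I) * B))"
    by (subst nn_integral_cmult, measurable) (intro mult_left_mono *, simp)
  also have "\<dots> = ennreal (exp (real (card I) * B - x))"
    by (simp flip: ennreal_mult' exp_add)
  finally show ?thesis by (simp add: emeasure_eq_measure)
qed

lemma (in prob_space) density_facts:
  fixes f :: "real \<Rightarrow> real"
  assumes "distributed M lborel Y (\<lambda>x. ennreal (f x))" "\<And>x. f x \<ge> 0"
  shows "f \<in> borel_measurable borel" "integrable lborel f" "integral\<^sup>L lborel f = 1"
proof -
  have "(\<lambda>x. ennreal (f x)) \<in> borel_measurable lborel"
    using assms(1) by (auto simp: distributed_def)
  then have "(\<lambda>x. enn2real (ennreal (f x))) \<in> borel_measurable borel" by simp
  then show m [measurable]: "f \<in> borel_measurable borel" using assms(2) by simp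
  have "(\<integral>\<^sup>+x. ennreal (f x) \<partial>lborel) = 1"
    using distributed_nn_integral[OF assms(1), of "\<lambda>_. 1"] by (simp add: emeasure_space_1)
  then show "integrable lborel f" "integral\<^sup>L lborel f = 1"
    using assms(2) by (auto intro!: integrableI_nonneg simp: integral_eq_nn_integral)
qed

text \<open>
  A single observation contributes the factor \<open>1 + (LBINT x:J. f x * (exp (h x) - 1)) \<le> exp B\<close>, because observations
  outside \<open>J\<close> count with \<open>exp 0\<close>.
\<close>

lemma (in prob_space) exp_markov_density:
  fixes Y :: "'i \<Rightarrow> 'a \<Rightarrow> real" and f h :: "real \<Rightarrow> real"
  assumes I: "finite I" "indep_vars (\<lambda>_. borel) Y I"
    and D: "\<And>i. i \<in> I \<Longrightarrow> distributed M lborel (Y i) (\<lambda>x. ennreal (f x))"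
    and f: "\<And>x. f x \<ge> 0"
    and J [measurable]: "J \<in> sets borel"
    and h [measurable]: "h \<in> borel_measurable borel" and hb: "\<And>x. x \<in> J \<Longrightarrow> \<bar>h x\<bar> \<le> c"
    and B: "(LBINT x:J. f x * (exp (h x) - 1)) \<le> B"
  shows "prob {\<omega> \<in> space M. y \<le> (\<Sum>i\<in>I. if Y i \<omega> \<in> J then h (Y i \<omega>) else 0)}
     \<le> exp (real (card I) * B - y)"
proof (rule exp_markov_indep_sum[OF I, where g = "\<lambda>x. if x \<in> J then h x else 0"])
  show "(\<lambda>x. if x \<in> J then h x else 0) \<in> borel_measurable borel" by measurable
  fix i assume i: "i \<in> I"
  note df = density_facts[OF D[OF i] f]
  note df(1)[measurable]
  define g where "g x = (if x \<in> J then h x else 0)" for x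
  have [measurable]: "g \<in> borel_measurable borel" unfolding g_def by measurable
  have gb: "\<bar>g x\<bar> \<le> \<bar>c\<bar>" for x using hb[of x] by (auto simp: g_def)
  have int: "integrable lborel (\<lambda>x. f x * exp (g x))"
  proof (rule Bochner_Integration.integrable_bound[where f = "\<lambda>x. exp \<bar>c\<bar> * f x"])
    show "integrable lborel (\<lambda>x. exp \<bar>c\<bar> * f x)" using df by simp
    have "f x * exp (g x) \<le> f x * exp \<bar>c\<bar>" for x
      using gb[of x] f[of x] by (intro mult_left_mono) auto
    then show "AE x in lborel. norm (f x * exp (g x)) \<le> norm (exp \<bar>c\<bar> * f x)"
      using f by (auto simp: abs_mult mult.commute)
  qed simp
  have "(\<integral>\<^sup>+\<omega>. ennreal (exp (g (Y i \<omega>))) \<partial>M) = (\<integral>\<^sup>+x. ennreal (f x * exp (g x)) \<partial>lborel)"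
    using f by (subst distributed_nn_integral[OF D[OF i], symmetric]) (auto simp: ennreal_mult)
  also have "\<dots> = ennreal (\<integral>x. f x * exp (g x) \<partial>lborel)"
    using f by (intro nn_integral_eq_integral int) auto
  also have "(\<integral>x. f x * exp (g x) \<partial>lborel) = (\<integral>x. f x + (f x * exp (g x) - f x) \<partial>lborel)" by simp
  also have "\<dots> = 1 + (\<integral>x. f x * exp (g x) - f x \<partial>lborel)"
    using df int by (subst Bochner_Integration.integral_add) auto
  also have "(\<integral>x. f x * exp (g x) - f x \<partial>lborel) = (LBINT x:J. f x * (exp (h x) - 1))"
    unfolding set_lebesgue_integral_def
    by (intro Bochner_Integration.integral_cong) (auto simp: g_def algebra_simps)
  also have "1 + \<dots> \<le> exp B" using B exp_ge_add_one_self[of B] by linarith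
  finally show "(\<integral>\<^sup>+\<omega>. ennreal (exp (if Y i \<omega> \<in> J then h (Y i \<omega>) else 0)) \<partial>M) \<le> ennreal (exp B)"
    by (simp add: g_def ennreal_leI)
qed

definition obs_count :: "('i \<Rightarrow> 'a \<Rightarrow> real) \<Rightarrow> 'i set \<Rightarrow> real set \<Rightarrow> 'a \<Rightarrow> nat" where
  "obs_count Y I J \<omega> = card {i \<in> I. Y i \<omega> \<in> J}"

lemma obs_count_real: "finite I \<Longrightarrow> real (obs_count Y I J \<omega>) = (\<Sum>i\<in>I. if Y i \<omega> \<in> J then 1 else 0)"
  by (simp add: obs_count_def sum.If_cases Int_def)

lemma (in prob_space) obs_count_chernoff:
  fixes Y :: "'i \<Rightarrow> 'a \<Rightarrow> real" and f :: "real \<Rightarrow> real"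
  assumes I: "finite I" "indep_vars (\<lambda>_. borel) Y I"
    and D: "\<And>i. i \<in> I \<Longrightarrow> distributed M lborel (Y i) (\<lambda>x. ennreal (f x))"
    and f: "\<And>x. f x \<ge> 0"
    and J [measurable]: "J \<in> sets borel"
  shows "prob {\<omega> \<in> space M. y \<le> t * real (obs_count Y I J \<omega>)}
     \<le> exp (real (card I) * (mass f J * (exp t - 1)) - y)"
proof -
  have *: "(if P then t else 0) = t * (if P then 1 else 0)" for P by simp
  have "(LBINT x:J. f x * (exp t - 1)) \<le> mass f J * (exp t - 1)"
    by (simp add: mass_def)
  from exp_markov_density[OF I D f J _ _ this, where y=y and c="\<bar>t\<bar>"] show ?thesis
    using I(1) by (simp add: obs_count_real * sum_distrib_left[symmetric] del: mult_cancel_left2)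
qed

text \<open>
  Chernoff's bound together with \<open>exp u - 1 \<le> u + u\<^sup>2\<close> for \<open>\<bar>u\<bar> \<le> 1\<close>.  For the upper tail an upper bound \<open>F\<close> of
  the mass is enough; this is the form in which it applies to a part of an interval of mass \<open>F\<close>.
\<close>

lemma (in prob_space) obs_count_deviation:
  fixes Y :: "'i \<Rightarrow> 'a \<Rightarrow> real" and f :: "real \<Rightarrow> real"
  assumes I: "finite I" "indep_vars (\<lambda>_. borel) Y I"
    and D: "\<And>i. i \<in> I \<Longrightarrow> distributed M lborel (Y i) (\<lambda>x. ennreal (f x))"
    and f: "\<And>x. f x \<ge> 0"
    and J: "J \<in> sets borel"
    and F: "mass f J \<le> F" "0 \<le> F" and t: "0 \<le> t" "t \<le> 1"
  shows "prob {\<omega> \<in> space M. real (card I) * F + y \<le> real (obs_count Y I J \<omega>)}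
           \<le> exp (real (card I) * F * t\<^sup>2 - t * y)"  (is ?up)
    and "mass f J = F \<Longrightarrow> prob {\<omega> \<in> space M. real (obs_count Y I J \<omega>) \<le> real (card I) * F - y}
           \<le> exp (real (card I) * F * t\<^sup>2 - t * y)"  (is "_ \<Longrightarrow> ?low")
proof -
  have e: "exp u - 1 \<le> u + t\<^sup>2" if "\<bar>u\<bar> = t" for u
  proof -
    have "u\<^sup>2 / 2 * (1 + \<bar>u\<bar>) \<le> u\<^sup>2 / 2 * 2" using t that by (intro mult_left_mono) auto
    moreover have "u\<^sup>2 = t\<^sup>2" using that by (metis power2_abs)
    ultimately show ?thesis using exp_le_quadratic[of u] t that by auto
  qed
  have "prob {\<omega> \<in> space M. real (card I) * F + y \<le> real (obs_count Y I J \<omega>)}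
      \<le> prob {\<omega> \<in> space M. t * (real (card I) * F + y) \<le> t * real (obs_count Y I J \<omega>)}"
  proof (rule finite_measure_mono)
    have [measurable]: "Y i \<in> borel_measurable M" if "i \<in> I" for i
      using I that by (auto simp: indep_vars_def)
    show "{\<omega> \<in> space M. t * (real (card I) * F + y) \<le> t * real (obs_count Y I J \<omega>)} \<in> events"
      using J I(1) by (simp add: obs_count_real)
  qed (use t in \<open>auto intro: mult_left_mono\<close>)
  also have "\<dots> \<le> exp (real (card I) * (mass f J * (exp t - 1)) - t * (real (card I) * F + y))"
    by (rule obs_count_chernoff[OF I D f J])
  also have "\<dots> \<le> exp (real (card I) * F * t\<^sup>2 - t * y)"
  proof -
    have "mass f J * (exp t - 1) \<le> F * (t + t\<^sup>2)"
      using e[of t] F t by (intro mult_mono) auto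
    from mult_left_mono[OF this, of "real (card I)"] show ?thesis by (simp add: algebra_simps)
  qed
  finally show ?up .
  assume eq: "mass f J = F"
  have "prob {\<omega> \<in> space M. real (obs_count Y I J \<omega>) \<le> real (card I) * F - y}
      \<le> prob {\<omega> \<in> space M. - t * (real (card I) * F - y) \<le> - t * real (obs_count Y I J \<omega>)}"
  proof (rule finite_measure_mono)
    have [measurable]: "Y i \<in> borel_measurable M" if "i \<in> I" for i
      using I that by (auto simp: indep_vars_def)
    show "{\<omega> \<in> space M. - t * (real (card I) * F - y) \<le> - t * real (obs_count Y I J \<omega>)} \<in> events"
      using J I(1) by (simp add: obs_count_real)
  qed (use t in \<open>auto intro: mult_left_mono\<close>)
  also have "\<dots> \<le> exp (real (card I) * (mass f J * (exp (-t) - 1)) - (- t * (real (card I) * F - y)))"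
    by (rule obs_count_chernoff[OF I D f J])
  also have "\<dots> \<le> exp (real (card I) * F * t\<^sup>2 - t * y)"
  proof -
    have "mass f J * (exp (-t) - 1) \<le> F * (-t + t\<^sup>2)"
      using e[of "-t"] F t eq by (auto intro!: mult_left_mono)
    from mult_left_mono[OF this, of "real (card I)"] show ?thesis by (simp add: algebra_simps)
  qed
  finally show ?low .
qed

lemma (in prob_space) obs_count_zero:
  fixes Y :: "'i \<Rightarrow> 'a \<Rightarrow> real" and f :: "real \<Rightarrow> real"
  assumes I: "finite I" "indep_vars (\<lambda>_. borel) Y I"
    and D: "\<And>i. i \<in> I \<Longrightarrow> distributed M lborel (Y i) (\<lambda>x. ennreal (f x))"
    and f: "\<And>x. f x \<ge> 0"
    and J: "J \<in> sets borel"
  shows "prob {\<omega> \<in> space M. obs_count Y I J \<omega> = 0} \<le> exp (- real (card I) * mass f J)"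
proof -
  have "prob {\<omega> \<in> space M. obs_count Y I J \<omega> = 0} \<le> exp (real (card I) * (mass f J * (exp (-t) - 1)))" for t
  proof -
    have "prob {\<omega> \<in> space M. obs_count Y I J \<omega> = 0}
       \<le> prob {\<omega> \<in> space M. 0 \<le> -t * real (obs_count Y I J \<omega>)}"
    proof (rule finite_measure_mono)
      have [measurable]: "Y i \<in> borel_measurable M" if "i \<in> I" for i
        using I that by (auto simp: indep_vars_def)
      show "{\<omega> \<in> space M. 0 \<le> - t * real (obs_count Y I J \<omega>)} \<in> events"
        using J I(1) by (simp add: obs_count_real)
    qed auto
    also have "\<dots> \<le> exp (real (card I) * (mass f J * (exp (-t) - 1)) - 0)"
      by (rule obs_count_chernoff[OF I D f J])
    finally show ?thesis by simp
  qed
  moreover have "((\<lambda>t::real. exp (real (card I) * (mass f J * (exp (-t) - 1))))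
      \<longlongrightarrow> exp (real (card I) * (mass f J * (0 - 1)))) at_top"
    by (intro tendsto_intros) real_asymp
  ultimately show ?thesis
    by (intro tendsto_lowerbound[OF _ always_eventually]) auto
qed

lemma (in prob_space) AE_distributed_neq_const:
  assumes "distributed M lborel (Y :: 'a \<Rightarrow> real) g"
  shows "AE \<omega> in M. Y \<omega> \<noteq> c"
proof -
  have "AE x in density lborel g. x \<noteq> c"
    using assms by (subst AE_density) (use AE_lborel_singleton[of c] in \<open>auto simp: distributed_def elim: eventually_mono\<close>)
  moreover have "distr M lborel Y = density lborel g"
    using assms by (simp add: distributed_def)
  ultimately have "AE x in distr M lborel Y. x \<noteq> c" by metis
  then show ?thesis
    using assms by (subst (asm) AE_distr_iff) (auto simp: distributed_def)
qed

text \<open>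
  Fubini's theorem: a variable with a density avoids any value of the other, independent one.
\<close>

lemma (in prob_space) AE_indep_neq:
  fixes X Y :: "'a \<Rightarrow> real"
  assumes ind: "indep_var borel X borel Y" and D: "distributed M lborel Y g"
  shows "AE \<omega> in M. X \<omega> \<noteq> Y \<omega>"
proof -
  have [measurable]: "X \<in> borel_measurable M" "Y \<in> borel_measurable M"
    using indep_var_rv1[OF ind] indep_var_rv2[OF ind] by auto
  interpret X: prob_space "distr M borel X" by (rule prob_space_distr) simp
  interpret Y: prob_space "distr M borel Y" by (rule prob_space_distr) simp
  interpret P: pair_sigma_finite "distr M borel X" "distr M borel Y" ..
  have 1: "AE y in distr M borel Y. x \<noteq> y" for x
    using AE_distributed_neq_const[OF D, of x] by (subst AE_distr_iff) auto
  have "AE p in distr M borel X \<Otimes>\<^sub>M distr M borel Y. fst p \<noteq> snd p"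
  proof (rule P.AE_pair_measure)
    have "{p \<in> space (borel \<Otimes>\<^sub>M borel). fst p \<noteq> (snd p :: real)} \<in> sets (borel \<Otimes>\<^sub>M borel)" by measurable
    then show "{x \<in> space (distr M borel X \<Otimes>\<^sub>M distr M borel Y). fst x \<noteq> snd x} \<in> sets (distr M borel X \<Otimes>\<^sub>M distr M borel Y)"
      by (simp add: space_pair_measure cong: sets_pair_measure_cong)
  qed (use 1 in simp)
  also have "distr M borel X \<Otimes>\<^sub>M distr M borel Y = distr M (borel \<Otimes>\<^sub>M borel) (\<lambda>x. (X x, Y x))"
    using ind by (simp add: indep_var_distribution_eq)
  finally show ?thesis by (subst (asm) AE_distr_iff) (auto simp: split_beta')
qed

lemma (in prob_space) AE_indep_inj:
  fixes Y :: "'i \<Rightarrow> 'a \<Rightarrow> real"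
  assumes I: "finite I" "indep_vars (\<lambda>_. borel) Y I"
    and D: "\<And>i. i \<in> I \<Longrightarrow> distributed M lborel (Y i) g"
  shows "AE \<omega> in M. inj_on (\<lambda>i. Y i \<omega>) I"
proof -
  have "AE \<omega> in M. \<forall>i\<in>I. \<forall>j\<in>I. i \<noteq> j \<longrightarrow> Y i \<omega> \<noteq> Y j \<omega>"
  proof (intro AE_finite_allI I)
    fix i j assume ij: "i \<in> I" "j \<in> I"
    show "AE \<omega> in M. i \<noteq> j \<longrightarrow> Y i \<omega> \<noteq> Y j \<omega>"
    proof (cases "i = j")
      case False
      with ij have "indep_var (PiM {i} (\<lambda>_. borel)) (\<lambda>\<omega>. restrict (\<lambda>i. Y i \<omega>) {i})
          (PiM {j} (\<lambda>_. borel)) (\<lambda>\<omega>. restrict (\<lambda>i. Y i \<omega>) {j})"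
        by (intro indep_var_restrict[OF I(2)]) auto
      from indep_var_compose[OF this, of "\<lambda>x. x i" borel "\<lambda>x. x j" borel]
      have "indep_var borel (Y i) borel (Y j)" by (simp add: comp_def)
      from AE_indep_neq[OF this D[OF ij(2)]] show ?thesis by eventually_elim simp
    qed simp
  qed
  then show ?thesis by eventually_elim (auto simp: inj_on_def)
qed

section \<open>Densities whose slope is bounded below\<close>

definition slope_ge :: "(real \<Rightarrow> real) \<Rightarrow> real set \<Rightarrow> real \<Rightarrow> bool" where
  "slope_ge f I s \<longleftrightarrow> (\<forall>x\<in>I. \<forall>y\<in>I. x < y \<longrightarrow> s * (y - x) \<le> f y - f x)"

lemma slope_geD: "slope_ge f I s \<Longrightarrow> x \<in> I \<Longrightarrow> y \<in> I \<Longrightarrow> x \<le> y \<Longrightarrow> s * (y - x) \<le> f y - f x"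
  unfolding slope_ge_def by (cases "x = y") auto

lemma slope_ge_subset: "slope_ge f I s \<Longrightarrow> J \<subseteq> I \<Longrightarrow> slope_ge f J s"
  unfolding slope_ge_def by blast

lemma integral_Ioo_FTC:
  fixes q G :: "real \<Rightarrow> real"
  assumes "a \<le> c" "\<And>x. (G has_real_derivative q x) (at x)" "continuous_on UNIV q"
  shows "(LBINT x:{a<..<c}. q x) = G c - G a"
proof -
  have "(LBINT x=ereal a..ereal c. q x) = G c - G a"
    using assms by (intro interval_integral_FTC_finite)
      (auto intro: continuous_on_subset has_vector_derivative_at_within
        simp: has_real_derivative_iff_has_vector_derivative)
  then show ?thesis using assms(1) by (simp add: interval_lebesgue_integral_def einterval_eq)
qed

lemma set_integrable_Ioo_continuous:
  fixes q :: "real \<Rightarrow> real"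
  assumes "continuous_on UNIV q" shows "set_integrable lborel {a<..<c} q"
proof -
  have "set_integrable lborel {a..c} q"
    by (rule borel_integrable_atLeastAtMost') (use assms in \<open>blast intro: continuous_on_subset\<close>)
  then show ?thesis by (rule set_integrable_subset) auto
qed

lemma mass_mono:
  assumes f: "\<And>x. f x \<ge> 0" "integrable lborel f" and "A \<in> sets borel" "B \<in> sets borel" "A \<subseteq> B"
  shows "mass f A \<le> mass f B"
  unfolding mass_def set_lebesgue_integral_def
proof (rule integral_mono)
  show "integrable lborel (\<lambda>x. indicator A x *\<^sub>R f x)" "integrable lborel (\<lambda>x. indicator B x *\<^sub>R f x)"
    using assms by (auto intro!: integrable_mult_indicator simp del: real_scaleR_def)
qed (use assms in \<open>auto simp: indicator_def\<close>)

text \<open>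
  Let \<open>y\<close> tend to \<open>a\<close> in \<open>f x \<ge> f y + s * (x - y) \<ge> s * (x - y)\<close>.
\<close>

lemma slope_pointwise_lower:
  assumes f: "\<And>x. f x \<ge> 0" and s: "slope_ge f {a<..<c} s" and x: "x \<in> {a<..<c}"
  shows "s * (x - a) \<le> f x"
proof (rule tendsto_upperbound)
  show "((\<lambda>y. s * (x - y)) \<longlongrightarrow> s * (x - a)) (at_right a)"
    by (intro tendsto_intros)
  show "eventually (\<lambda>y. s * (x - y) \<le> f x) (at_right a)"
    using eventually_at_right_less[of a] eventually_at_right[of a x] x
  proof -
    have "eventually (\<lambda>y. y \<in> {a<..<x}) (at_right a)"
      using x by (intro eventually_at_rightI[where b = x]) auto
    then show ?thesis
    proof eventually_elim
      case (elim y)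
      then have "s * (x - y) \<le> f x - f y" using x by (intro slope_geD[OF s]) auto
      with f[of y] show ?case by linarith
    qed
  qed
qed simp

lemma slope_mass_lower:
  assumes f: "\<And>x. f x \<ge> 0" "integrable lborel f" and s: "slope_ge f {a<..<c} s" and ac: "a \<le> c"
  shows "s * (c - a)\<^sup>2 / 2 \<le> mass f {a<..<c}"
proof -
  have "s * (c - a)\<^sup>2 / 2 = (LBINT x:{a<..<c}. s * (x - a))"
    by (subst integral_Ioo_FTC[OF ac, where G = "\<lambda>x. s * (x - a)\<^sup>2 / 2"])
       (auto intro!: derivative_eq_intros continuous_intros)
  also have "\<dots> \<le> mass f {a<..<c}"
    unfolding mass_def
  proof (rule set_integral_mono)
    show "set_integrable lborel {a<..<c} f"
      unfolding set_integrable_def using f by (intro integrable_mult_indicator) auto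
    show "set_integrable lborel {a<..<c} (\<lambda>x. s * (x - a))"
      by (intro set_integrable_Ioo_continuous continuous_intros)
  qed (use slope_pointwise_lower[OF f(1) s] in auto)
  finally show ?thesis .
qed

text \<open>
  Chebyshev's association inequality.  The nondecreasing function \<open>D\<close> changes sign from minus to plus at some
  point \<open>z\<close>, so that \<open>D x * (q x - q z) \<le> 0\<close> for all \<open>x\<close>, and the integral of \<open>D x * q z\<close> is zero.
\<close>

lemma integral_mono_antimono_le_0:
  fixes D q :: "real \<Rightarrow> real"
  assumes ac: "a < c"
    and D: "\<And>x y. x \<in> {a<..<c} \<Longrightarrow> y \<in> {a<..<c} \<Longrightarrow> x \<le> y \<Longrightarrow> D x \<le> D y"
    and q: "\<And>x y. a \<le> x \<Longrightarrow> x \<le> y \<Longrightarrow> y \<le> c \<Longrightarrow> q y \<le> q x"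
    and int: "set_integrable lborel {a<..<c} D" "set_integrable lborel {a<..<c} (\<lambda>x. D x * q x)"
    and zero: "(LBINT x:{a<..<c}. D x) = 0"
  shows "(LBINT x:{a<..<c}. D x * q x) \<le> 0"
proof -
  define N where "N = insert a {x \<in> {a<..<c}. D x < 0}"
  define z where "z = Sup N"
  have bdd: "bdd_above N" unfolding N_def by (intro bdd_aboveI[of _ c]) (use ac in auto)
  have z: "a \<le> z" "z \<le> c"
    unfolding z_def using bdd ac by (auto intro!: cSup_upper cSup_least simp: N_def)
  have neg: "D x \<le> 0" if "x \<in> {a<..<c}" "x < z" for x
  proof -
    have "N \<noteq> {}" by (simp add: N_def)
    from less_cSup_iff[OF this bdd, of x] that obtain y where "y \<in> N" "x < y"
      by (auto simp: z_def)
    with that D[of x y] show ?thesis by (auto simp: N_def)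
  qed
  have pos: "D x \<ge> 0" if "x \<in> {a<..<c}" "z < x" for x
    using that cSup_upper[OF _ bdd, of x] by (force simp: N_def z_def)
  have le: "D x * q x \<le> q z * D x" if "x \<in> {a<..<c}" for x
  proof (cases "x < z")
    case True
    have "q z \<le> q x" by (rule q) (use True that z in auto)
    with neg[OF that True] show ?thesis
      by (subst (2) mult.commute) (rule mult_left_mono_neg)
  next
    case False
    show ?thesis
    proof (cases "x = z")
      case False
      with \<open>\<not> x < z\<close> have "z < x" by simp
      have "q x \<le> q z" by (rule q) (use \<open>z < x\<close> that z in auto)
      with pos[OF that \<open>z < x\<close>] show ?thesis
        by (subst (2) mult.commute) (rule mult_left_mono[rotated])
    qed simp
  qed
  have "(LBINT x:{a<..<c}. D x * q x) \<le> (LBINT x:{a<..<c}. q z * D x)"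
    by (rule set_integral_mono) (use int le in auto)
  also have "\<dots> = 0" using zero by simp
  finally show ?thesis .
qed

text \<open>
  Inside \<open>(a, c)\<close> this is \<open>beta_fun\<close> of the relative position; being affine throughout, it can be compared between
  intervals with different end points.
\<close>

definition rel_pos :: "real \<Rightarrow> real \<Rightarrow> real \<Rightarrow> real" where
  "rel_pos a c x = 2 * ((x - a) / (c - a)) - 1"

lemma rel_pos_measurable [measurable]: "rel_pos a c \<in> borel_measurable borel"
  unfolding rel_pos_def by measurable

lemma rel_pos_bound: "a < c \<Longrightarrow> a \<le> x \<Longrightarrow> x \<le> c \<Longrightarrow> \<bar>rel_pos a c x\<bar> \<le> 1"
  by (auto simp: rel_pos_def abs_le_iff field_simps)

lemma rel_pos_mult: "a < c \<Longrightarrow> (c - a) * rel_pos a c x = 2 * x - a - c"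
proof -
  assume "a < c"
  then have "rel_pos a c x = (2 * x - a - c) / (c - a)" by (simp add: rel_pos_def field_simps)
  with \<open>a < c\<close> show ?thesis by simp
qed

text \<open>
  Bound the exponential by a quadratic function \<open>q\<close> of the position, which is nonincreasing as \<open>t \<le> 1/2\<close>.
  If \<open>lin\<close> is the linear function with slope \<open>s\<close> and the same integral as \<open>f\<close>, then \<open>f - lin\<close> is
  nondecreasing, and the association inequality shows that replacing \<open>f\<close> by \<open>lin\<close> only increases the
  integral.  What remains is the integral of a polynomial.  The resulting mean is that of \<open>lin\<close>, and \<open>t\<^sup>2 / 6\<close>
  is half the variance \<open>1/3\<close> of a uniform variable on \<open>[-1, 1]\<close>.
\<close>

lemma slope_exp_moment:
  assumes f: "\<And>x. f x \<ge> 0" "integrable lborel f" and s: "slope_ge f {a<..<c} s" and ac: "a < c"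
    and t: "0 \<le> t" "t \<le> 1/2"
  shows "(LBINT x:{a<..<c}. f x * (exp (- t * rel_pos a c x) - 1))
          \<le> mass f {a<..<c} * (t\<^sup>2 * (1 + t) / 6) - t * s * (c - a)\<^sup>2 / 6"
proof -
  define w where "w = c - a"
  define m where "m = (a + c) / 2"
  define F where "F = mass f {a<..<c}"
  define B where "B = t\<^sup>2 * (1 + t) / 2"
  define v where "v = rel_pos a c"
  define q where "q x = - t * v x + B * (v x)\<^sup>2" for x
  define lin where "lin x = F / w + s * (x - m)" for x
  have w: "w > 0" using ac by (simp add: w_def)
  have veq: "v x = 2 / w * (x - m)" for x
    using ac by (simp add: v_def rel_pos_def w_def m_def field_simps)
  have [measurable]: "f \<in> borel_measurable borel" using f(2) by auto
  have [measurable]: "v \<in> borel_measurable borel" unfolding v_def by measurable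
  have intf: "set_integrable lborel {a<..<c} f"
    unfolding set_integrable_def using f by (intro integrable_mult_indicator) auto
  have bnd: "set_integrable lborel {a<..<c} (\<lambda>x. f x * h x)"
    if h [measurable]: "h \<in> borel_measurable borel" and hb: "\<And>x. x \<in> {a<..<c} \<Longrightarrow> \<bar>h x\<bar> \<le> C" for h C
  proof (rule set_integrable_bound[where f = "\<lambda>x. C * f x"])
    show "set_integrable lborel {a<..<c} (\<lambda>x. C * f x)" using intf by simp
    have "norm (f x * h x) \<le> norm (C * f x)" if "x \<in> {a<..<c}" for x
    proof -
      have "f x * \<bar>h x\<bar> \<le> f x * C" using hb[OF that] f(1)[of x] by (rule mult_left_mono)
      moreover have "C \<ge> 0" using hb[OF that] by linarith
      ultimately show ?thesis using f(1)[of x] by (simp add: abs_mult mult.commute)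
    qed
    then show "AE x in lborel. x \<in> {a<..<c} \<longrightarrow> norm (f x * h x) \<le> norm (C * f x)" by simp
  qed (simp add: set_borel_measurable_def)
  have vb: "\<bar>v x\<bar> \<le> 1" if "x \<in> {a<..<c}" for x
    unfolding v_def using that ac by (intro rel_pos_bound) auto
  have B0: "0 \<le> B" "2 * B \<le> t"
  proof -
    show "0 \<le> B" using t by (simp add: B_def)
    have "t * (1 + t) \<le> 1" using mult_mono[of t "1/2" "1 + t" "3/2"] t by simp
    from mult_left_mono[OF this t(1)] show "2 * B \<le> t" by (simp add: B_def power2_eq_square mult.assoc)
  qed
  have qbound: "exp (- t * v x) - 1 \<le> q x" "\<bar>q x\<bar> \<le> 1 + B" if "x \<in> {a<..<c}" for x
  proof -
    have tv: "t * \<bar>v x\<bar> \<le> t" using vb[OF that] t by (simp add: mult_left_le)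
    have v2: "(v x)\<^sup>2 \<le> 1" using vb[OF that] by (simp add: abs_square_le_1)
    have "exp (- t * v x) \<le> 1 + - t * v x + (- t * v x)\<^sup>2 / 2 * (1 + \<bar>- t * v x\<bar>)"
      by (rule exp_le_quadratic) (use tv t in \<open>simp add: abs_mult\<close>)
    also have "(- t * v x)\<^sup>2 / 2 * (1 + \<bar>- t * v x\<bar>) \<le> (- t * v x)\<^sup>2 / 2 * (1 + t)"
      using tv t by (intro mult_left_mono) (auto simp: abs_mult)
    also have "\<dots> = B * (v x)\<^sup>2" by (simp add: B_def power_mult_distrib)
    finally show "exp (- t * v x) - 1 \<le> q x" by (simp add: q_def)
    have "\<bar>q x\<bar> \<le> \<bar>- t * v x\<bar> + \<bar>B * (v x)\<^sup>2\<bar>" unfolding q_def by (rule abs_triangle_ineq)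
    also have "\<dots> \<le> 1 + B" using tv t v2 B0 by (intro add_mono) (auto simp: abs_mult mult_left_le)
    finally show "\<bar>q x\<bar> \<le> 1 + B" .
  qed
  have qm [measurable]: "q \<in> borel_measurable borel" unfolding q_def by measurable
  have intfq: "set_integrable lborel {a<..<c} (\<lambda>x. f x * q x)"
    by (rule bnd[where C = "1 + B"]) (use qbound in auto)
  have cont: "continuous_on UNIV lin" "continuous_on UNIV (\<lambda>x. lin x * q x)"
    unfolding lin_def q_def veq using w by (auto intro!: continuous_intros)
  have intlin: "set_integrable lborel {a<..<c} lin" "set_integrable lborel {a<..<c} (\<lambda>x. lin x * q x)"
    by (intro set_integrable_Ioo_continuous cont)+
  have "(LBINT x:{a<..<c}. f x * (exp (- t * v x) - 1)) \<le> (LBINT x:{a<..<c}. f x * q x)"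
  proof (rule set_integral_mono[OF _ intfq])
    show "set_integrable lborel {a<..<c} (\<lambda>x. f x * (exp (- t * v x) - 1))"
    proof (rule bnd[where C = 2])
      fix x assume "x \<in> {a<..<c}"
      then have "\<bar>- t * v x\<bar> \<le> 1"
        using vb[of x] t mult_mono[of t 1 "\<bar>v x\<bar>" 1] by (simp add: abs_mult)
      then have "- t * v x \<le> 1" by linarith
      have "exp (- t * v x) \<le> exp 1" using \<open>- t * v x \<le> 1\<close> by (subst exp_le_cancel_iff)
      also have "\<dots> \<le> 3" by (rule exp_le)
      finally show "\<bar>exp (- t * v x) - 1\<bar> \<le> 2" using exp_gt_zero[of "- t * v x"] by linarith
    qed measurable
  qed (use qbound(1) f(1) in \<open>auto intro!: mult_left_mono\<close>)
  also have "\<dots> = (LBINT x:{a<..<c}. (f x - lin x) * q x) + (LBINT x:{a<..<c}. lin x * q x)"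
    using set_integral_diff(2)[OF intfq intlin(2)] by (simp add: left_diff_distrib)
  also have "(LBINT x:{a<..<c}. (f x - lin x) * q x) \<le> 0"
  proof (rule integral_mono_antimono_le_0[OF ac])
    show "f x - lin x \<le> f y - lin y" if "x \<in> {a<..<c}" "y \<in> {a<..<c}" "x \<le> y" for x y
      using slope_geD[OF s that] by (simp add: lin_def algebra_simps)
    show "q y \<le> q x" if "a \<le> x" "x \<le> y" "y \<le> c" for x y
    proof -
      have vy: "v x \<le> v y" "v x + v y \<le> 2"
      proof -
        show "v x \<le> v y" using that w by (auto simp: veq intro!: divide_right_mono)
        have "\<bar>v x\<bar> \<le> 1" "\<bar>v y\<bar> \<le> 1" unfolding v_def using that by (auto intro!: rel_pos_bound ac)
        then show "v x + v y \<le> 2" by linarith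
      qed
      have "B * (v x + v y) \<le> B * 2" using vy(2) B0(1) by (rule mult_left_mono)
      then have "0 \<le> (v y - v x) * (t - B * (v x + v y))"
        using vy(1) B0 by (intro mult_nonneg_nonneg) auto
      also have "\<dots> = q x - q y" by (simp add: q_def power2_eq_square algebra_simps)
      finally show ?thesis by simp
    qed
    show "set_integrable lborel {a<..<c} (\<lambda>x. f x - lin x)"
      by (rule set_integral_diff(1)[OF intf intlin(1)])
    show "set_integrable lborel {a<..<c} (\<lambda>x. (f x - lin x) * q x)"
      using set_integral_diff(1)[OF intfq intlin(2)] by (simp add: left_diff_distrib)
    have "(LBINT x:{a<..<c}. lin x) = F"
    proof (subst integral_Ioo_FTC[where G = "\<lambda>x. F / w * x + s * (x - m)\<^sup>2 / 2"])
      show "((\<lambda>x. F / w * x + s * (x - m)\<^sup>2 / 2) has_real_derivative lin x) (at x)" for x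
        unfolding lin_def using w by (auto intro!: derivative_eq_intros)
      have e: "c - m = w / 2" "a - m = - w / 2" by (auto simp: m_def w_def field_simps)
      have "F / w * c + s * (c - m)\<^sup>2 / 2 - (F / w * a + s * (a - m)\<^sup>2 / 2) = F / w * (c - a)"
        unfolding e by (simp add: right_diff_distrib)
      then show "F / w * c + s * (c - m)\<^sup>2 / 2 - (F / w * a + s * (a - m)\<^sup>2 / 2) = F"
        using w by (simp flip: w_def)
    qed (use ac cont in auto)
    then show "(LBINT x:{a<..<c}. f x - lin x) = 0"
      using set_integral_diff(2)[OF intf intlin(1)] by (simp add: F_def mass_def)
  qed
  also have "(LBINT x:{a<..<c}. lin x * q x) = F * (t\<^sup>2 * (1 + t) / 6) - t * s * w\<^sup>2 / 6"
  proof -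
    \<comment> \<open>An antiderivative of \<open>lin x * q x\<close>.\<close>
    define G where "G x = - t * F * (x - m)\<^sup>2 / w\<^sup>2 + 4 * F * B * (x - m) ^ 3 / (3 * w ^ 3)
       - 2 * t * s * (x - m) ^ 3 / (3 * w) + s * B * (x - m) ^ 4 / w\<^sup>2" for x
    have "(LBINT x:{a<..<c}. lin x * q x) = G c - G a"
    proof (rule integral_Ioo_FTC)
      show "(G has_real_derivative lin x * q x) (at x)" for x
        unfolding G_def lin_def q_def veq using w
        apply (auto intro!: derivative_eq_intros)
        apply (simp add: field_simps eval_nat_numeral)
        done
    qed (use ac cont in auto)
    moreover have e: "c - m = w / 2" "a - m = - w / 2" by (auto simp: m_def w_def field_simps)
    have "G c - G a = F * (t\<^sup>2 * (1 + t) / 6) - t * s * w\<^sup>2 / 6"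
      unfolding G_def e B_def using w by (simp add: field_simps eval_nat_numeral)
    ultimately show ?thesis by simp
  qed
  finally show ?thesis by (simp add: v_def F_def w_def)
qed

section \<open>Order statistics and the local test statistic\<close>

definition ext_list :: "real option \<Rightarrow> real option \<Rightarrow> nat \<Rightarrow> (nat \<Rightarrow> real) \<Rightarrow> real list" where
  "ext_list lo hi m y = (case lo of None \<Rightarrow> [] | Some a \<Rightarrow> [a]) @ sort (map y [0..<m]) @
      (case hi of None \<Rightarrow> [] | Some b \<Rightarrow> [b])"

lemma ext_order_stats_nth: "ext_order_stats lo hi m y = (!) (ext_list lo hi m y)"
  by (simp add: fun_eq_iff ext_order_stats_def ext_list_def)

lemma length_ext_list: "length (ext_list lo hi (sample_size n lo hi) y) = n + 2"
  by (auto simp: ext_list_def sample_size_def split: option.split)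

lemma set_ext_list: "set (ext_list lo hi m y) = set_option lo \<union> y ` {..<m} \<union> set_option hi"
  by (auto simp: ext_list_def split: option.split)

lemma strict_sorted_ext_list:
  assumes "inj_on y {..<m}"
    and "\<And>i a. i < m \<Longrightarrow> lo = Some a \<Longrightarrow> a < y i" "\<And>i b. i < m \<Longrightarrow> hi = Some b \<Longrightarrow> y i < b"
    and "\<And>a b. lo = Some a \<Longrightarrow> hi = Some b \<Longrightarrow> a < b"
  shows "sorted_wrt (<) (ext_list lo hi m y)"
proof -
  have "distinct (map y [0..<m])" using assms(1) by (simp add: distinct_map atLeast0LessThan)
  then have "sorted_wrt (<) (sort (map y [0..<m]))" by (simp add: strict_sorted_iff)
  then show ?thesis
    using assms(2-4) by (auto simp: ext_list_def sorted_wrt_append split: option.split)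
qed

lemma strict_sorted_between:
  fixes zs :: "real list"
  assumes zs: "sorted_wrt (<) zs" and jk: "j < k" "k < length zs"
  shows "{z \<in> set zs. zs ! j < z \<and> z < zs ! k} = (!) zs ` {j+1..k-1}"
    and "inj_on ((!) zs) {j+1..k-1}"
proof -
  have less: "zs ! i < zs ! i' \<longleftrightarrow> i < i'" if "i < length zs" "i' < length zs" for i i'
    using that sorted_wrt_nth_less[OF zs, of i i'] sorted_wrt_nth_less[OF zs, of i' i]
    by (cases i i' rule: linorder_cases) auto
  show "{z \<in> set zs. zs ! j < z \<and> z < zs ! k} = (!) zs ` {j+1..k-1}"
  proof (intro set_eqI iffI)
    fix z assume "z \<in> {z \<in> set zs. zs ! j < z \<and> z < zs ! k}"
    then obtain i where "i < length zs" "zs ! i = z" "zs ! j < zs ! i" "zs ! i < zs ! k"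
      by (auto simp: in_set_conv_nth)
    then show "z \<in> (!) zs ` {j+1..k-1}" using jk less by auto
  next
    fix z assume "z \<in> (!) zs ` {j+1..k-1}"
    then show "z \<in> {z \<in> set zs. zs ! j < z \<and> z < zs ! k}" using jk less by auto
  qed
  show "inj_on ((!) zs) {j+1..k-1}"
    using jk zs by (auto simp: inj_on_def strict_sorted_iff nth_eq_iff_index_eq)
qed

lemma local_stat_between:
  fixes zs :: "real list"
  assumes zs: "sorted_wrt (<) zs" and jk: "j < k" "k < length zs"
  shows "local_stat j k ((!) zs) = (\<Sum>z | z \<in> set zs \<and> zs ! j < z \<and> z < zs ! k. rel_pos (zs ! j) (zs ! k) z)"
    and "card {z \<in> set zs. zs ! j < z \<and> z < zs ! k} = k - j - 1"
proof -
  note b = strict_sorted_between[OF assms]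
  show "card {z \<in> set zs. zs ! j < z \<and> z < zs ! k} = k - j - 1"
    using b jk by (simp add: card_image)
  have "(\<Sum>z | z \<in> set zs \<and> zs ! j < z \<and> z < zs ! k. rel_pos (zs ! j) (zs ! k) z)
      = (\<Sum>i=j+1..k-1. rel_pos (zs ! j) (zs ! k) (zs ! i))"
    unfolding b(1) by (subst sum.reindex[OF b(2)]) (simp add: comp_def)
  also have "\<dots> = local_stat j k ((!) zs)"
    unfolding local_stat_def
  proof (rule sum.cong)
    fix i assume "i \<in> {j+1..k-1}"
    then have "zs ! j < zs ! i" "zs ! i < zs ! k" using zs jk by (auto intro!: sorted_wrt_nth_less[OF zs])
    then show "rel_pos (zs ! j) (zs ! k) (zs ! i) = beta_fun ((zs ! i - zs ! j) / (zs ! k - zs ! j))"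
      by (auto simp: rel_pos_def beta_fun_def)
  qed simp
  finally show "local_stat j k ((!) zs) = (\<Sum>z | z \<in> set zs \<and> zs ! j < z \<and> z < zs ! k. rel_pos (zs ! j) (zs ! k) z)" ..
qed

text \<open>
  Let \<open>u = zs ! j\<close> be the largest point in \<open>(a, a']\<close> and \<open>v = zs ! k\<close> the largest one in \<open>(a', c)\<close>.  Then
  \<open>(v - u) * rel_pos u v z = 2 * z - u - v \<ge> 2 * z - a' - c = (c - a') * rel_pos a' c z\<close> for every \<open>z\<close>.  The summand
  \<open>rel_pos u v v = 1\<close> of the sum over the points in \<open>(a', c)\<close> is missing in the local statistic, and dividing by
  \<open>v - u \<le> c - a\<close> gives the claim.
\<close>

lemma local_stat_inner_interval:
  fixes zs :: "real list"
  assumes zs: "sorted_wrt (<) zs" and a: "a \<le> a'" "a' < c"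
    and ne: "set zs \<inter> {a<..a'} \<noteq> {}"
    and S: "S = (\<Sum>z\<in>set zs \<inter> {a'<..<c}. rel_pos a' c z)"
    and pos: "(c - a') / (c - a) * S > 1"
  obtains j k where "j < k" "k < length zs" "k - j = card (set zs \<inter> {a'<..<c})" "k - j > 1"
    "a < zs ! j" "zs ! k < c" "local_stat j k ((!) zs) \<ge> (c - a') / (c - a) * S - 1"
proof -
  define Z where "Z = set zs"
  define N where "N = Z \<inter> {a'<..<c}"
  have ac: "a < c" using a by simp
  have Spos: "S > 1"
  proof -
    have "(c - a') / (c - a) \<le> 1" "(c - a') / (c - a) > 0" using a by (auto simp: field_simps)
    moreover from this pos have "S > 0" by (smt (verit) mult_nonneg_nonpos)
    ultimately have "(c - a') / (c - a) * S \<le> 1 * S" by (intro mult_right_mono) auto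
    with pos show ?thesis by simp
  qed
  have "S \<le> (\<Sum>z\<in>N. 1)" unfolding S N_def Z_def
    using a rel_pos_bound[of a' c] by (intro sum_mono) (force simp: abs_le_iff)
  with Spos have cardN: "card N > 1" by simp
  then have Nne: "N \<noteq> {}" "finite N" by (auto simp: N_def Z_def)
  define u where "u = Max (Z \<inter> {a<..a'})"
  define v where "v = Max N"
  have finu: "finite (Z \<inter> {a<..a'})" by (simp add: Z_def)
  have u: "u \<in> Z" "a < u" "u \<le> a'" using Max_in[OF finu] ne by (auto simp: u_def Z_def)
  have v: "v \<in> Z" "a' < v" "v < c" "v \<in> N" using Max_in[OF Nne(2,1)] by (auto simp: v_def N_def)
  obtain j where j: "j < length zs" "zs ! j = u" using u by (auto simp: Z_def in_set_conv_nth)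
  obtain k where k: "k < length zs" "zs ! k = v" using v by (auto simp: Z_def in_set_conv_nth)
  have jk: "j < k"
  proof (rule ccontr)
    assume "\<not> j < k"
    then have "zs ! k \<le> zs ! j" using j(1) zs sorted_wrt_nth_less[OF zs, of k j] by (cases "k = j") auto
    with j k u v show False by simp
  qed
  have between: "{z \<in> set zs. zs ! j < z \<and> z < zs ! k} = N - {v}"
  proof (intro set_eqI iffI)
    fix z assume z: "z \<in> {z \<in> set zs. zs ! j < z \<and> z < zs ! k}"
    have "a' < z"
    proof (rule ccontr)
      assume "\<not> a' < z"
      then have "z \<in> Z \<inter> {a<..a'}" using z u j by (auto simp: Z_def)
      then have "z \<le> u" unfolding u_def using finu by (rule Max_ge[rotated])
      with z j show False by simp
    qed
    with z k v show "z \<in> N - {v}" by (auto simp: N_def Z_def)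
  next
    fix z assume z: "z \<in> N - {v}"
    then have "z \<le> v" unfolding v_def using Nne by (intro Max_ge) auto
    with z u j k show "z \<in> {z \<in> set zs. zs ! j < z \<and> z < zs ! k}" by (auto simp: N_def Z_def)
  qed
  have "card (N - {v}) = card N - 1" using v Nne by simp
  then have kj: "k - j = card N"
    using local_stat_between(2)[OF zs jk k(1)] jk cardN unfolding between by simp
  have "local_stat j k ((!) zs) = (\<Sum>z\<in>N - {v}. rel_pos u v z)"
    using local_stat_between(1)[OF zs jk k(1)] unfolding between unfolding j k .
  also have "\<dots> = (\<Sum>z\<in>N. rel_pos u v z) - rel_pos u v v" using v Nne by (simp add: sum_diff1)
  also have "rel_pos u v v = 1" using u v by (simp add: rel_pos_def)
  finally have T: "local_stat j k ((!) zs) + 1 = (\<Sum>z\<in>N. rel_pos u v z)" by simp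
  have "(c - a') * S = (\<Sum>z\<in>N. (c - a') * rel_pos a' c z)"
    by (simp add: S N_def Z_def sum_distrib_left)
  also have "\<dots> \<le> (\<Sum>z\<in>N. (v - u) * rel_pos u v z)"
    using u v a by (intro sum_mono) (simp add: rel_pos_mult)
  also have "\<dots> = (v - u) * (local_stat j k ((!) zs) + 1)" by (simp add: T sum_distrib_left)
  finally have le: "(c - a') * S \<le> (v - u) * (local_stat j k ((!) zs) + 1)" .
  have "(c - a') * S > 0" using a Spos by simp
  with le have "(v - u) * (local_stat j k ((!) zs) + 1) > 0" by linarith
  then have "local_stat j k ((!) zs) + 1 > 0" using u v by (simp add: zero_less_mult_iff)
  then have "(v - u) * (local_stat j k ((!) zs) + 1) \<le> (c - a) * (local_stat j k ((!) zs) + 1)"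
    using u v by (intro mult_right_mono) auto
  with le have "(c - a') * S \<le> (c - a) * (local_stat j k ((!) zs) + 1)" by linarith
  then have "(c - a') * S / (c - a) \<le> local_stat j k ((!) zs) + 1"
    using ac by (subst pos_divide_le_eq) (auto simp: mult.commute)
  then show thesis
    using jk k j kj cardN u v by (intro that[of j k]) (auto simp: N_def Z_def)
qed

section \<open>Measurability of the statistics\<close>

text \<open>
  Turns an event about an order statistic into one about a count, which is measurable.
\<close>

lemma sorted_nth_le_iff:
  fixes ys :: "real list"
  assumes "sorted ys" "i < length ys"
  shows "ys ! i \<le> t \<longleftrightarrow> i < length (filter (\<lambda>x. x \<le> t) ys)"
  using assms
proof (induction ys arbitrary: i)
  case (Cons y ys)
  show ?case
  proof (cases "y \<le> t")
    case True
    then show ?thesis using Cons by (cases i) auto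
  next
    case False
    then have "filter (\<lambda>x. x \<le> t) ys = []" using Cons.prems by (auto simp: filter_empty_conv)
    moreover have "\<not> (y # ys) ! i \<le> t" using False Cons.prems
      by (cases i) (use nth_mem in fastforce)+
    ultimately show ?thesis using False by simp
  qed
qed simp

lemma measurable_sort_nth:
  assumes Y [measurable]: "\<And>p. p < m \<Longrightarrow> Y p \<in> borel_measurable M" and i: "i < m"
  shows "(\<lambda>\<omega>. sort (map (\<lambda>p. Y p \<omega>) [0..<m]) ! i :: real) \<in> borel_measurable M"
proof (subst borel_measurable_iff_le, intro allI)
  fix t
  have "length (filter (\<lambda>x. x \<le> t) (sort (map (\<lambda>p. Y p \<omega>) [0..<m]))) = (\<Sum>p<m. if Y p \<omega> \<le> t then 1 else 0)" for \<omega>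
    by (simp add: filter_sort length_filter_map sum.If_cases Int_def
        distinct_length_filter atLeast0LessThan comp_def conj_commute)
  then have "{\<omega> \<in> space M. sort (map (\<lambda>p. Y p \<omega>) [0..<m]) ! i \<le> t}
     = {\<omega> \<in> space M. i < (\<Sum>p<m. if Y p \<omega> \<le> t then 1 else 0)}"
    using i by (subst sorted_nth_le_iff) auto
  also have "\<dots> \<in> sets M" by measurable
  finally show "{\<omega> \<in> space M. sort (map (\<lambda>p. Y p \<omega>) [0..<m]) ! i \<le> t} \<in> sets M" .
qed

lemma measurable_ext_order_stats:
  assumes Y: "\<And>p. p < m \<Longrightarrow> Y p \<in> borel_measurable M"
  shows "(\<lambda>\<omega>. ext_order_stats lo hi m (\<lambda>p. Y p \<omega>) i) \<in> borel_measurable M"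
proof -
  note [measurable] = measurable_sort_nth[OF Y]
  have [measurable]: "(\<lambda>\<omega>. (sort (map (\<lambda>p. Y p \<omega>) [0..<m]) @ ys) ! i) \<in> borel_measurable M" for i ys
    by (cases "i < m") (simp_all add: nth_append)
  show ?thesis unfolding ext_order_stats_def
    by (cases lo; cases i) simp_all
qed

lemma measurable_local_stat:
  assumes [measurable]: "\<And>i. (\<lambda>\<omega>. V \<omega> i) \<in> borel_measurable M"
  shows "(\<lambda>\<omega>. local_stat j k (V \<omega>)) \<in> borel_measurable M"
proof -
  have [measurable]: "beta_fun \<in> borel_measurable borel" unfolding beta_fun_def by measurable
  show ?thesis unfolding local_stat_def by measurable
qed

lemma finite_index_pairs: "finite (index_pairs n)"
  by (rule finite_subset[of _ "{..n+1} \<times> {..n+1}"]) (auto simp: index_pairs_def)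

lemma measurable_multiscale_stat:
  assumes [measurable]: "\<And>i. (\<lambda>\<omega>. V \<omega> i) \<in> borel_measurable M"
  shows "(\<lambda>\<omega>. multiscale_stat n (V \<omega>)) \<in> borel_measurable M"
proof -
  note [measurable] = measurable_local_stat[of V M, OF assms]
  show ?thesis unfolding multiscale_stat_def
    by (intro borel_measurable_Max finite_index_pairs) (auto split: prod.split)
qed

section \<open>Subgaussian tails of the local statistics of a uniform sample\<close>

lemma fact_odd_ge: "6 ^ k * fact k \<le> (fact (2 * k + 1) :: real)"
proof (induction k)
  case (Suc k)
  have "6 ^ Suc k * fact (Suc k) = (6 * real (Suc k)) * (6 ^ k * fact k)" by simp
  also have "\<dots> \<le> (real (2 * k + 3) * real (2 * k + 2)) * fact (2 * k + 1)"
  proof (rule mult_mono[OF _ Suc])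
    have "3 * real (2 * k + 2) \<le> real (2 * k + 3) * real (2 * k + 2)" by (intro mult_right_mono) auto
    then show "6 * real (Suc k) \<le> real (2 * k + 3) * real (2 * k + 2)" by (simp add: algebra_simps)
  qed auto
  also have "\<dots> = fact (2 * Suc k + 1)" by (simp add: algebra_simps)
  finally show ?case .
qed simp

text \<open>
  Compare the power series term by term.  In other words, the uniform distribution on \<open>[-1, 1]\<close>, whose variance is
  \<open>1/3\<close>, has a moment generating function below that of the normal distribution with this variance.
\<close>

lemma sinh_le_exp: fixes t :: real assumes "t \<ge> 0" shows "sinh t \<le> t * exp (t\<^sup>2 / 6)"
proof -
  have "(\<lambda>k. (t\<^sup>2 / 6) ^ k /\<^sub>R fact k) sums exp (t\<^sup>2 / 6)" by (rule exp_converges)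
  from sums_mult[OF this, of t] have "(\<lambda>k. t * ((t\<^sup>2 / 6) ^ k /\<^sub>R fact k)) sums (t * exp (t\<^sup>2 / 6))" .
  from sums_if'[OF this] have 1: "(\<lambda>n. if even n then 0 else t * ((t\<^sup>2 / 6) ^ ((n - 1) div 2) /\<^sub>R fact ((n - 1) div 2))) sums (t * exp (t\<^sup>2 / 6))" .
  show ?thesis
  proof (rule sums_le[OF _ sinh_converges 1])
    fix n :: nat
    show "(if even n then 0 else t ^ n /\<^sub>R fact n) \<le> (if even n then 0 else t * ((t\<^sup>2 / 6) ^ ((n - 1) div 2) /\<^sub>R fact ((n - 1) div 2)))"
    proof (cases "even n")
      case False
      then obtain k where k: "n = 2 * k + 1" by (elim oddE)
      have "t ^ n / fact n \<le> t ^ n / (6 ^ k * fact k)"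
        unfolding k using fact_odd_ge[of k] assms by (intro divide_left_mono) auto
      also have "\<dots> = t * ((t\<^sup>2 / 6) ^ k / fact k)" by (simp add: k power_mult power_divide)
      finally have "t ^ n /\<^sub>R fact n \<le> t * ((t\<^sup>2 / 6) ^ k /\<^sub>R fact k)"
        by (simp only: real_scaleR_def divide_inverse mult.commute[of _ "inverse (fact _)"])
      moreover have "(n - 1) div 2 = k" by (simp add: k)
      ultimately show ?thesis using False by simp
    qed simp
  qed
qed

lemma rel_pos_mgf:
  assumes uv: "u < v"
  shows "(LBINT y:{u<..<v}. exp (t * rel_pos u v y)) \<le> exp (t\<^sup>2 / 6) * (v - u)"
proof (cases "t = 0")
  case True
  have "(LBINT y:{u<..<v}. (1::real)) = v - u" using uv by (subst integral_Ioo_FTC[where G = "\<lambda>x. x"]) auto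
  then show ?thesis using True by simp
next
  case False
  define w where "w = v - u"
  have w: "w > 0" using uv by (simp add: w_def)
  have veq: "rel_pos u v y = 2 / w * y - (u + v) / w" for y
  proof -
    have "rel_pos u v y = (2 * y - u - v) / w" using uv by (simp add: rel_pos_def w_def field_simps)
    then show ?thesis by (simp add: diff_divide_distrib add_divide_distrib)
  qed
  have "(LBINT y:{u<..<v}. exp (t * rel_pos u v y)) = w / (2 * t) * exp (t * rel_pos u v v) - w / (2 * t) * exp (t * rel_pos u v u)"
  proof (rule integral_Ioo_FTC)
    show "((\<lambda>y. w / (2 * t) * exp (t * rel_pos u v y)) has_real_derivative exp (t * rel_pos u v x)) (at x)" for x
      unfolding veq using w False by (auto intro!: derivative_eq_intros)
    show "continuous_on UNIV (\<lambda>y. exp (t * rel_pos u v y))" unfolding veq by (intro continuous_intros) (use w in auto)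
  qed (use uv in auto)
  also have "\<dots> = w / (2 * t) * (exp t - exp (- t))"
    using uv by (simp add: rel_pos_def right_diff_distrib)
  also have "\<dots> = w * (sinh \<bar>t\<bar> / \<bar>t\<bar>)" using False by (auto simp: sinh_def abs_if field_simps)
  also have "\<dots> \<le> w * exp (\<bar>t\<bar>\<^sup>2 / 6)"
    using sinh_le_exp[of "\<bar>t\<bar>"] False w by (intro mult_left_mono) (auto simp: field_simps)
  finally show ?thesis by (simp add: w_def mult.commute)
qed

abbreviation unif :: "real measure" where "unif \<equiv> uniform_measure lborel {0..1}"

lemma prob_space_unif: "prob_space unif" by (rule prob_space_uniform_measure) auto

text \<open>
  Written with comparisons of its arguments, this indicator is measurable also when the end points are random.
\<close>

definition window_ind :: "real \<Rightarrow> real \<Rightarrow> real \<Rightarrow> ennreal" where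
  "window_ind u v y = (if u < y \<and> y < v then 1 else 0)"

lemma unif_mgf:
  assumes uv: "0 \<le> u" "u < v" "v \<le> 1"
  shows "(\<integral>\<^sup>+y. window_ind u v y * ennreal (exp (t * rel_pos u v y)) \<partial>unif)
     \<le> (\<integral>\<^sup>+y. ennreal (exp (t\<^sup>2 / 6)) * window_ind u v y \<partial>unif)"
proof -
  have [measurable]: "window_ind u v \<in> borel_measurable borel" unfolding window_ind_def by measurable
  have w: "window_ind u v y = indicator {u<..<v} y" for y by (simp add: window_ind_def indicator_def)
  have "(\<integral>\<^sup>+y. ennreal (exp (t\<^sup>2 / 6)) * window_ind u v y \<partial>unif) = ennreal (exp (t\<^sup>2 / 6)) * (\<integral>\<^sup>+y. window_ind u v y \<partial>unif)"
    by (rule nn_integral_cmult) simp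
  also have "(\<integral>\<^sup>+y. window_ind u v y \<partial>unif) = emeasure lborel ({0..1} \<inter> {u<..<v})" unfolding w by (simp add: divide_ennreal_def)
  also have "{0..1} \<inter> {u<..<v} = {u<..<v}" using uv by auto
  also have "ennreal (exp (t\<^sup>2 / 6)) * emeasure lborel {u<..<v} = ennreal (exp (t\<^sup>2 / 6) * (v - u))"
    using uv by (simp add: ennreal_mult')
  finally have 1: "(\<integral>\<^sup>+y. ennreal (exp (t\<^sup>2 / 6)) * window_ind u v y \<partial>unif) = ennreal (exp (t\<^sup>2 / 6) * (v - u))" .
  have int: "set_integrable lborel {u<..<v} (\<lambda>y. exp (t * rel_pos u v y))"
    unfolding rel_pos_def by (intro set_integrable_Ioo_continuous continuous_intros) (use uv in auto)
  have "(\<integral>\<^sup>+y. window_ind u v y * ennreal (exp (t * rel_pos u v y)) \<partial>unif)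
    = (\<integral>\<^sup>+y. window_ind u v y * ennreal (exp (t * rel_pos u v y)) * indicator {0..1} y \<partial>lborel)"
    by (subst nn_integral_uniform_measure) (auto simp: divide_ennreal_def)
  also have "\<dots> = (\<integral>\<^sup>+y. ennreal (indicator {u<..<v} y * exp (t * rel_pos u v y)) \<partial>lborel)"
    using uv by (intro nn_integral_cong) (auto simp: w split: split_indicator)
  also have "\<dots> = ennreal (LBINT y:{u<..<v}. exp (t * rel_pos u v y))"
    using int unfolding set_integrable_def set_lebesgue_integral_def
    by (subst nn_integral_eq_integral) auto
  also have "\<dots> \<le> ennreal (exp (t\<^sup>2 / 6) * (v - u))" using rel_pos_mgf[OF uv(2)] by (rule ennreal_leI)
  finally show ?thesis unfolding 1 .
qed

text \<open>
  Fubini's theorem: the coordinates in \<open>A\<close> are integrated first, while \<open>D\<close>, \<open>u\<close> and \<open>v\<close> depend only on the others.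
\<close>

lemma product_nn_integral_conditional:
  fixes n :: nat and D :: "(nat \<Rightarrow> real) \<Rightarrow> bool" and u v :: "(nat \<Rightarrow> real) \<Rightarrow> real"
    and G :: "real \<Rightarrow> real \<Rightarrow> real \<Rightarrow> ennreal"
  defines "P \<equiv> uniform_sample n"
  assumes A: "A \<subseteq> {..<n}"
    and D [measurable]: "Measurable.pred P D"
    and G1 [measurable]: "\<And>i. i \<in> A \<Longrightarrow> (\<lambda>x. G (u x) (v x) (x i)) \<in> borel_measurable P"
    and G2 [measurable]: "\<And>a b. G a b \<in> borel_measurable borel"
    and dep: "\<And>x y. (\<And>i. i \<in> {..<n} - A \<Longrightarrow> x i = y i) \<Longrightarrow> D x = D y \<and> u x = u y \<and> v x = v y"
  shows "(\<integral>\<^sup>+x. (if D x then 1 else 0) * (\<Prod>i\<in>A. G (u x) (v x) (x i)) \<partial>P) =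
     (\<integral>\<^sup>+x. (if D x then 1 else 0) * (\<Prod>i\<in>A. (\<integral>\<^sup>+y. G (u x) (v x) y \<partial>unif)) \<partial>PiM ({..<n} - A) (\<lambda>_. unif))"
proof -
  interpret U: prob_space unif by (rule prob_space_unif)
  interpret product_sigma_finite "\<lambda>_::nat. unif" by standard
  define B where "B = {..<n} - A"
  have AB: "B \<inter> A = {}" "finite B" "finite A" "B \<union> A = {..<n}"
    using A finite_subset by (auto simp: B_def)
  have P: "P = PiM (B \<union> A) (\<lambda>_. unif)" by (simp add: P_def uniform_sample_def AB)
  have "(\<integral>\<^sup>+x. (if D x then 1 else 0) * (\<Prod>i\<in>A. G (u x) (v x) (x i)) \<partial>P) =
     (\<integral>\<^sup>+x. (\<integral>\<^sup>+y. (if D (merge B A (x, y)) then 1 else 0) * (\<Prod>i\<in>A. G (u (merge B A (x, y))) (v (merge B A (x, y))) (merge B A (x, y) i)) \<partial>PiM A (\<lambda>_. unif)) \<partial>PiM B (\<lambda>_. unif))"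
    unfolding P
  proof (rule product_nn_integral_fold[OF AB(1-3)])
    show "(\<lambda>x. (if D x then 1 else 0) * (\<Prod>i\<in>A. G (u x) (v x) (x i))) \<in> borel_measurable (PiM (B \<union> A) (\<lambda>_. unif))"
      unfolding P[symmetric] by (intro borel_measurable_times_ennreal borel_measurable_prod_ennreal) measurable
  qed
  also have "\<dots> = (\<integral>\<^sup>+x. (if D x then 1 else 0) * (\<Prod>i\<in>A. (\<integral>\<^sup>+y. G (u x) (v x) y \<partial>unif)) \<partial>PiM B (\<lambda>_. unif))"
  proof (rule nn_integral_cong)
    fix x :: "nat \<Rightarrow> real"
    have d: "D (merge B A (x, y)) = D x \<and> u (merge B A (x, y)) = u x \<and> v (merge B A (x, y)) = v x" for y
      by (rule dep) (auto simp: merge_def B_def)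
    have mA: "merge B A (x, y) i = y i" if "i \<in> A" for y i using that by (auto simp: merge_def B_def)
    have "(\<integral>\<^sup>+y. (if D (merge B A (x, y)) then 1 else 0) * (\<Prod>i\<in>A. G (u (merge B A (x, y))) (v (merge B A (x, y))) (merge B A (x, y) i)) \<partial>PiM A (\<lambda>_. unif))
      = (\<integral>\<^sup>+y. (if D x then 1 else 0) * (\<Prod>i\<in>A. G (u x) (v x) (y i)) \<partial>PiM A (\<lambda>_. unif))"
      by (intro nn_integral_cong) (simp add: d mA)
    also have "\<dots> = (if D x then 1 else 0) * (\<integral>\<^sup>+y. (\<Prod>i\<in>A. G (u x) (v x) (y i)) \<partial>PiM A (\<lambda>_. unif))"
      by (intro nn_integral_cmult borel_measurable_prod_ennreal measurable_PiM_component_rev) auto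
    also have "(\<integral>\<^sup>+y. (\<Prod>i\<in>A. G (u x) (v x) (y i)) \<partial>PiM A (\<lambda>_. unif)) = (\<Prod>i\<in>A. (\<integral>\<^sup>+y. G (u x) (v x) y \<partial>unif))"
      by (rule product_nn_integral_prod) (use AB in auto)
    finally show "(\<integral>\<^sup>+y. (if D (merge B A (x, y)) then 1 else 0) * (\<Prod>i\<in>A. G (u (merge B A (x, y))) (v (merge B A (x, y))) (merge B A (x, y) i)) \<partial>PiM A (\<lambda>_. unif))
      = (if D x then 1 else 0) * (\<Prod>i\<in>A. (\<integral>\<^sup>+y. G (u x) (v x) y \<partial>unif))" .
  qed
  finally show ?thesis by (simp add: B_def)
qed

lemma uniform_sample_coord [measurable]:
  "i < n \<Longrightarrow> (\<lambda>x. x i) \<in> borel_measurable (uniform_sample n)"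
  unfolding uniform_sample_def by (intro measurable_PiM_component_rev) (auto simp: measurable_ident_sets)

text \<open>
  Given the coordinates outside \<open>A\<close>, those in \<open>A\<close> are independent, and uniform on \<open>(u, v)\<close> once they are known
  to lie there.  The inequality of conditional expectations is multiplied by the probability of the condition, and no
  conditional probability has to be formed.
\<close>

lemma conditional_mgf:
  fixes n :: nat and D :: "(nat \<Rightarrow> real) \<Rightarrow> bool" and u v :: "(nat \<Rightarrow> real) \<Rightarrow> real"
  defines "P \<equiv> uniform_sample n"
  assumes A: "A \<subseteq> {..<n}"
    and D [measurable]: "Measurable.pred P D" and um [measurable]: "u \<in> borel_measurable P" "v \<in> borel_measurable P"
    and dep: "\<And>x y. (\<And>i. i \<in> {..<n} - A \<Longrightarrow> x i = y i) \<Longrightarrow> D x = D y \<and> u x = u y \<and> v x = v y"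
    and uv: "\<And>x. D x \<Longrightarrow> 0 \<le> u x \<and> u x < v x \<and> v x \<le> 1"
  shows "(\<integral>\<^sup>+x. (if D x then 1 else 0) * (\<Prod>i\<in>A. window_ind (u x) (v x) (x i) * ennreal (exp (t * rel_pos (u x) (v x) (x i)))) \<partial>P)
    \<le> ennreal (exp (t\<^sup>2 / 6 * card A)) * (\<integral>\<^sup>+x. (if D x then 1 else 0) * (\<Prod>i\<in>A. window_ind (u x) (v x) (x i)) \<partial>P)"
proof -
  have [measurable]: "(\<lambda>x. x i) \<in> borel_measurable P" if "i \<in> A" for i
    unfolding P_def using that A by (intro uniform_sample_coord) auto
  have w [measurable]: "(\<lambda>x. window_ind (u x) (v x) (x i)) \<in> borel_measurable P" if "i \<in> A" for i
    using that unfolding window_ind_def by measurable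
  have w2 [measurable]: "window_ind a b \<in> borel_measurable borel" for a b unfolding window_ind_def by measurable
  have r [measurable]: "(\<lambda>x. rel_pos (u x) (v x) (x i)) \<in> borel_measurable P" if "i \<in> A" for i
    using that unfolding rel_pos_def by measurable
  have "(\<integral>\<^sup>+x. (if D x then 1 else 0) * (\<Prod>i\<in>A. window_ind (u x) (v x) (x i) * ennreal (exp (t * rel_pos (u x) (v x) (x i)))) \<partial>P)
     = (\<integral>\<^sup>+x. (if D x then 1 else 0) * (\<Prod>i\<in>A. (\<integral>\<^sup>+y. window_ind (u x) (v x) y * ennreal (exp (t * rel_pos (u x) (v x) y)) \<partial>unif)) \<partial>PiM ({..<n} - A) (\<lambda>_. unif))"
  proof (rule product_nn_integral_conditional[where G = "\<lambda>a b y. window_ind a b y * ennreal (exp (t * rel_pos a b y))" and u = u and v = v and D = D, OF A, folded P_def])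
    show "(\<lambda>x. window_ind (u x) (v x) (x i) * ennreal (exp (t * rel_pos (u x) (v x) (x i)))) \<in> borel_measurable P" if "i \<in> A" for i
      using w[OF that] r[OF that] by measurable
    show "(\<lambda>y. window_ind a b y * ennreal (exp (t * rel_pos a b y))) \<in> borel_measurable borel" for a b
      by measurable
  qed (rule D, rule dep)
  also have "\<dots> \<le> (\<integral>\<^sup>+x. (if D x then 1 else 0) * (\<Prod>i\<in>A. (\<integral>\<^sup>+y. ennreal (exp (t\<^sup>2 / 6)) * window_ind (u x) (v x) y \<partial>unif)) \<partial>PiM ({..<n} - A) (\<lambda>_. unif))"
  proof (rule nn_integral_mono)
    fix x :: "nat \<Rightarrow> real"
    show "(if D x then 1 else 0) * (\<Prod>i\<in>A. (\<integral>\<^sup>+y. window_ind (u x) (v x) y * ennreal (exp (t * rel_pos (u x) (v x) y)) \<partial>unif))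
      \<le> (if D x then 1 else 0) * (\<Prod>i\<in>A. (\<integral>\<^sup>+y. ennreal (exp (t\<^sup>2 / 6)) * window_ind (u x) (v x) y \<partial>unif))"
      using unif_mgf[of "u x" "v x" t] uv[of x] by (cases "D x") (auto simp: power_mono)
  qed
  also have "\<dots> = (\<integral>\<^sup>+x. (if D x then 1 else 0) * (\<Prod>i\<in>A. ennreal (exp (t\<^sup>2 / 6)) * window_ind (u x) (v x) (x i)) \<partial>P)"
  proof (rule product_nn_integral_conditional[where G = "\<lambda>a b y. ennreal (exp (t\<^sup>2 / 6)) * window_ind a b y" and u = u and v = v and D = D, OF A, folded P_def, symmetric])
    show "(\<lambda>x. ennreal (exp (t\<^sup>2 / 6)) * window_ind (u x) (v x) (x i)) \<in> borel_measurable P" if "i \<in> A" for i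
      using w[OF that] by measurable
    show "(\<lambda>y. ennreal (exp (t\<^sup>2 / 6)) * window_ind a b y) \<in> borel_measurable borel" for a b
      by measurable
  qed (rule D, rule dep)
  also have "\<dots> = (\<integral>\<^sup>+x. ennreal (exp (t\<^sup>2 / 6 * card A)) * ((if D x then 1 else 0) * (\<Prod>i\<in>A. window_ind (u x) (v x) (x i))) \<partial>P)"
  proof -
    have "ennreal (exp (t\<^sup>2 / 6)) ^ card A = ennreal (exp (t\<^sup>2 / 6 * card A))"
      unfolding exp_of_nat2_mult by (simp add: ennreal_power)
    then show ?thesis by (intro nn_integral_cong) (simp add: prod.distrib mult.left_commute)
  qed
  also have "\<dots> = ennreal (exp (t\<^sup>2 / 6 * card A)) * (\<integral>\<^sup>+x. (if D x then 1 else 0) * (\<Prod>i\<in>A. window_ind (u x) (v x) (x i)) \<partial>P)"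
    by (intro nn_integral_cmult borel_measurable_times_ennreal borel_measurable_prod_ennreal) measurable
  finally show ?thesis .
qed

lemma conditional_tail:
  fixes n :: nat and D :: "(nat \<Rightarrow> real) \<Rightarrow> bool" and u v :: "(nat \<Rightarrow> real) \<Rightarrow> real"
  defines "P \<equiv> uniform_sample n"
  assumes A: "A \<subseteq> {..<n}" "card A > 0"
    and D [measurable]: "Measurable.pred P D" and um [measurable]: "u \<in> borel_measurable P" "v \<in> borel_measurable P"
    and dep: "\<And>x y. (\<And>i. i \<in> {..<n} - A \<Longrightarrow> x i = y i) \<Longrightarrow> D x = D y \<and> u x = u y \<and> v x = v y"
    and uv: "\<And>x. D x \<Longrightarrow> 0 \<le> u x \<and> u x < v x \<and> v x \<le> 1"
    and z: "z \<ge> 0"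
  defines "E \<equiv> {x \<in> space P. D x \<and> (\<forall>i\<in>A. u x < x i \<and> x i < v x)}"
  shows "E \<in> sets P"
    "{x \<in> E. z * sqrt (card A / 3) < \<bar>\<Sum>i\<in>A. rel_pos (u x) (v x) (x i)\<bar>} \<in> sets P"
    "measure P {x \<in> E. z * sqrt (card A / 3) < \<bar>\<Sum>i\<in>A. rel_pos (u x) (v x) (x i)\<bar>} \<le> 2 * exp (- z\<^sup>2 / 2) * measure P E"
proof -
  interpret prob_space P unfolding P_def uniform_sample_def
    by (intro prob_space_PiM prob_space_unif)
  have fA: "finite A" using A(2) card_ge_0_finite by blast
  have c [measurable]: "(\<lambda>x. x i) \<in> borel_measurable P" if "i \<in> A" for i
    unfolding P_def using that A by (intro uniform_sample_coord) auto
  have r [measurable]: "(\<lambda>x. rel_pos (u x) (v x) (x i)) \<in> borel_measurable P" if "i \<in> A" for i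
    using that unfolding rel_pos_def by measurable
  define S where "S x = (\<Sum>i\<in>A. rel_pos (u x) (v x) (x i))" for x
  have S [measurable]: "S \<in> borel_measurable P" unfolding S_def by measurable
  show E [measurable]: "E \<in> sets P" unfolding E_def using fA by measurable
  have "{x \<in> E. z * sqrt (card A / 3) < \<bar>S x\<bar>} = E \<inter> {x \<in> space P. z * sqrt (card A / 3) < \<bar>S x\<bar>}"
    by (auto simp: E_def)
  also have "\<dots> \<in> sets P" by measurable
  finally show "{x \<in> E. z * sqrt (card A / 3) < \<bar>\<Sum>i\<in>A. rel_pos (u x) (v x) (x i)\<bar>} \<in> sets P"
    by (simp add: S_def)
  define m where "m = real (card A)"
  have m: "m > 0" using A by (simp add: m_def)
  define y where "y = z * sqrt (m / 3)"
  have wE: "(if D x then 1 else 0) * (\<Prod>i\<in>A. window_ind (u x) (v x) (x i)) = (indicator E x :: ennreal)" if "x \<in> space P" for x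
  proof (cases "\<forall>i\<in>A. u x < x i \<and> x i < v x")
    case True
    then show ?thesis using that by (auto simp: window_ind_def E_def indicator_def)
  next
    case False
    then obtain i where "i \<in> A" "window_ind (u x) (v x) (x i) = 0" by (auto simp: window_ind_def)
    then have "(\<Prod>i\<in>A. window_ind (u x) (v x) (x i)) = 0" using fA by (intro prod_zero) auto
    then show ?thesis using False by (auto simp: E_def)
  qed
  have one: "measure P {x \<in> E. y < \<tau> * S x} \<le> exp (- z\<^sup>2 / 2) * measure P E" if \<tau>: "\<tau> = 1 \<or> \<tau> = -1" for \<tau>
  proof -
    \<comment> \<open>The minimiser of the exponent \<open>s\<^sup>2 * m / 6 - s * y\<close>.\<close>
    define s where "s = 3 * y / m"
    have s0: "s \<ge> 0" using m z by (simp add: s_def y_def)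
    have set: "{x \<in> E. y < \<tau> * S x} = E \<inter> {x \<in> space P. y < \<tau> * S x}" by (auto simp: E_def)
    have [measurable]: "{x \<in> E. y < \<tau> * S x} \<in> sets P" unfolding set by measurable
    have "emeasure P {x \<in> E. y < \<tau> * S x} = (\<integral>\<^sup>+x. indicator {x \<in> E. y < \<tau> * S x} x \<partial>P)" by simp
    also have "\<dots> \<le> (\<integral>\<^sup>+x. ennreal (exp (- s * y)) * ((if D x then 1 else 0) *
        (\<Prod>i\<in>A. window_ind (u x) (v x) (x i) * ennreal (exp (s * \<tau> * rel_pos (u x) (v x) (x i))))) \<partial>P)"
    proof (rule nn_integral_mono)
      fix x assume x: "x \<in> space P"
      have "(if D x then 1 else 0) * (\<Prod>i\<in>A. window_ind (u x) (v x) (x i) * ennreal (exp (s * \<tau> * rel_pos (u x) (v x) (x i))))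
        = indicator E x * ennreal (exp (s * (\<tau> * S x)))"
        unfolding prod.distrib mult.assoc[symmetric] wE[OF x]
        using fA by (simp add: prod_ennreal S_def exp_sum[symmetric] sum_distrib_left mult.assoc)
      moreover have "indicator {x \<in> E. y < \<tau> * S x} x \<le> ennreal (exp (- s * y)) * (indicator E x * ennreal (exp (s * (\<tau> * S x))))"
      proof (cases "x \<in> E \<and> y < \<tau> * S x")
        case True
        then have "s * y \<le> s * (\<tau> * S x)" using s0 by (intro mult_left_mono) auto
        then have "1 \<le> exp (- s * y) * exp (s * (\<tau> * S x))" by (simp flip: exp_add)
        then have "ennreal 1 \<le> ennreal (exp (- s * y) * exp (s * (\<tau> * S x)))" by (rule ennreal_leI)
        then show ?thesis using True by (simp add: ennreal_mult')
      qed auto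
      ultimately show "indicator {x \<in> E. y < \<tau> * S x} x \<le> ennreal (exp (- s * y)) * ((if D x then 1 else 0) *
        (\<Prod>i\<in>A. window_ind (u x) (v x) (x i) * ennreal (exp (s * \<tau> * rel_pos (u x) (v x) (x i)))))" by simp
    qed
    also have "\<dots> = ennreal (exp (- s * y)) * (\<integral>\<^sup>+x. ((if D x then 1 else 0) *
        (\<Prod>i\<in>A. window_ind (u x) (v x) (x i) * ennreal (exp (s * \<tau> * rel_pos (u x) (v x) (x i))))) \<partial>P)"
    proof -
      have [measurable]: "(\<lambda>x. window_ind (u x) (v x) (x i)) \<in> borel_measurable P" if "i \<in> A" for i
        using that unfolding window_ind_def by measurable
      show ?thesis
        by (intro nn_integral_cmult borel_measurable_times_ennreal borel_measurable_prod_ennreal) measurable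
    qed
    also have "\<dots> \<le> ennreal (exp (- s * y)) * (ennreal (exp ((s * \<tau>)\<^sup>2 / 6 * card A)) * (\<integral>\<^sup>+x. (if D x then 1 else 0) * (\<Prod>i\<in>A. window_ind (u x) (v x) (x i)) \<partial>P))"
      by (rule mult_left_mono[OF conditional_mgf[where D = D and u = u and v = v, OF A(1), folded P_def, OF D um dep uv]]) simp_all
    also have "(\<integral>\<^sup>+x. (if D x then 1 else 0) * (\<Prod>i\<in>A. window_ind (u x) (v x) (x i)) \<partial>P) = emeasure P E"
      by (subst nn_integral_cong[OF wE]) auto
    also have "ennreal (exp (- s * y)) * (ennreal (exp ((s * \<tau>)\<^sup>2 / 6 * card A)) * emeasure P E)
       = ennreal (exp (- z\<^sup>2 / 2) * measure P E)"
    proof -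
      have y2: "y\<^sup>2 = z\<^sup>2 * (m / 3)" using m by (simp add: y_def power_mult_distrib)
      have "- s * y + s\<^sup>2 / 6 * m = - (3 / 2) * (y\<^sup>2 / m)" using m by (simp add: s_def power2_eq_square field_simps)
      also have "\<dots> = - z\<^sup>2 / 2" using m by (simp add: y2)
      finally have "exp (- s * y) * exp (s\<^sup>2 / 6 * m) = exp (- z\<^sup>2 / 2)" by (simp flip: exp_add)
      moreover have "(s * \<tau>)\<^sup>2 = s\<^sup>2" using \<tau> by (auto simp: power_mult_distrib)
      ultimately show ?thesis
        by (simp add: emeasure_eq_measure m_def[symmetric] mult.assoc[symmetric] flip: ennreal_mult')
    qed
    finally show ?thesis by (simp add: emeasure_eq_measure)
  qed
  have "measure P {x \<in> E. y < \<bar>S x\<bar>} \<le> measure P ({x \<in> E. y < 1 * S x} \<union> {x \<in> E. y < - 1 * S x})"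
  proof (rule finite_measure_mono)
    have "{x \<in> E. y < 1 * S x} \<union> {x \<in> E. y < - 1 * S x} = E \<inter> {x \<in> space P. y < S x \<or> y < - S x}" by (auto simp: E_def)
    also have "\<dots> \<in> sets P" by measurable
    finally show "{x \<in> E. y < 1 * S x} \<union> {x \<in> E. y < - 1 * S x} \<in> sets P" .
  qed auto
  also have "\<dots> \<le> measure P {x \<in> E. y < 1 * S x} + measure P {x \<in> E. y < - 1 * S x}"
  proof (rule measure_Un_le)
    have "{x \<in> E. y < \<tau> * S x} \<in> sets P" for \<tau>
    proof -
      have "{x \<in> E. y < \<tau> * S x} = E \<inter> {x \<in> space P. y < \<tau> * S x}" by (auto simp: E_def)
      also have "\<dots> \<in> sets P" by measurable
      finally show ?thesis .
    qed
    from this[of 1] this[of "-1"]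
    show "{x \<in> E. y < 1 * S x} \<in> sets P" "{x \<in> E. y < - 1 * S x} \<in> sets P" .
  qed
  also have "\<dots> \<le> 2 * exp (- z\<^sup>2 / 2) * measure P E" using one[of 1] one[of "-1"] by simp
  finally show "measure P {x \<in> E. z * sqrt (card A / 3) < \<bar>\<Sum>i\<in>A. rel_pos (u x) (v x) (x i)\<bar>} \<le> 2 * exp (- z\<^sup>2 / 2) * measure P E"
    by (simp add: S_def y_def m_def)
qed

lemma prob_space_uniform_sample: "prob_space (uniform_sample n)"
  unfolding uniform_sample_def by (intro prob_space_PiM prob_space_unif)

lemma distr_uniform_coord:
  assumes "i < n" "sets N = sets borel"
  shows "distr (uniform_sample n) N (\<lambda>x. x i) = unif"
proof -
  have "distr (uniform_sample n) N (\<lambda>x. x i) = distr (uniform_sample n) unif (\<lambda>x. x i)"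
    using assms by (intro distr_cong) auto
  also have "\<dots> = unif"
    unfolding uniform_sample_def using assms by (intro distr_PiM_component prob_space_unif) auto
  finally show ?thesis .
qed

lemma uniform_coord_distributed:
  assumes "i < n"
  shows "distributed (uniform_sample n) lborel (\<lambda>x. x i) (\<lambda>x. ennreal (indicator {0..1} x))"
  unfolding distributed_def
proof (intro conjI)
  have "unif = density lborel (\<lambda>x. ennreal (indicator {0..1} x))"
    unfolding uniform_measure_def
    by (intro density_cong) (auto simp: divide_ennreal_def split: split_indicator)
  then show "distr (uniform_sample n) lborel (\<lambda>x. x i) = density lborel (\<lambda>x. ennreal (indicator {0..1} x))"
    using distr_uniform_coord[OF assms, of lborel] by simp
qed (use uniform_sample_coord[OF assms] in auto)

lemma uniform_coord_indep:
  assumes "n > 0"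
  shows "prob_space.indep_vars (uniform_sample n) (\<lambda>_. borel) (\<lambda>i x. x i) {..<n}"
proof -
  interpret prob_space "uniform_sample n" by (rule prob_space_uniform_sample)
  have "distr (uniform_sample n) (PiM {..<n} (\<lambda>_. borel)) (\<lambda>x. \<lambda>i\<in>{..<n}. x i)
     = distr (uniform_sample n) (uniform_sample n) (\<lambda>x. x)"
  proof (rule distr_cong)
    show "sets (PiM {..<n} (\<lambda>_. borel)) = sets (uniform_sample n)"
      unfolding uniform_sample_def by (intro sets_PiM_cong) auto
    show "(\<lambda>i\<in>{..<n}. x i) = x" if "x \<in> space (uniform_sample n)" for x
      using that by (auto simp: uniform_sample_def space_PiM PiE_def extensional_def)
  qed simp
  also have "\<dots> = uniform_sample n" by (rule distr_id)
  also have "\<dots> = PiM {..<n} (\<lambda>i. distr (uniform_sample n) borel (\<lambda>x. x i))"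
    unfolding uniform_sample_def[of n] using distr_uniform_coord[of _ n borel, unfolded uniform_sample_def]
    by (intro PiM_cong) auto
  finally show ?thesis
    using assms by (subst indep_vars_iff_distr_eq_PiM') auto
qed

text \<open>
  Almost surely all points of the sample with its end points 0 and 1 are distinct, and then the extended vector is
  strictly increasing.
\<close>

definition generic :: "nat \<Rightarrow> (nat \<Rightarrow> real) \<Rightarrow> bool" where
  "generic n y \<longleftrightarrow> inj_on y {..<n} \<and> (\<forall>i<n. 0 < y i \<and> y i < 1)"

lemma AE_generic: "AE x in uniform_sample n. generic n x"
proof (cases "n = 0")
  case False
  interpret prob_space "uniform_sample n" by (rule prob_space_uniform_sample)
  have 1: "AE x in uniform_sample n. inj_on (\<lambda>i. x i) {..<n}"
    using False by (intro AE_indep_inj[OF _ uniform_coord_indep uniform_coord_distributed]) auto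
  have m1: "mass (indicator {0..1}) {0..1::real} = 1"
    by (simp add: mass_def set_lebesgue_integral_def flip: indicator_inter_arith)
  have "AE x in uniform_sample n. \<forall>i\<in>{..<n}. x i \<in> {0..1} \<and> x i \<noteq> 0 \<and> x i \<noteq> 1"
  proof (intro AE_finite_allI)
    fix i assume "i \<in> {..<n}"
    then have D: "distributed (uniform_sample n) lborel (\<lambda>x. x i) (\<lambda>x. ennreal (indicator {0..1} x))"
      by (intro uniform_coord_distributed) auto
    have "AE x in unif. x \<in> {0..1}" by (rule AE_uniform_measureI) auto
    then have "AE x in distr (uniform_sample n) borel (\<lambda>x. x i). x \<in> {0..1}"
      using distr_uniform_coord[of i n borel] \<open>i \<in> {..<n}\<close> by (metis lessThan_iff)
    then have "AE x in uniform_sample n. x i \<in> {0..1}"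
      using \<open>i \<in> {..<n}\<close> by (subst (asm) AE_distr_iff) auto
    with AE_distributed_neq_const[OF D, of 0] AE_distributed_neq_const[OF D, of 1]
    show "AE x in uniform_sample n. x i \<in> {0..1} \<and> x i \<noteq> 0 \<and> x i \<noteq> 1" by eventually_elim auto
  qed simp
  with 1 show ?thesis
    by eventually_elim (force simp: generic_def less_le)
qed (simp add: generic_def)

text \<open>
  The end points 0 and 1 figure as coordinates \<open>n\<close> and \<open>n + 1\<close>, so that the bounding order statistics of a local
  statistic need no case distinction.
\<close>

definition ext_coord :: "nat \<Rightarrow> (nat \<Rightarrow> real) \<Rightarrow> nat \<Rightarrow> real" where
  "ext_coord n y p = (if p < n then y p else if p = n then 0 else 1)"

abbreviation unif_list :: "nat \<Rightarrow> (nat \<Rightarrow> real) \<Rightarrow> real list" where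
  "unif_list n y \<equiv> ext_list (Some 0) (Some 1) n y"

lemma unif_list_facts:
  assumes "generic n y"
  shows "sorted_wrt (<) (unif_list n y)" "length (unif_list n y) = n + 2"
    "set (unif_list n y) = ext_coord n y ` {..<n+2}" "inj_on (ext_coord n y) {..<n+2}"
proof -
  show "sorted_wrt (<) (unif_list n y)"
    using assms by (intro strict_sorted_ext_list) (auto simp: generic_def)
  show "length (unif_list n y) = n + 2"
    using length_ext_list[of "Some 0" "Some 1" n y] by (simp add: sample_size_def)
  have "{..<n+2} = {..<n} \<union> {n, n+1}" by auto
  then show "set (unif_list n y) = ext_coord n y ` {..<n+2}"
    unfolding set_ext_list by (auto simp: ext_coord_def image_Un)
  show "inj_on (ext_coord n y) {..<n+2}"
    using assms unfolding generic_def ext_coord_def inj_on_def by (auto split: if_splits)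
qed

lemma strict_sorted_rank:
  fixes zs :: "real list"
  assumes zs: "sorted_wrt (<) zs" and j: "j < length zs"
  shows "card {z \<in> set zs. z < zs ! j} = j"
proof -
  have less: "zs ! i < zs ! i' \<longleftrightarrow> i < i'" if "i < length zs" "i' < length zs" for i i'
    using that sorted_wrt_nth_less[OF zs, of i i'] sorted_wrt_nth_less[OF zs, of i' i]
    by (cases i i' rule: linorder_cases) auto
  have "{z \<in> set zs. z < zs ! j} = (!) zs ` {..<j}"
  proof (intro set_eqI iffI)
    fix z assume "z \<in> {z \<in> set zs. z < zs ! j}"
    then obtain i where "i < length zs" "zs ! i = z" "zs ! i < zs ! j" by (auto simp: in_set_conv_nth)
    then show "z \<in> (!) zs ` {..<j}" using less j by auto
  qed (use less j in auto)
  moreover have "inj_on ((!) zs) {..<j}"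
    using zs j by (auto simp: inj_on_def strict_sorted_iff nth_eq_iff_index_eq)
  ultimately show ?thesis by (simp add: card_image)
qed

text \<open>
  The coordinates \<open>p\<close> and \<open>q\<close> carry the order statistics with indices \<open>j\<close> and \<open>k\<close>, and \<open>A\<close> is the set of coordinates
  between them.  The predicate collects the conditions on coordinates outside \<open>A\<close>; that those in \<open>A\<close> lie between is
  added in \<open>pattern_event\<close>.  Fubini's theorem needs this separation.
\<close>

definition between_pattern :: "nat \<Rightarrow> nat \<Rightarrow> nat \<times> nat \<times> nat set \<Rightarrow> (nat \<Rightarrow> real) \<Rightarrow> bool" where
  "between_pattern n j = (\<lambda>(p, q, A) y.
     0 \<le> ext_coord n y p \<and> ext_coord n y p < ext_coord n y q \<and> ext_coord n y q \<le> 1 \<and>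
     (\<forall>i\<in>{..<n+2} - A. \<not> (ext_coord n y p < ext_coord n y i \<and> ext_coord n y i < ext_coord n y q)) \<and>
     card {i \<in> {..<n+2} - A. ext_coord n y i < ext_coord n y p} = j)"

definition patterns :: "nat \<Rightarrow> nat \<Rightarrow> (nat \<times> nat \<times> nat set) set" where
  "patterns n m = {(p, q, A). p < n + 2 \<and> q < n + 2 \<and> A \<subseteq> {..<n} \<and> p \<notin> A \<and> q \<notin> A \<and> card A = m}"

lemma finite_patterns: "finite (patterns n m)"
  by (rule finite_subset[of _ "{..<n+2} \<times> {..<n+2} \<times> Pow {..<n}"]) (auto simp: patterns_def)

lemma measurable_ext_coord [measurable]: "(\<lambda>x. ext_coord n x p) \<in> borel_measurable (uniform_sample n)"
  unfolding ext_coord_def by (cases "p < n") auto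

lemma measurable_between_pattern: "Measurable.pred (uniform_sample n) (between_pattern n j (p, q, A))"
proof -
  have "card {i \<in> {..<n+2} - A. ext_coord n y i < ext_coord n y p}
     = (\<Sum>i\<in>{..<n+2} - A. if ext_coord n y i < ext_coord n y p then 1 else 0)" for y
    by (simp add: sum.If_cases Int_def)
  then show ?thesis unfolding between_pattern_def by (simp only: prod.case) measurable
qed

lemma between_pattern_cong:
  assumes "\<And>i. i \<in> {..<n} - A \<Longrightarrow> x i = y i" "p \<notin> A" "q \<notin> A"
  shows "between_pattern n j (p, q, A) x = between_pattern n j (p, q, A) y"
    "ext_coord n x p = ext_coord n y p" "ext_coord n x q = ext_coord n y q"
proof -
  have e: "ext_coord n x i = ext_coord n y i" if "i \<notin> A" for i
    using that assms(1)[of i] by (auto simp: ext_coord_def)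
  show "ext_coord n x p = ext_coord n y p" "ext_coord n x q = ext_coord n y q" using e assms by auto
  have "{i \<in> {..<n+2} - A. ext_coord n x i < ext_coord n y p} = {i \<in> {..<n+2} - A. ext_coord n y i < ext_coord n y p}"
    using e by auto
  then show "between_pattern n j (p, q, A) x = between_pattern n j (p, q, A) y"
    unfolding between_pattern_def using e assms by auto
qed

definition pattern_event :: "nat \<Rightarrow> nat \<Rightarrow> nat \<times> nat \<times> nat set \<Rightarrow> (nat \<Rightarrow> real) set" where
  "pattern_event n j = (\<lambda>(p, q, A). {x \<in> space (uniform_sample n). between_pattern n j (p, q, A) x \<and>
      (\<forall>i\<in>A. ext_coord n x p < x i \<and> x i < ext_coord n x q)})"

text \<open>
  The coordinate \<open>p\<close> is determined by its rank \<open>j\<close>, then \<open>q\<close> by the number \<open>m\<close> of points between \<open>p\<close> and \<open>q\<close>, and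
  \<open>A\<close> consists of these points.
\<close>

lemma pattern_event_unique:
  assumes gen: "generic n x" and P: "(p, q, A) \<in> patterns n m" "(p', q', A') \<in> patterns n m"
    and x: "x \<in> pattern_event n j (p, q, A)" "x \<in> pattern_event n j (p', q', A')"
  shows "(p, q, A) = (p', q', A')"
proof -
  define e where "e = ext_coord n x"
  have inj: "inj_on e {..<n+2}" unfolding e_def by (rule unif_list_facts(4)[OF gen])
  have finm: "card A = m" "card A' = m" "A \<subseteq> {..<n}" "A' \<subseteq> {..<n}" "p < n + 2" "q < n + 2" "p' < n + 2" "q' < n + 2"
    using P by (auto simp: patterns_def)
  have rank: "card {i \<in> {..<n+2}. e i < e r} = j"
    and betw: "B = {i \<in> {..<n+2}. e r < e i \<and> e i < e s}" "e r < e s"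
    if "(r, s, B) \<in> patterns n m" "x \<in> pattern_event n j (r, s, B)" for r s B
  proof -
    have B: "B \<subseteq> {..<n}" and eB: "\<And>i. i \<in> B \<Longrightarrow> e i = x i"
      using that by (auto simp: patterns_def e_def ext_coord_def)
    have xb: "between_pattern n j (r, s, B) x" "\<And>i. i \<in> B \<Longrightarrow> e r < e i \<and> e i < e s"
      using that eB by (auto simp: pattern_event_def e_def)
    have "{i \<in> {..<n+2}. e i < e r} = {i \<in> {..<n+2} - B. e i < e r}"
      using xb(2) by force
    then show "card {i \<in> {..<n+2}. e i < e r} = j"
      using xb(1) by (simp add: between_pattern_def e_def)
    show "e r < e s" using xb(1) by (simp add: between_pattern_def e_def)
    show "B = {i \<in> {..<n+2}. e r < e i \<and> e i < e s}"
      using xb B by (auto simp: between_pattern_def e_def)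
  qed
  have pp: "e p = e p'"
  proof (rule ccontr)
    have *: False if "e r < e r'" "r < n + 2" "card {i \<in> {..<n+2}. e i < e r} = j" "card {i \<in> {..<n+2}. e i < e r'} = j" for r r'
    proof -
      have "{i \<in> {..<n+2}. e i < e r} \<subset> {i \<in> {..<n+2}. e i < e r'}" using that by force
      then have "card {i \<in> {..<n+2}. e i < e r} < card {i \<in> {..<n+2}. e i < e r'}" by (intro psubset_card_mono) auto
      with that show False by simp
    qed
    assume "e p \<noteq> e p'"
    with *[of p p'] *[of p' p] rank[OF P(1) x(1)] rank[OF P(2) x(2)] finm show False by linarith
  qed
  then have p: "p = p'" using inj finm by (auto simp: inj_on_def)
  have "e q = e q'"
  proof (rule ccontr)
    have *: False if "e r < e s" "e s < e s'" "s < n + 2"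
      "card {i \<in> {..<n+2}. e r < e i \<and> e i < e s} = m" "card {i \<in> {..<n+2}. e r < e i \<and> e i < e s'} = m" for r s s'
    proof -
      have "{i \<in> {..<n+2}. e r < e i \<and> e i < e s} \<subset> {i \<in> {..<n+2}. e r < e i \<and> e i < e s'}" using that by force
      then have "card {i \<in> {..<n+2}. e r < e i \<and> e i < e s} < card {i \<in> {..<n+2}. e r < e i \<and> e i < e s'}"
        by (intro psubset_card_mono) auto
      with that show False by simp
    qed
    assume "e q \<noteq> e q'"
    with *[of p q q'] *[of p q' q] betw[OF P(1) x(1)] betw[OF P(2) x(2)] finm p show False
      by (metis linorder_neqE_linordered_idom)
  qed
  then have "q = q'" using inj finm by (auto simp: inj_on_def)
  with p betw(1)[OF P(1) x(1)] betw(1)[OF P(2) x(2)] show ?thesis by simp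
qed

lemma pattern_event_exists:
  assumes gen: "generic n x" and x: "x \<in> space (uniform_sample n)" and jk: "j < k" "k \<le> n + 1"
  shows "\<exists>p q A. (p, q, A) \<in> patterns n (k - j - 1) \<and> x \<in> pattern_event n j (p, q, A) \<and>
     local_stat j k (ext_order_stats (Some 0) (Some 1) n x) = (\<Sum>i\<in>A. rel_pos (ext_coord n x p) (ext_coord n x q) (x i))"
proof -
  define zs where "zs = unif_list n x"
  define e where "e = ext_coord n x"
  note uf = unif_list_facts[OF gen, folded zs_def e_def]
  have kl: "k < length zs" "j < length zs" using jk uf by auto
  have "zs ! j \<in> e ` {..<n+2}" "zs ! k \<in> e ` {..<n+2}"
    using nth_mem[OF kl(2)] nth_mem[OF kl(1)] unfolding uf(3) .
  then obtain p q where p: "p < n + 2" "e p = zs ! j" and q: "q < n + 2" "e q = zs ! k" by auto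
  have epq: "e p < e q" unfolding p q using sorted_wrt_nth_less[OF uf(1) jk(1) kl(1)] .
  have e01: "0 \<le> e i" "e i \<le> 1" if "i < n + 2" for i
    using gen that by (auto simp: e_def ext_coord_def generic_def less_imp_le)
  define A where "A = {i \<in> {..<n+2}. e p < e i \<and> e i < e q}"
  have An: "A \<subseteq> {..<n}"
  proof
    fix i assume i: "i \<in> A"
    then have "e p < e i" "e i < e q" by (auto simp: A_def)
    then have "0 < e i" "e i < 1" using e01(1)[OF p(1)] e01(2)[OF q(1)] by linarith+
    then show "i \<in> {..<n}" by (auto simp: e_def ext_coord_def split: if_splits)
  qed
  have eA: "e i = x i" if "i \<in> A" for i using that An by (auto simp: e_def ext_coord_def)
  have img: "{z \<in> set zs. zs ! j < z \<and> z < zs ! k} = e ` A" unfolding uf(3) A_def p q by auto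
  have injA: "inj_on e A" by (rule inj_on_subset[OF uf(4)]) (auto simp: A_def)
  have "card A = k - j - 1"
    using local_stat_between(2)[OF uf(1) jk(1) kl(1)] unfolding img by (simp add: card_image[OF injA])
  then have pat: "(p, q, A) \<in> patterns n (k - j - 1)" using p q An by (auto simp: patterns_def A_def)
  have "{z \<in> set zs. z < zs ! j} = e ` {i \<in> {..<n+2}. e i < e p}" unfolding uf(3) p by auto
  moreover have "inj_on e {i \<in> {..<n+2}. e i < e p}" by (rule inj_on_subset[OF uf(4)]) auto
  ultimately have "card {i \<in> {..<n+2}. e i < e p} = j"
    using strict_sorted_rank[OF uf(1) kl(2)] by (simp add: card_image)
  moreover have "{i \<in> {..<n+2}. e i < e p} = {i \<in> {..<n+2} - A. e i < e p}" by (auto simp: A_def)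
  ultimately have "card {i \<in> {..<n+2} - A. e i < e p} = j" by simp
  then have "between_pattern n j (p, q, A) x"
    using e01 p(1) q(1) epq by (auto simp: between_pattern_def e_def[symmetric] A_def)
  then have ev: "x \<in> pattern_event n j (p, q, A)"
  proof -
    have "e p < x i \<and> x i < e q" if "i \<in> A" for i
    proof -
      have "e p < e i \<and> e i < e q" using that by (simp add: A_def)
      then show ?thesis by (simp only: eA[OF that])
    qed
    then show ?thesis using x \<open>between_pattern n j (p, q, A) x\<close> unfolding pattern_event_def prod.case e_def by blast
  qed
  have "local_stat j k (ext_order_stats (Some 0) (Some 1) n x) = (\<Sum>z\<in>e ` A. rel_pos (e p) (e q) z)"
    unfolding ext_order_stats_nth zs_def[symmetric] local_stat_between(1)[OF uf(1) jk(1) kl(1)] img p q ..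
  also have "\<dots> = (\<Sum>i\<in>A. rel_pos (e p) (e q) (x i))"
    by (subst sum.reindex[OF injA]) (simp add: eA)
  finally show ?thesis using pat ev unfolding e_def by blast
qed

text \<open>
  On each pattern event the local statistic is the sum treated by \<open>conditional_tail\<close>.  These events are disjoint up to
  a null set, so their probabilities add up to at most one, and the bound is no worse than for \<open>k - j - 1\<close> independent
  uniform variables.
\<close>

theorem local_stat_uniform_tail:
  assumes jk: "(j, k) \<in> index_pairs n" and z: "z \<ge> 0"
  shows "measure (uniform_sample n) {x \<in> space (uniform_sample n).
     z * sqrt (real (k - j - 1) / 3) < \<bar>local_stat j k (ext_order_stats (Some 0) (Some 1) n x)\<bar>} \<le> 2 * exp (- z\<^sup>2 / 2)"
proof -
  define P where "P = uniform_sample n"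
  interpret prob_space P unfolding P_def by (rule prob_space_uniform_sample)
  define m where "m = k - j - 1"
  have jk': "j < k" "k \<le> n + 1" "m > 0" using jk by (auto simp: index_pairs_def m_def)
  define Bad where "Bad = (\<lambda>(p, q, A). {x \<in> pattern_event n j (p, q, A). z * sqrt (real m / 3) < \<bar>\<Sum>i\<in>A. rel_pos (ext_coord n x p) (ext_coord n x q) (x i)\<bar>})"
  have tail: "pattern_event n j c \<in> events" "Bad c \<in> events" "prob (Bad c) \<le> 2 * exp (- z\<^sup>2 / 2) * prob (pattern_event n j c)"
    if c: "c \<in> patterns n m" for c
  proof -
    obtain p q A where pqA: "c = (p, q, A)" by (cases c)
    have A: "A \<subseteq> {..<n}" "card A = m" "p \<notin> A" "q \<notin> A" using c by (auto simp: patterns_def pqA)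
    note ct = conditional_tail[where D = "between_pattern n j (p, q, A)" and u = "\<lambda>x. ext_coord n x p" and v = "\<lambda>x. ext_coord n x q" and n = n and A = A and z = z]
    have cong: "between_pattern n j (p, q, A) x = between_pattern n j (p, q, A) y \<and> ext_coord n x p = ext_coord n y p \<and> ext_coord n x q = ext_coord n y q"
      if "\<And>i. i \<in> {..<n} - A \<Longrightarrow> x i = y i" for x y
      by (intro conjI between_pattern_cong[OF _ A(3,4)]; rule that)
    have uv: "0 \<le> ext_coord n x p \<and> ext_coord n x p < ext_coord n x q \<and> ext_coord n x q \<le> 1" if "between_pattern n j (p, q, A) x" for x
      using that by (simp add: between_pattern_def)
    have cA: "0 < card A" using A jk' by simp
    note ct' = ct[OF A(1) cA measurable_between_pattern measurable_ext_coord measurable_ext_coord cong uv z]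
    show "pattern_event n j c \<in> events" "Bad c \<in> events" "prob (Bad c) \<le> 2 * exp (- z\<^sup>2 / 2) * prob (pattern_event n j c)"
      using ct' by (simp_all add: pqA pattern_event_def Bad_def P_def A(2))
  qed
  have genE: "{x \<in> space P. generic n x} \<in> events"
  proof -
    have c: "(\<lambda>x. x i) \<in> borel_measurable P" if "i < n" for i unfolding P_def by (rule uniform_sample_coord[OF that])
    have "{x \<in> space P. \<forall>i\<in>{..<n}. \<forall>i'\<in>{..<n}. i \<noteq> i' \<longrightarrow> x i \<noteq> x i'} \<in> events"
    proof (intro sets.sets_Collect_finite_All finite_lessThan)
      fix i i' assume "i \<in> {..<n}" "i' \<in> {..<n}"
      then have "(\<lambda>x. x i) \<in> borel_measurable P" "(\<lambda>x. x i') \<in> borel_measurable P" by (auto intro: c)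
      then have "{x \<in> space P. x i \<noteq> x i'} \<in> events" by (rule borel_measurable_neq)
      then show "{x \<in> space P. i \<noteq> i' \<longrightarrow> x i \<noteq> x i'} \<in> events" by (cases "i = i'") auto
    qed
    moreover have "{x \<in> space P. \<forall>i\<in>{..<n}. 0 < x i \<and> x i < 1} \<in> events"
    proof (intro sets.sets_Collect_finite_All finite_lessThan)
      fix i assume "i \<in> {..<n}"
      then have "(\<lambda>x. x i) \<in> borel_measurable P" by (auto intro: c)
      then have "{x \<in> space P. 0 < x i} \<in> events" "{x \<in> space P. x i < 1} \<in> events"
        by (auto intro!: borel_measurable_less)
      then show "{x \<in> space P. 0 < x i \<and> x i < 1} \<in> events" by (intro sets.sets_Collect_conj)
    qed
    moreover have "{x \<in> space P. generic n x} = {x \<in> space P. \<forall>i\<in>{..<n}. \<forall>i'\<in>{..<n}. i \<noteq> i' \<longrightarrow> x i \<noteq> x i'}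
       \<inter> {x \<in> space P. \<forall>i\<in>{..<n}. 0 < x i \<and> x i < 1}"
      unfolding generic_def inj_on_def by blast
    ultimately show ?thesis by (simp only: sets.Int)
  qed
  define Gen where "Gen = {x \<in> space P. generic n x}"
  have total: "(\<Sum>c\<in>patterns n m. prob (pattern_event n j c \<inter> Gen)) \<le> 1"
  proof -
    have "(\<Sum>c\<in>patterns n m. prob (pattern_event n j c \<inter> Gen)) = prob (\<Union>c\<in>patterns n m. pattern_event n j c \<inter> Gen)"
    proof (rule finite_measure_finite_Union[symmetric])
      show "(\<lambda>c. pattern_event n j c \<inter> Gen) ` patterns n m \<subseteq> events" using tail(1) genE unfolding Gen_def by blast
      show "disjoint_family_on (\<lambda>c. pattern_event n j c \<inter> Gen) (patterns n m)"
        unfolding disjoint_family_on_def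
      proof (intro ballI impI)
        fix c c' assume c: "c \<in> patterns n m" "c' \<in> patterns n m" "c \<noteq> c'"
        obtain p q A where c1: "c = (p, q, A)" by (cases c)
        obtain p' q' A' where c2: "c' = (p', q', A')" by (cases c')
        show "(pattern_event n j c \<inter> Gen) \<inter> (pattern_event n j c' \<inter> Gen) = {}"
          using pattern_event_unique[of n _ p q A m p' q' A' j] c unfolding c1 c2 Gen_def by blast
      qed
    qed (rule finite_patterns)
    then show ?thesis by simp
  qed
  have "prob {x \<in> space P. z * sqrt (real m / 3) < \<bar>local_stat j k (ext_order_stats (Some 0) (Some 1) n x)\<bar>}
      \<le> prob (\<Union>c\<in>patterns n m. Bad c)"
  proof (rule finite_measure_mono_AE)
    show "(\<Union>c\<in>patterns n m. Bad c) \<in> events" by (intro sets.finite_UN finite_patterns tail(2))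
    show "AE x in P. x \<in> {x \<in> space P. z * sqrt (real m / 3) < \<bar>local_stat j k (ext_order_stats (Some 0) (Some 1) n x)\<bar>}
       \<longrightarrow> x \<in> (\<Union>c\<in>patterns n m. Bad c)"
      using AE_generic[of n, folded P_def]
    proof eventually_elim
      case (elim x)
      show ?case
      proof
        assume x: "x \<in> {x \<in> space P. z * sqrt (real m / 3) < \<bar>local_stat j k (ext_order_stats (Some 0) (Some 1) n x)\<bar>}"
        then have "x \<in> space (uniform_sample n)" by (simp add: P_def)
        from pattern_event_exists[OF elim this jk'(1,2)] obtain p q A where
          "(p, q, A) \<in> patterns n m" "x \<in> pattern_event n j (p, q, A)"
          "local_stat j k (ext_order_stats (Some 0) (Some 1) n x) = (\<Sum>i\<in>A. rel_pos (ext_coord n x p) (ext_coord n x q) (x i))"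
          unfolding m_def by blast
        with x have "x \<in> Bad (p, q, A)" by (simp add: Bad_def)
        with \<open>(p, q, A) \<in> patterns n m\<close> show "x \<in> (\<Union>c\<in>patterns n m. Bad c)" by blast
      qed
    qed
  qed
  also have "\<dots> \<le> (\<Sum>c\<in>patterns n m. prob (Bad c))"
    by (rule finite_measure_subadditive_finite[OF finite_patterns]) (blast intro: tail(2))
  also have "\<dots> \<le> (\<Sum>c\<in>patterns n m. 2 * exp (- z\<^sup>2 / 2) * prob (pattern_event n j c))"
    by (intro sum_mono tail)
  also have "\<dots> = 2 * exp (- z\<^sup>2 / 2) * (\<Sum>c\<in>patterns n m. prob (pattern_event n j c \<inter> Gen))"
  proof -
    have "prob (pattern_event n j c) = prob (pattern_event n j c \<inter> Gen)" if "c \<in> patterns n m" for c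
    proof (rule finite_measure_eq_AE)
      show "AE x in P. x \<in> pattern_event n j c \<longleftrightarrow> x \<in> pattern_event n j c \<inter> Gen"
        using AE_generic[of n, folded P_def]
      proof eventually_elim
        case (elim x)
        then show ?case using sets.sets_into_space[OF tail(1)[OF that]] unfolding Gen_def by blast
      qed
      show "pattern_event n j c \<in> events" by (rule tail(1)[OF that])
      then show "pattern_event n j c \<inter> Gen \<in> events" using genE unfolding Gen_def by (rule sets.Int)
    qed
    then show ?thesis unfolding sum_distrib_left by (intro sum.cong refl) simp
  qed
  finally have "prob {x \<in> space P. z * sqrt (real m / 3) < \<bar>local_stat j k (ext_order_stats (Some 0) (Some 1) n x)\<bar>}
     \<le> 2 * exp (- z\<^sup>2 / 2) * (\<Sum>c\<in>patterns n m. prob (pattern_event n j c \<inter> Gen))" .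
  moreover have "2 * exp (- z\<^sup>2 / 2) * (\<Sum>c\<in>patterns n m. prob (pattern_event n j c \<inter> Gen)) \<le> 2 * exp (- z\<^sup>2 / 2) * 1"
    by (rule mult_left_mono[OF total]) simp
  ultimately show ?thesis unfolding P_def[symmetric] m_def[symmetric] by linarith
qed

section \<open>The modulus of continuity of the uniform empirical process\<close>

definition emp_count :: "nat \<Rightarrow> (nat \<Rightarrow> real) \<Rightarrow> real \<Rightarrow> nat" where
  "emp_count n x t = card {i. i < n \<and> x i \<le> t}"

definition emp_dev :: "nat \<Rightarrow> (nat \<Rightarrow> real) \<Rightarrow> real \<Rightarrow> real" where
  "emp_dev n x t = real (emp_count n x t) - real n * t"

definition cell :: "nat \<Rightarrow> nat \<Rightarrow> real set" where
  "cell r a = {real a / 2 ^ r<..real (a + 1) / 2 ^ r}"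

abbreviation cell_count :: "nat \<Rightarrow> (nat \<Rightarrow> real) \<Rightarrow> nat \<Rightarrow> nat \<Rightarrow> nat" where
  "cell_count n x r a \<equiv> obs_count (\<lambda>i x. x i) {..<n} (cell r a) x"

text \<open>
  The number of points in a cell of level \<open>r\<close> fluctuates by \<open>sqrt (n / 2 ^ r)\<close>; the factor \<open>r + 4\<close> makes room for
  a union bound over the \<open>2 ^ r\<close> cells of each level.
\<close>

definition level_bound :: "nat \<Rightarrow> real \<Rightarrow> nat \<Rightarrow> real" where
  "level_bound n lam r = lam * (real r + 4) * sqrt (real n / 2 ^ r)"

definition cells_regular :: "nat \<Rightarrow> real \<Rightarrow> nat \<Rightarrow> (nat \<Rightarrow> real) \<Rightarrow> bool" where
  "cells_regular n lam R x \<longleftrightarrow>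
    (\<forall>r\<in>{..R}. \<forall>a\<in>{..<2 ^ r}. \<bar>real (cell_count n x r a) - real n / 2 ^ r\<bar> < level_bound n lam r)"

lemma emp_count_diff:
  assumes "s \<le> t"
  shows "emp_count n x t = emp_count n x s + obs_count (\<lambda>i x. x i) {..<n} {s<..t} x"
proof -
  have "{i. i < n \<and> x i \<le> t} = {i. i < n \<and> x i \<le> s} \<union> {i \<in> {..<n}. x i \<in> {s<..t}}"
    using assms by auto
  then show ?thesis unfolding emp_count_def obs_count_def
    by (simp add: card_Un_disjoint disjoint_iff)
qed

lemma emp_count_mono: "s \<le> t \<Longrightarrow> emp_count n x s \<le> emp_count n x t"
  by (simp add: emp_count_diff)

lemma level_bound_nonneg: "lam \<ge> 0 \<Longrightarrow> level_bound n lam r \<ge> 0"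
  by (simp add: level_bound_def)

lemma emp_dev_cell:
  assumes "cells_regular n lam R x" "r \<le> R" "a < 2 ^ r"
  shows "\<bar>emp_dev n x (real (a + 1) / 2 ^ r) - emp_dev n x (real a / 2 ^ r)\<bar> \<le> level_bound n lam r"
proof -
  have "real a / 2 ^ r \<le> real (a + 1) / 2 ^ r" by (intro divide_right_mono) auto
  from emp_count_diff[OF this, of n x]
  have "emp_dev n x (real (a + 1) / 2 ^ r) - emp_dev n x (real a / 2 ^ r) = real (cell_count n x r a) - real n / 2 ^ r"
    by (simp add: emp_dev_def cell_def add_divide_distrib algebra_simps)
  moreover have "\<bar>real (cell_count n x r a) - real n / 2 ^ r\<bar> < level_bound n lam r"
    using assms unfolding cells_regular_def by auto
  ultimately show ?thesis by simp
qed

text \<open>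
  Of the grid points of level \<open>r\<close>, \<open>dyadic_index r t / 2 ^ r\<close> is the last one up to \<open>t\<close>; the value \<open>2 ^ r\<close>, which is
  not the index of a cell, occurs for \<open>t = 1\<close>.
\<close>

definition dyadic_index :: "nat \<Rightarrow> real \<Rightarrow> nat" where
  "dyadic_index r t = nat \<lfloor>2 ^ r * t\<rfloor>"

lemma dyadic_index_bounds:
  assumes "0 \<le> t" "t \<le> 1"
  shows "real (dyadic_index r t) / 2 ^ r \<le> t" "t < real (dyadic_index r t + 1) / 2 ^ r" "dyadic_index r t \<le> 2 ^ r"
proof -
  have fl: "real (dyadic_index r t) = of_int \<lfloor>2 ^ r * t\<rfloor>" using assms by (simp add: dyadic_index_def)
  have 1: "real (dyadic_index r t) \<le> 2 ^ r * t" "2 ^ r * t < real (dyadic_index r t) + 1" unfolding fl by linarith+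
  then show "real (dyadic_index r t) / 2 ^ r \<le> t" "t < real (dyadic_index r t + 1) / 2 ^ r" by (auto simp: field_simps)
  have "2 ^ r * t \<le> 2 ^ r * 1" using assms by (intro mult_left_mono) auto
  with 1 have "real (dyadic_index r t) \<le> real (2 ^ r)" unfolding of_nat_power of_nat_numeral by linarith
  then show "dyadic_index r t \<le> 2 ^ r" by (simp only: of_nat_le_iff)
qed

lemma dyadic_index_Suc:
  assumes "0 \<le> t" "t \<le> 1"
  shows "dyadic_index (Suc r) t = 2 * dyadic_index r t \<or> dyadic_index (Suc r) t = 2 * dyadic_index r t + 1"
proof -
  have p: "(0::real) < 2 ^ r" by simp
  have a: "real (dyadic_index r t) \<le> 2 ^ r * t" "2 ^ r * t < real (dyadic_index r t) + 1"
    using dyadic_index_bounds[OF assms, of r] p by (auto simp: field_simps)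
  have b: "real (dyadic_index (Suc r) t) \<le> 2 * (2 ^ r * t)" "2 * (2 ^ r * t) < real (dyadic_index (Suc r) t) + 1"
    using dyadic_index_bounds[OF assms, of "Suc r"] p by (auto simp: field_simps)
  have "real (dyadic_index (Suc r) t) < real (2 * dyadic_index r t + 2)" "real (2 * dyadic_index r t) < real (dyadic_index (Suc r) t + 1)" using a b by simp_all
  then have "dyadic_index (Suc r) t < 2 * dyadic_index r t + 2" "2 * dyadic_index r t < dyadic_index (Suc r) t + 1" by (simp_all only: of_nat_less_iff)
  then show ?thesis by linarith
qed

text \<open>
  Chaining: \<open>t\<close> is approached by its dyadic approximations of levels \<open>q, \<dots>, R\<close>.  Two consecutive ones coincide or
  bound a cell, and the bounds form a series dominated by a geometric one.  Below level \<open>R\<close> only the monotonicity of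
  the counts is used, which costs the expected number \<open>n / 2 ^ R\<close> of points in a cell.
\<close>

lemma emp_dev_chain:
  assumes cr: "cells_regular n lam R x" and lam: "lam \<ge> 0" and t: "0 \<le> t" "t \<le> 1" and q: "q \<le> R"
  shows "\<bar>emp_dev n x t - emp_dev n x (real (dyadic_index q t) / 2 ^ q)\<bar>
    \<le> 10 * level_bound n lam q + (real n / 2 ^ R + level_bound n lam R)"
  using q
proof (induction q rule: inc_induct)
  case base
  define a where "a = dyadic_index R t"
  note db = dyadic_index_bounds[OF t, of R, folded a_def]
  show ?case
  proof (cases "a = 2 ^ R")
    case True
    then have "real a / 2 ^ R = t" using db(1) t by (auto simp: True)
    then show ?thesis using level_bound_nonneg[OF lam] by (simp add: a_def)
  next
    case False
    then have aR: "a < 2 ^ R" using db(3) by simp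
    have 1: "real (emp_count n x (real a / 2 ^ R)) \<le> real (emp_count n x t)"
      using emp_count_mono[OF db(1)] by (simp only: of_nat_le_iff)
    have 2: "real (emp_count n x t) \<le> real (emp_count n x (real (a + 1) / 2 ^ R))"
      using emp_count_mono[OF less_imp_le[OF db(2)]] by (simp only: of_nat_le_iff)
    have 3: "\<bar>emp_dev n x (real (a + 1) / 2 ^ R) - emp_dev n x (real a / 2 ^ R)\<bar> \<le> level_bound n lam R"
      by (rule emp_dev_cell[OF cr order_refl aR])
    have e: "real (a + 1) / 2 ^ R = real a / 2 ^ R + 1 / 2 ^ R" by (simp add: add_divide_distrib)
    have 4: "real n * (real a / 2 ^ R) \<le> real n * t" "real n * t \<le> real n * (real (a + 1) / 2 ^ R)"
      using db by (intro mult_left_mono; simp)+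
    have 5: "real n * (real (a + 1) / 2 ^ R) = real n * (real a / 2 ^ R) + real n / 2 ^ R"
      unfolding e by (simp add: distrib_left)
    have "\<bar>emp_dev n x t - emp_dev n x (real a / 2 ^ R)\<bar> \<le> real n / 2 ^ R + level_bound n lam R"
    proof -
      have "\<bar>et - ut - (e0 - u0)\<bar> \<le> w + L"
        if "e0 \<le> et" "et \<le> e1" "\<bar>e1 - u1 - (e0 - u0)\<bar> \<le> L" "u0 \<le> ut" "ut \<le> u1" "u1 = u0 + w"
        for e0 e1 et u0 u1 ut w L :: real
        using that by linarith
      from this[OF 1 2 3[unfolded emp_dev_def] 4 5] show ?thesis unfolding emp_dev_def .
    qed
    then show ?thesis using level_bound_nonneg[OF lam, of n R] by (simp add: a_def)
  qed
next
  case (step q)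
  define a where "a = dyadic_index q t"
  define a' where "a' = dyadic_index (Suc q) t"
  have aa: "a' = 2 * a \<or> a' = 2 * a + 1" unfolding a_def a'_def by (rule dyadic_index_Suc[OF t])
  have eq: "real (2 * a) / 2 ^ Suc q = real a / 2 ^ q" by simp
  have le1: "\<bar>emp_dev n x (real a' / 2 ^ Suc q) - emp_dev n x (real a / 2 ^ q)\<bar> \<le> level_bound n lam (Suc q)"
  proof (cases "a' = 2 * a")
    case True
    then show ?thesis using level_bound_nonneg[OF lam] by (simp add: eq)
  next
    case False
    with aa have a': "a' = 2 * a + 1" by simp
    then have "2 * a < 2 ^ Suc q" using dyadic_index_bounds(3)[OF t, of "Suc q", folded a'_def] by linarith
    from emp_dev_cell[OF cr _ this] step.hyps show ?thesis unfolding a' eq by simp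
  qed
  \<comment> \<open>The factor from level \<open>q\<close> to \<open>q + 1\<close> is at most
    \<open>(5/4) / sqrt 2 < 10/11\<close>, so 10 times the first bound exceeds the sum of all later ones.\<close>
  have "11 * level_bound n lam (Suc q) \<le> 10 * level_bound n lam q"
  proof -
    define z where "z = sqrt (real n / 2 ^ Suc q)"
    have s2: "7/5 * z \<le> sqrt (real n / 2 ^ q)"
    proof (rule real_le_rsqrt)
      have "z\<^sup>2 = real n / 2 ^ Suc q" unfolding z_def by (rule real_sqrt_pow2) simp
      then have "(7/5 * z)\<^sup>2 = (7/5)\<^sup>2 * (real n / 2 ^ Suc q)" unfolding power_mult_distrib by simp
      also have "\<dots> \<le> real n / 2 ^ q" by (simp add: field_simps power2_eq_square)
      finally show "(7/5 * z)\<^sup>2 \<le> real n / 2 ^ q" .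
    qed
    have "11 * (real (Suc q) + 4) * z \<le> (10 * (real q + 4)) * (7/5 * z)"
    proof -
      have "11 * (real (Suc q) + 4) \<le> 14 * (real q + 4)" by simp
      then have "11 * (real (Suc q) + 4) * z \<le> 14 * (real q + 4) * z"
        by (rule mult_right_mono) (simp add: z_def)
      also have "14 * (real q + 4) * z = (10 * (real q + 4)) * (7/5 * z)" by simp
      finally show ?thesis .
    qed
    also have "\<dots> \<le> (10 * (real q + 4)) * sqrt (real n / 2 ^ q)" using s2 by (rule mult_left_mono) simp
    finally have "lam * (11 * (real (Suc q) + 4) * z) \<le> lam * (10 * (real q + 4) * sqrt (real n / 2 ^ q))"
      using lam by (rule mult_left_mono)
    then show ?thesis unfolding level_bound_def z_def by (simp only: mult_ac)
  qed
  with le1 step.IH show ?case unfolding a_def a'_def by linarith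
qed

text \<open>
  Two chains of \<open>emp_dev_chain\<close>, from the two points to level \<open>q\<close>, and one cell of that level.
\<close>

definition modulus :: "nat \<Rightarrow> real \<Rightarrow> nat \<Rightarrow> nat \<Rightarrow> real" where
  "modulus n lam R q = 21 * level_bound n lam q + 2 * (real n / 2 ^ R + level_bound n lam R)"

lemma emp_dev_modulus:
  assumes cr: "cells_regular n lam R x" and lam: "lam \<ge> 0" and st: "0 \<le> s" "s \<le> t" "t \<le> 1"
    and q: "q \<le> R" and d: "t - s \<le> 1 / 2 ^ q"
  shows "\<bar>emp_dev n x t - emp_dev n x s\<bar> \<le> modulus n lam R q"
proof -
  have t: "0 \<le> t" "t \<le> 1" and s: "0 \<le> s" "s \<le> 1" using st by auto
  have p: "(0::real) < 2 ^ q" by simp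
  have a: "real (dyadic_index q t) \<le> 2 ^ q * t" "2 ^ q * t < real (dyadic_index q t) + 1"
    using dyadic_index_bounds[OF t, of q] p by (auto simp: field_simps)
  have b: "real (dyadic_index q s) \<le> 2 ^ q * s" "2 ^ q * s < real (dyadic_index q s) + 1"
    using dyadic_index_bounds[OF s, of q] p by (auto simp: field_simps)
  have c: "2 ^ q * s \<le> 2 ^ q * t" "2 ^ q * t \<le> 2 ^ q * s + 1" using st d p by (auto simp: field_simps)
  have "real (dyadic_index q t) < real (dyadic_index q s) + 2" "real (dyadic_index q s) < real (dyadic_index q t) + 1" using a b c by linarith+
  then have "real (dyadic_index q t) < real (dyadic_index q s + 2)" "real (dyadic_index q s) < real (dyadic_index q t + 1)" by simp_all
  then have "dyadic_index q t < dyadic_index q s + 2" "dyadic_index q s < dyadic_index q t + 1" by (simp_all only: of_nat_less_iff)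
  then have cases: "dyadic_index q t = dyadic_index q s \<or> dyadic_index q t = dyadic_index q s + 1" by linarith
  have "\<bar>emp_dev n x (real (dyadic_index q t) / 2 ^ q) - emp_dev n x (real (dyadic_index q s) / 2 ^ q)\<bar> \<le> level_bound n lam q"
  proof (cases "dyadic_index q t = dyadic_index q s")
    case True
    then show ?thesis using level_bound_nonneg[OF lam] by simp
  next
    case False
    with cases have e: "dyadic_index q t = dyadic_index q s + 1" by simp
    then have "dyadic_index q s < 2 ^ q" using dyadic_index_bounds(3)[OF t, of q] by linarith
    from emp_dev_cell[OF cr q this] show ?thesis unfolding e .
  qed
  note mid = this
  have tri: "\<bar>A - C\<bar> \<le> 21 * L + 2 * Z"
    if "\<bar>A - B\<bar> \<le> 10 * L + Z" "\<bar>C - D\<bar> \<le> 10 * L + Z" "\<bar>B - D\<bar> \<le> L" for A B C D L Z :: real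
    using that by linarith
  show ?thesis unfolding modulus_def
    by (rule tri[OF emp_dev_chain[OF cr lam t q] emp_dev_chain[OF cr lam s q] mid])
qed

text \<open>
  The minimum occurs because the entry 1 with index \<open>n + 1\<close> is not an observation.
\<close>

lemma emp_count_order_stat:
  assumes gen: "generic n x" and i: "i \<le> n + 1"
  shows "emp_count n x (unif_list n x ! i) = min i n" "0 \<le> unif_list n x ! i" "unif_list n x ! i \<le> 1"
proof -
  define zs where "zs = unif_list n x"
  note uf = unif_list_facts[OF gen, folded zs_def]
  have last: "zs ! (n + 1) = 1" "zs ! 0 = 0" by (simp_all add: zs_def ext_list_def nth_append)
  have il: "i < length zs" using i uf by simp
  have mem: "zs ! i \<in> set zs" using il by simp
  then show 01: "0 \<le> unif_list n x ! i" "unif_list n x ! i \<le> 1"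
    using gen unfolding zs_def set_ext_list by (auto simp: generic_def less_imp_le)
  show "emp_count n x (unif_list n x ! i) = min i n"
  proof (cases "i = n + 1")
    case True
    have "{i. i < n \<and> x i \<le> 1} = {..<n}" using gen by (auto simp: generic_def less_imp_le)
    then show ?thesis using True last by (simp add: emp_count_def zs_def)
  next
    case False
    then have lt: "zs ! i < 1" using sorted_wrt_nth_less[OF uf(1), of i "n + 1"] i uf last by simp
    have "{z \<in> set zs. z \<le> zs ! i} = insert (zs ! i) {z \<in> set zs. z < zs ! i}" using mem by auto
    then have c: "card {z \<in> set zs. z \<le> zs ! i} = i + 1"
      using strict_sorted_rank[OF uf(1) il] by simp
    have "{z \<in> set zs. z \<le> zs ! i} = insert 0 (x ` {p. p < n \<and> x p \<le> zs ! i})"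
      using lt 01 unfolding zs_def set_ext_list by auto
    moreover have "0 \<notin> x ` {p. p < n \<and> x p \<le> zs ! i}" using gen by (auto simp: generic_def)
    ultimately have "card {z \<in> set zs. z \<le> zs ! i} = card (x ` {p. p < n \<and> x p \<le> zs ! i}) + 1" by simp
    also have "card (x ` {p. p < n \<and> x p \<le> zs ! i}) = emp_count n x (zs ! i)"
      unfolding emp_count_def using gen by (intro card_image) (auto simp: generic_def inj_on_def)
    finally show ?thesis using c False i by (simp add: zs_def)
  qed
qed

text \<open>
  If the order statistics were more than \<open>1 / 2 ^ q\<close> apart, then already a part of length \<open>1 / 2 ^ q\<close> of the interval
  between them would contain too many points.  Hence they are close, and the modulus of continuity applies to them.
  The case \<open>q = 0\<close> is trivial, all points being in the unit interval.
\<close>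

lemma order_stat_modulus:
  assumes gen: "generic n x" and cr: "cells_regular n lam R x" and lam: "lam \<ge> 0"
    and i: "i \<le> i'" "i' \<le> n + 1" and q: "q \<le> R"
    and small: "q = 0 \<or> modulus n lam R q + 1 + real (i' - i) < real n / 2 ^ q"
  shows "\<bar>real n * (unif_list n x ! i' - unif_list n x ! i) - real (i' - i)\<bar> \<le> modulus n lam R q + 1"
proof -
  define s where "s = unif_list n x ! i"
  define t where "t = unif_list n x ! i'"
  have ii: "i \<le> n + 1" using i by simp
  note es = emp_count_order_stat[OF gen ii, folded s_def]
  note et = emp_count_order_stat[OF gen i(2), folded t_def]
  have st: "s \<le> t"
  proof (cases "i = i'")
    case False
    then show ?thesis unfolding s_def t_def
      using sorted_wrt_nth_less[OF unif_list_facts(1)[OF gen], of i i'] i unif_list_facts(2)[OF gen] by simp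
  qed (simp add: s_def t_def)
  have cnt: "\<bar>real (emp_count n x t) - real (emp_count n x s) - real (i' - i)\<bar> \<le> 1"
    using i unfolding es(1) et(1) by (auto simp: min_def of_nat_diff)
  have close: "t - s \<le> 1 / 2 ^ q"
  proof (cases "q = 0")
    case True
    then show ?thesis using es(2) et(3) by simp
  next
    case q0: False
    show ?thesis
    proof (rule ccontr)
      assume "\<not> t - s \<le> 1 / 2 ^ q"
      then have lt: "s + 1 / 2 ^ q \<le> t" by simp
      have "\<bar>emp_dev n x (s + 1 / 2 ^ q) - emp_dev n x s\<bar> \<le> modulus n lam R q"
        by (rule emp_dev_modulus[OF cr lam es(2) _ _ q]) (use lt et in auto)
      moreover have "emp_count n x (s + 1 / 2 ^ q) \<le> emp_count n x t" by (rule emp_count_mono[OF lt])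
      moreover have "real n * (s + 1 / 2 ^ q) = real n * s + real n / 2 ^ q" by (simp add: distrib_left)
      ultimately show False using cnt small q0 unfolding emp_dev_def by linarith
    qed
  qed
  have "\<bar>emp_dev n x t - emp_dev n x s\<bar> \<le> modulus n lam R q"
    by (rule emp_dev_modulus[OF cr lam es(2) st et(3) q close])
  then have "\<bar>real n * (t - s) - real (i' - i)\<bar> \<le> modulus n lam R q + 1"
    using cnt unfolding emp_dev_def right_diff_distrib by linarith
  then show ?thesis by (simp add: s_def t_def)
qed

text \<open>
  A cell of level \<open>r\<close> fails with probability at most \<open>2 * exp (- lam\<^sup>2 * (r + 4)\<^sup>2 / 4)\<close>, hence one of the \<open>2 ^ r\<close>
  cells of the level fails with probability at most \<open>(2 * exp (- lam\<^sup>2)) ^ Suc r\<close>, a term of a geometric series.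
  The assumption \<open>reg\<close> keeps the optimal parameter of the Chernoff bound in \<open>[0, 1]\<close>.
\<close>

lemma prob_cells_irregular:
  assumes n: "n \<ge> 1" and lam: "lam \<ge> 0" "2 * exp (- lam\<^sup>2) \<le> 1/2"
    and reg: "\<And>r. r \<le> R \<Longrightarrow> lam * (real r + 4) \<le> 2 * sqrt (real n / 2 ^ r)"
  shows "{x \<in> space (uniform_sample n). \<not> cells_regular n lam R x} \<in> sets (uniform_sample n)"
    "measure (uniform_sample n) {x \<in> space (uniform_sample n). \<not> cells_regular n lam R x} \<le> 4 * exp (- lam\<^sup>2)"
proof -
  interpret prob_space "uniform_sample n" by (rule prob_space_uniform_sample)
  define P where "P = uniform_sample n"
  define B where "B r a = {x \<in> space P. \<not> \<bar>real (cell_count n x r a) - real n / 2 ^ r\<bar> < level_bound n lam r}" for r a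
  have Nm: "(\<lambda>x. real (cell_count n x r a)) \<in> borel_measurable P" for r a
  proof -
    have "(\<lambda>x. x i) \<in> borel_measurable P" if "i < n" for i unfolding P_def by (rule uniform_sample_coord[OF that])
    then show ?thesis by (subst obs_count_real) (auto simp: cell_def)
  qed
  have B: "B r a \<in> events" for r a
    using Nm[of r a] unfolding B_def P_def by measurable
  have pB: "prob (B r a) \<le> 2 * exp (- lam\<^sup>2 * (real r + 1))" if r: "r \<le> R" and a: "a < 2 ^ r" for r a
  proof -
    define y where "y = sqrt (real n / 2 ^ r)"
    \<comment> \<open>The minimiser of \<open>y\<^sup>2 * t\<^sup>2 - t * level_bound n lam r\<close>.\<close>
    define t where "t = lam * (real r + 4) / (2 * y)"
    have y: "y > 0" "y\<^sup>2 = real n / 2 ^ r" using n by (auto simp: y_def)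
    have t: "0 \<le> t" "t \<le> 1" using reg[OF r] lam y by (auto simp: t_def y_def[symmetric] field_simps)
    have "mass (indicator {0..1}) (cell r a) = 1 / 2 ^ r"
    proof -
      have "real (a + 1) \<le> real (2 ^ r)" using a unfolding of_nat_le_iff by simp
      then have sub: "real (a + 1) / 2 ^ r \<le> 1" by simp
      have "mass (indicator {0..1}) (cell r a) = measure lborel ({0..1} \<inter> cell r a)"
        unfolding mass_def set_lebesgue_integral_def by (simp flip: indicator_inter_arith add: Int_commute cell_def)
      also have "{0..1} \<inter> cell r a = cell r a"
      proof (intro Int_absorb1 subsetI)
        fix x assume "x \<in> cell r a"
        then have "real a / 2 ^ r < x" "x \<le> real (a + 1) / 2 ^ r" unfolding cell_def by auto
        moreover have "0 \<le> real a / 2 ^ r" by simp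
        ultimately show "x \<in> {0..1}" using sub unfolding atLeastAtMost_iff by linarith
      qed
      also have "measure lborel (cell r a) = 1 / 2 ^ r"
        by (simp add: cell_def divide_right_mono add_divide_distrib)
      finally show ?thesis .
    qed
    note dev = obs_count_deviation[OF finite_lessThan uniform_coord_indep uniform_coord_distributed _ _ _ _ t, where F = "1 / 2 ^ r" and y = "level_bound n lam r" and J = "cell r a"]
    have cellb: "cell r a \<in> sets borel" by (simp add: cell_def)
    have e: "real (card {..<n}) * (1 / 2 ^ r) * t\<^sup>2 - t * level_bound n lam r = - (lam\<^sup>2 * (real r + 4)\<^sup>2 / 4)"
    proof -
      have "real (card {..<n}) * (1 / 2 ^ r) * t\<^sup>2 = y\<^sup>2 * t\<^sup>2" by (simp add: y)
      also have "\<dots> = lam\<^sup>2 * (real r + 4)\<^sup>2 / 4" using y(1) by (simp add: t_def power_divide power_mult_distrib)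
      finally have 1: "real (card {..<n}) * (1 / 2 ^ r) * t\<^sup>2 = lam\<^sup>2 * (real r + 4)\<^sup>2 / 4" .
      have "t * level_bound n lam r = lam\<^sup>2 * (real r + 4)\<^sup>2 / 2"
        using y(1) unfolding t_def level_bound_def y_def[symmetric] by (simp add: power2_eq_square)
      with 1 show ?thesis by linarith
    qed
    have e2: "exp (- (lam\<^sup>2 * (real r + 4)\<^sup>2 / 4)) \<le> exp (- lam\<^sup>2 * (real r + 1))"
    proof -
      have "real r + 1 \<le> (real r + 4)\<^sup>2 / 4" by (simp add: power2_eq_square algebra_simps)
      then have "lam\<^sup>2 * (real r + 1) \<le> lam\<^sup>2 * ((real r + 4)\<^sup>2 / 4)" by (rule mult_left_mono) simp
      then show ?thesis by simp
    qed
    have up0: "prob {x \<in> space P. real n / 2 ^ r + level_bound n lam r \<le> real (cell_count n x r a)} \<le> exp (- (lam\<^sup>2 * (real r + 4)\<^sup>2 / 4))"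
      and low0: "prob {x \<in> space P. real (cell_count n x r a) \<le> real n / 2 ^ r - level_bound n lam r} \<le> exp (- (lam\<^sup>2 * (real r + 4)\<^sup>2 / 4))"
      using dev \<open>mass (indicator {0..1}) (cell r a) = 1 / 2 ^ r\<close> e n cellb by (auto simp: P_def)
    note up = order_trans[OF up0 e2] and low = order_trans[OF low0 e2]
    have m: "{x \<in> space P. real n / 2 ^ r + level_bound n lam r \<le> real (cell_count n x r a)} \<in> events"
      "{x \<in> space P. real (cell_count n x r a) \<le> real n / 2 ^ r - level_bound n lam r} \<in> events"
      using Nm[of r a] unfolding P_def by measurable
    have "B r a = {x \<in> space P. real n / 2 ^ r + level_bound n lam r \<le> real (cell_count n x r a)} \<union>
       {x \<in> space P. real (cell_count n x r a) \<le> real n / 2 ^ r - level_bound n lam r}"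
      unfolding B_def by (auto simp: abs_less_iff not_less)
    then have "prob (B r a) \<le> prob {x \<in> space P. real n / 2 ^ r + level_bound n lam r \<le> real (cell_count n x r a)} +
       prob {x \<in> space P. real (cell_count n x r a) \<le> real n / 2 ^ r - level_bound n lam r}"
      using measure_Un_le[OF m] by simp
    with up low show ?thesis by simp
  qed
  have eq: "{x \<in> space (uniform_sample n). \<not> cells_regular n lam R x} = (\<Union>r\<in>{..R}. \<Union>a\<in>{..<2 ^ r}. B r a)"
    unfolding B_def cells_regular_def P_def by blast
  have inner: "(\<Union>a\<in>{..<2 ^ r}. B r a) \<in> events" for r by (intro sets.finite_UN B) auto
  show "{x \<in> space (uniform_sample n). \<not> cells_regular n lam R x} \<in> events"
    unfolding eq by (intro sets.finite_UN inner) auto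
  have "prob {x \<in> space (uniform_sample n). \<not> cells_regular n lam R x} \<le> (\<Sum>r\<in>{..R}. prob (\<Union>a\<in>{..<2 ^ r}. B r a))"
    unfolding eq using inner by (intro finite_measure_subadditive_finite) auto
  also have "\<dots> \<le> (\<Sum>r\<in>{..R}. (2 * exp (- lam\<^sup>2)) ^ Suc r)"
  proof (rule sum_mono)
    fix r assume r: "r \<in> {..R}"
    have "prob (\<Union>a\<in>{..<2 ^ r}. B r a) \<le> (\<Sum>a\<in>{..<2 ^ r}. prob (B r a))"
      using B by (intro finite_measure_subadditive_finite) auto
    also have "\<dots> \<le> (\<Sum>a\<in>{..<(2::nat) ^ r}. 2 * exp (- lam\<^sup>2 * (real r + 1)))"
      using pB r by (intro sum_mono) auto
    also have "\<dots> = 2 ^ Suc r * exp (- lam\<^sup>2 * real (Suc r))" by (simp add: algebra_simps)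
    also have "\<dots> = (2 * exp (- lam\<^sup>2)) ^ Suc r" unfolding exp_of_nat2_mult power_mult_distrib ..
    finally show "prob (\<Union>a\<in>{..<2 ^ r}. B r a) \<le> (2 * exp (- lam\<^sup>2)) ^ Suc r" .
  qed
  also have "\<dots> \<le> 2 * (2 * exp (- lam\<^sup>2))"
  proof -
    define w where "w = 2 * exp (- lam\<^sup>2)"
    have w: "0 < w" "w \<le> 1/2" using lam by (auto simp: w_def)
    have "(\<Sum>r\<in>{..R}. w ^ Suc r) \<le> 2 * w - 2 * w * w ^ Suc R"
    proof (induction R)
      case 0
      have "w * w \<le> w * (1/2)" using w by (intro mult_left_mono) auto
      then show ?case by simp
    next
      case (Suc R)
      have "w * w ^ Suc (Suc R) * 2 \<le> w ^ Suc (Suc R)"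
        using mult_right_mono[of "2 * w" 1 "w ^ Suc (Suc R)"] w by (simp add: mult_ac)
      with Suc show ?case by (simp add: mult_ac)
    qed
    also have "\<dots> \<le> 2 * w" using w by simp
    finally show ?thesis by (simp add: w_def)
  qed
  finally show "prob {x \<in> space (uniform_sample n). \<not> cells_regular n lam R x} \<le> 4 * exp (- lam\<^sup>2)" by simp
qed

section \<open>Local statistics of nested index intervals\<close>

lemma sum_offsets: "(\<Sum>i=j..<j+p. real i - real j) = real p * (real p - 1) / 2"
proof (induction p)
  case (Suc p)
  have "{j..<j + Suc p} = insert (j + p) {j..<j+p}" by auto
  then show ?case using Suc by (simp add: field_simps)
qed simp

text \<open>
  The end points contribute \<open>- 1\<close> and \<open>1\<close>, and may be included.
\<close>

lemma local_stat_closed: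
  assumes jk: "j < k" and V: "\<And>i. j < i \<Longrightarrow> i < k \<Longrightarrow> V j < V i \<and> V i < V k" and Vjk: "V j < V k"
  shows "local_stat j k V = (\<Sum>i=j..k. rel_pos (V j) (V k) (V i))"
proof -
  have "{j..k} = insert j (insert k {j+1..k-1})" using jk by auto
  then have "(\<Sum>i=j..k. rel_pos (V j) (V k) (V i)) = rel_pos (V j) (V k) (V j) + (rel_pos (V j) (V k) (V k) + (\<Sum>i=j+1..k-1. rel_pos (V j) (V k) (V i)))"
    using jk by simp
  also have "(\<Sum>i=j+1..k-1. rel_pos (V j) (V k) (V i)) = local_stat j k V"
    unfolding local_stat_def
  proof (rule sum.cong)
    fix i assume "i \<in> {j+1..k-1}"
    then have "V j < V i" "V i < V k" using V[of i] by auto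
    then show "rel_pos (V j) (V k) (V i) = beta_fun ((V i - V j) / (V k - V j))" by (auto simp: rel_pos_def beta_fun_def)
  qed simp
  finally show ?thesis using Vjk by (simp add: rel_pos_def)
qed

lemma sum_affine:
  fixes g e :: "nat \<Rightarrow> real"
  shows "(\<Sum>i\<in>A. \<gamma> * g i + (2 * e i + \<beta>)) = \<gamma> * (\<Sum>i\<in>A. g i) + 2 * (\<Sum>i\<in>A. e i) + real (card A) * \<beta>"
  by (simp add: sum.distrib sum_distrib_left)

lemma relative_deviation:
  fixes l e1 e2 x y :: real
  assumes l: "l > 0" and x: "\<bar>x - a\<bar> \<le> e1" and y: "\<bar>y - l\<bar> \<le> e2" and e2: "e2 \<le> l / 2" and a: "0 \<le> a" "a \<le> P"
  shows "\<bar>x / y - a / l\<bar> \<le> (2 * e1 + 2 * (P / l) * e2) / l"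
proof -
  have y0: "y \<ge> l / 2" using y e2 by linarith
  have yl: "y > 0" using y0 l by linarith
  have "x / y - a / l = ((x - a) * l - a * (y - l)) / (y * l)" using yl l by (simp add: field_simps)
  then have "\<bar>x / y - a / l\<bar> = \<bar>(x - a) * l - a * (y - l)\<bar> / (y * l)" using yl l by simp
  also have "\<dots> \<le> (e1 * l + P * e2) / (y * l)"
  proof (rule divide_right_mono)
    have "\<bar>(x - a) * l - a * (y - l)\<bar> \<le> \<bar>x - a\<bar> * l + a * \<bar>y - l\<bar>"
      using abs_triangle_ineq4[of "(x - a) * l" "a * (y - l)"] l a by (simp add: abs_mult)
    also have "\<dots> \<le> e1 * l + P * e2" using x y a l by (intro add_mono mult_mono) auto
    finally show "\<bar>(x - a) * l - a * (y - l)\<bar> \<le> e1 * l + P * e2" .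
  qed (use yl l in simp)
  also have "\<dots> \<le> (e1 * l + P * e2) / (l / 2 * l)"
  proof (rule divide_left_mono)
    show "l / 2 * l \<le> y * l" using y0 l by (intro mult_right_mono) auto
    have "0 \<le> e1" "0 \<le> e2" "0 \<le> P" using x y a by linarith+
    then show "0 \<le> e1 * l + P * e2" using l by simp
    show "0 < y * l * (l / 2 * l)" using l yl by simp
  qed
  also have "\<dots> = (2 * e1 + 2 * (P / l) * e2) / l" using l by (simp add: field_simps)
  finally show ?thesis .
qed

text \<open>
  In terms of the relative positions \<open>z i\<close> in \<open>(V j, V k)\<close>, the local statistic of the inner pair times
  \<open>w = z k' - z j' \<le> 1\<close> is the sum of \<open>2 * z i - z j' - z k'\<close>.  For equidistant \<open>z i\<close> the outer summands and
  the change of centre cancel.  Therefore only the deviations of \<open>z i\<close> from equidistant positions near the two ends enter, each at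
  most \<open>D / (k - j)\<close>.
\<close>

lemma local_stat_inner_grid:
  fixes V :: "nat \<Rightarrow> real" and D :: real
  assumes jk: "j \<le> j'" "j' < k'" "k' \<le> k"
    and V: "\<And>i i'. j \<le> i \<Longrightarrow> i < i' \<Longrightarrow> i' \<le> k \<Longrightarrow> V i < V i'"
    and d: "\<And>i. i \<in> {j..j'} \<union> {k'..k} \<Longrightarrow> \<bar>(V i - V j) / (V k - V j) - (real i - real j) / (real k - real j)\<bar> \<le> D / (real k - real j)"
  shows "\<bar>local_stat j k V\<bar> \<le> \<bar>local_stat j' k' V\<bar> + 4 * D"
proof -
  define l where "l = real k - real j"
  define p where "p = j' - j"
  define p' where "p' = k - k'"
  define z where "z i = (V i - V j) / (V k - V j)" for i
  define e where "e i = z i - (real i - real j) / l" for i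
  have l: "l \<ge> 1" using jk by (simp add: l_def)
  have jp: "j' = j + p" "real j' = real j + real p" using jk by (auto simp: p_def)
  have kp: "k = k' + p'" "real k' = real k - real p'" using jk by (auto simp: p'_def)
  have pl: "real p + real p' + (real k' - real j') = l" using jp kp by (simp add: l_def)
  have Vk: "V j < V k" using V[of j k] jk by simp
  have eb: "\<bar>e i\<bar> \<le> D / l" if "i \<in> {j..j'} \<union> {k'..k}" for i
    using d[OF that] by (simp add: e_def z_def l_def)
  have D: "D \<ge> 0"
  proof -
    have "0 \<le> D / l" using eb[of j] jk abs_ge_zero[of "e j"] by (auto intro: order_trans)
    then show ?thesis using l by (simp add: zero_le_divide_iff)
  qed
  have rp: "rel_pos (V j) (V k) (V i) = 2 * z i - 1" for i by (simp add: rel_pos_def z_def)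
  have T: "local_stat j k V = (\<Sum>i=j..k. 2 * z i - 1)"
    using local_stat_closed[of j k V] V Vk jk by (simp add: rp)
  have Vk': "V j' < V k'" using V[of j' k'] jk by simp
  define w where "w = z k' - z j'"
  have wz: "w = (V k' - V j') / (V k - V j)" by (simp add: w_def z_def diff_divide_distrib)
  have w0: "w > 0" using Vk Vk' by (simp add: wz)
  have w1: "w \<le> 1"
  proof -
    have "V k' \<le> V k" "V j \<le> V j'" using V[of k' k] V[of j j'] jk by (cases "k' = k"; cases "j = j'"; simp)+
    then show ?thesis using Vk by (simp add: wz)
  qed
  have T': "local_stat j' k' V * w = (\<Sum>i=j'..k'. 2 * z i - z j' - z k')"
  proof -
    have "local_stat j' k' V = (\<Sum>i=j'..k'. rel_pos (V j') (V k') (V i))"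
      by (rule local_stat_closed) (use V jk Vk' in auto)
    moreover have "rel_pos (V j') (V k') (V i) * w = 2 * z i - z j' - z k'" for i
    proof -
      have "rel_pos (V j') (V k') (V i) * w = (V k' - V j') * rel_pos (V j') (V k') (V i) / (V k - V j)" by (simp add: wz)
      also have "\<dots> = (2 * V i - V j' - V k') / (V k - V j)" by (simp add: rel_pos_mult[OF Vk'])
      also have "\<dots> = (2 * (V i - V j) - (V j' - V j) - (V k' - V j)) / (V k - V j)" by simp
      also have "\<dots> = 2 * z i - z j' - z k'" by (simp only: z_def times_divide_eq_right[symmetric] diff_divide_distrib)
      finally show ?thesis .
    qed
    ultimately show ?thesis by (simp add: sum_distrib_right)
  qed
  have split: "(\<Sum>i=j..k. 2 * z i - 1) = (\<Sum>i=j..<j'. 2 * z i - 1) + (\<Sum>i=j'..k'. 2 * z i - 1) + (\<Sum>i=k'+1..<k'+1+p'. 2 * z i - 1)"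
  proof -
    have "{j..k} = ({j..<j'} \<union> {j'..k'}) \<union> {k'+1..<k'+1+p'}" using jk kp by auto
    moreover have "sum f (({j..<j'} \<union> {j'..k'}) \<union> {k'+1..<k'+1+p'}) = sum f {j..<j'} + sum f {j'..k'} + sum f {k'+1..<k'+1+p'}" for f :: "nat \<Rightarrow> real"
      using jk by (subst sum.union_disjoint, simp, simp, force, subst sum.union_disjoint) auto
    ultimately show ?thesis by simp
  qed
  have mid: "(\<Sum>i=j'..k'. 2 * z i - 1) = local_stat j' k' V * w + (real k' - real j' + 1) * (z j' + z k' - 1)"
  proof -
    have "(\<Sum>i=j'..k'. 2 * z i - 1) = (\<Sum>i=j'..k'. (2 * z i - z j' - z k') + (z j' + z k' - 1))" by simp
    also have "\<dots> = local_stat j' k' V * w + real (card {j'..k'}) * (z j' + z k' - 1)"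
      unfolding sum.distrib T' by simp
    finally show ?thesis using jk by (simp add: of_nat_diff)
  qed
  have left: "(\<Sum>i=j..<j'. 2 * z i - 1) = (real p * (real p - 1)) / l - real p + 2 * (\<Sum>i=j..<j'. e i)"
  proof -
    have "(\<Sum>i=j..<j'. 2 * z i - 1) = (\<Sum>i=j..<j'. 2 / l * (real i - real j) + (2 * e i + -1))"
      by (intro sum.cong) (auto simp: e_def)
    also have "\<dots> = 2 / l * (\<Sum>i=j..<j'. real i - real j) + 2 * (\<Sum>i=j..<j'. e i) + real (card {j..<j'}) * -1"
      by (rule sum_affine)
    also have "real (card {j..<j'}) = real p" by (simp add: p_def)
    also have "(\<Sum>i=j..<j'. real i - real j) = real p * (real p - 1) / 2" unfolding jp by (rule sum_offsets)
    finally show ?thesis by simp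
  qed
  have right: "(\<Sum>i=k'+1..<k'+1+p'. 2 * z i - 1) = real p' - (real p' * (real p' - 1)) / l + 2 * (\<Sum>i=k'+1..<k'+1+p'. e i)"
  proof -
    have zi: "2 * z i - 1 = 2 / l * (real i - real (k' + 1)) + (2 * e i + (1 - 2 * (real p' - 1) / l))" for i
    proof -
      have "real i - real j = (real i - real (k' + 1)) + (l - (real p' - 1))" using kp by (simp add: l_def)
      then have "(real i - real j) / l = (real i - real (k' + 1)) / l + (l / l - (real p' - 1) / l)"
        by (simp only: add_divide_distrib diff_divide_distrib)
      then have "(real i - real j) / l = (real i - real (k' + 1)) / l + (1 - (real p' - 1) / l)"
        using l by simp
      then show ?thesis by (simp add: e_def)
    qed
    have "(\<Sum>i=k'+1..<k'+1+p'. 2 * z i - 1) = 2 / l * (\<Sum>i=k'+1..<k'+1+p'. real i - real (k' + 1)) + 2 * (\<Sum>i=k'+1..<k'+1+p'. e i) + real (card {k'+1..<k'+1+p'}) * (1 - 2 * (real p' - 1) / l)"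
      unfolding zi by (rule sum_affine)
    also have "real (card {k'+1..<k'+1+p'}) = real p'" by simp
    also have "(\<Sum>i=k'+1..<k'+1+p'. real i - real (k' + 1)) = real p' * (real p' - 1) / 2" by (rule sum_offsets)
    finally have *: "(\<Sum>i=k'+1..<k'+1+p'. 2 * z i - 1) = 2 / l * (real p' * (real p' - 1) / 2) + 2 * (\<Sum>i=k'+1..<k'+1+p'. e i) + real p' * (1 - 2 * (real p' - 1) / l)" .
    have "2 / l * (x * (x - 1) / 2) + x * (1 - 2 * (x - 1) / l) = x - x * (x - 1) / l" for x
      using l by (simp add: field_simps)
    from this[of "real p'"] show ?thesis unfolding * by linarith
  qed
  have zj: "z j' = real p / l + e j'" by (simp add: e_def jp)
  have zk: "z k' = 1 - real p' / l + e k'"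
  proof -
    have "real k' - real j = l - real p'" using kp by (simp add: l_def)
    then show ?thesis using l by (simp add: e_def diff_divide_distrib)
  qed
  define c where "c = real k' - real j' + 1"
  have c: "c = l + 1 - real p - real p'" "0 \<le> c" using pl jk by (auto simp: c_def)
  define err where "err = c * (e j' + e k') + 2 * (\<Sum>i=j..<j'. e i) + 2 * (\<Sum>i=k'+1..<k'+1+p'. e i)"
  have main: "local_stat j k V = local_stat j' k' V * w + err"
  proof -
    \<comment> \<open>The cancellation for equidistant positions.\<close>
    have "c * (real p / l - real p' / l) + ((real p * (real p - 1)) / l - real p) + (real p' - (real p' * (real p' - 1)) / l) = 0"
      using l unfolding c(1) by (simp add: field_simps)
    moreover have "c * (z j' + z k' - 1) = c * (real p / l - real p' / l) + c * (e j' + e k')"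
      unfolding zj zk by (simp add: algebra_simps)
    ultimately show ?thesis unfolding T split mid left right err_def c_def[symmetric] by linarith
  qed
  have "\<bar>err\<bar> \<le> c * (2 * (D / l)) + 2 * (real p * (D / l)) + 2 * (real p' * (D / l))"
  proof -
    have "\<bar>e j' + e k'\<bar> \<le> 2 * (D / l)" using eb[of j'] eb[of k'] jk by auto
    then have 1: "\<bar>c * (e j' + e k')\<bar> \<le> c * (2 * (D / l))" unfolding abs_mult abs_of_nonneg[OF c(2)] using c(2) by (rule mult_left_mono)
    have "\<bar>\<Sum>i=j..<j'. e i\<bar> \<le> (\<Sum>i=j..<j'. D / l)" by (rule order_trans[OF sum_abs sum_mono]) (use eb in auto)
    then have 2: "\<bar>\<Sum>i=j..<j'. e i\<bar> \<le> real p * (D / l)" by (simp add: jp)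
    have "\<bar>\<Sum>i=k'+1..<k'+1+p'. e i\<bar> \<le> (\<Sum>i=k'+1..<k'+1+p'. D / l)" by (rule order_trans[OF sum_abs sum_mono]) (use eb kp in auto)
    then have 3: "\<bar>\<Sum>i=k'+1..<k'+1+p'. e i\<bar> \<le> real p' * (D / l)" by simp
    show ?thesis unfolding err_def using 1 2 3 by linarith
  qed
  also have "\<dots> = 2 * (l + 1) * (D / l)"
  proof -
    have "(l + 1 - a - b) * (2 * d) + 2 * (a * d) + 2 * (b * d) = 2 * (l + 1) * d" for a b d
      by (simp add: algebra_simps)
    then show ?thesis unfolding c(1) .
  qed
  also have "\<dots> = 2 * D * ((l + 1) / l)" by simp
  also have "\<dots> \<le> 2 * D * 2" using l D by (intro mult_left_mono) (auto simp: field_simps)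
  finally have err: "\<bar>err\<bar> \<le> 4 * D" by simp
  have "\<bar>local_stat j' k' V * w\<bar> \<le> \<bar>local_stat j' k' V\<bar>" using w0 w1 by (simp add: abs_mult mult_left_le)
  with err main show ?thesis by linarith
qed

section \<open>Comparison with index pairs on a grid\<close>

text \<open>
  The power \<open>2 ^ grid_exp s\<close> is comparable with \<open>s + 4\<close>, the factor lost in the modulus of continuity at scale \<open>s\<close>.
\<close>

definition grid_exp :: "nat \<Rightarrow> nat" where
  "grid_exp s = (LEAST c. s + 4 \<le> 2 ^ c)"

text \<open>
  Half the expected number of points in a dyadic cell of level \<open>s + 2 * grid_exp s\<close>; relative to the \<open>n / 2 ^ s\<close> indices of
  an interval at scale \<open>s\<close> it is of the order \<open>1 / (s + 4)\<^sup>2\<close>.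
\<close>

definition mesh :: "nat \<Rightarrow> nat \<Rightarrow> nat" where
  "mesh n s = nat \<lfloor>real n / 2 ^ (s + 2 * grid_exp s) / 2\<rfloor>"

definition grid_pairs :: "nat \<Rightarrow> nat \<Rightarrow> (nat \<times> nat) set" where
  "grid_pairs n s = {(j, k) \<in> index_pairs n. mesh n s dvd j \<and> mesh n s dvd k \<and>
     real (n + 1) / 2 ^ (s + 2) \<le> real (k - j) \<and> real (k - j) \<le> real (n + 1) / 2 ^ s}"

lemma grid_exp_bounds: "s + 4 \<le> 2 ^ grid_exp s" "2 ^ grid_exp s \<le> 2 * (s + 4)" "2 \<le> grid_exp s"
proof -
  have ex: "s + 4 \<le> 2 ^ (s + 4)" by (rule less_imp_le[OF less_exp])
  show 1: "s + 4 \<le> 2 ^ grid_exp s" unfolding grid_exp_def by (rule LeastI[of _ "s + 4"]) (rule ex)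
  show 2: "2 \<le> grid_exp s"
  proof (rule ccontr)
    assume "\<not> 2 \<le> grid_exp s"
    then have "grid_exp s = 0 \<or> grid_exp s = 1" by auto
    with 1 show False by auto
  qed
  obtain c where c: "grid_exp s = Suc c" using 2 by (cases "grid_exp s") auto
  have "\<not> s + 4 \<le> 2 ^ c" using not_less_Least[of c "\<lambda>c. s + 4 \<le> 2 ^ c"] c unfolding grid_exp_def by simp
  then show "2 ^ grid_exp s \<le> 2 * (s + 4)" unfolding c by simp
qed

lemma Gamma_fun_ge:
  assumes "0 < d" "d \<le> 1" shows "Gamma_fun d \<ge> 1" "(Gamma_fun d)\<^sup>2 = 2 * ln (exp 1 / d)"
proof -
  have l: "ln (exp 1 / d) \<ge> 1"
  proof -
    have "ln d \<le> 0" using assms ln_le_zero_iff by blast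
    moreover have "ln (exp 1 / d) = 1 - ln d" using assms by (simp add: ln_div)
    ultimately show ?thesis by linarith
  qed
  then show "Gamma_fun d \<ge> 1" unfolding Gamma_fun_def by (intro real_le_rsqrt) auto
  show "(Gamma_fun d)\<^sup>2 = 2 * ln (exp 1 / d)" unfolding Gamma_fun_def using l by simp
qed

lemma Gamma_fun_antimono: "0 < d \<Longrightarrow> d \<le> d' \<Longrightarrow> Gamma_fun d' \<le> Gamma_fun d"
  unfolding Gamma_fun_def by (intro real_sqrt_le_mono mult_left_mono) (auto simp: ln_div)

lemma Gamma_fun_half:
  assumes "0 < d" "d \<le> 1" "d / 2 \<le> d'" shows "Gamma_fun d' \<le> Gamma_fun d + 1"
proof -
  have "ln (2::real) \<le> 1" using ln_le_minus_one[of 2] by simp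
  moreover have "ln (exp 1 / (d / 2)) = ln 2 + ln (exp 1 / d)"
  proof -
    have "exp 1 / (d / 2) = 2 * (exp 1 / d)" by simp
    moreover have "ln (2 * (exp 1 / d)) = ln 2 + ln (exp 1 / d)" using assms by (simp add: ln_mult ln_div)
    ultimately show ?thesis by (simp only:)
  qed
  ultimately have "ln (exp 1 / (d / 2)) \<le> ln (exp 1 / d) + 1" by linarith
  then have "2 * ln (exp 1 / (d / 2)) \<le> (Gamma_fun d)\<^sup>2 + 2" using Gamma_fun_ge(2)[OF assms(1,2)] by simp
  also have "\<dots> \<le> (Gamma_fun d + 1)\<^sup>2" using Gamma_fun_ge(1)[OF assms(1,2)] by (simp add: power2_sum)
  finally have "Gamma_fun (d / 2) \<le> Gamma_fun d + 1"
    unfolding Gamma_fun_def[of "d / 2"] using Gamma_fun_ge(1)[OF assms(1,2)] by (intro real_le_lsqrt) auto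
  moreover have "Gamma_fun d' \<le> Gamma_fun (d / 2)" using assms by (intro Gamma_fun_antimono) auto
  ultimately show ?thesis by linarith
qed

text \<open>
  Equivalently, the pair pushes \<open>multiscale_stat\<close> above \<open>\<kappa>\<close>.
\<close>

definition exceeds :: "nat \<Rightarrow> real \<Rightarrow> nat \<times> nat \<Rightarrow> (nat \<Rightarrow> real) \<Rightarrow> bool" where
  "exceeds n \<kappa> = (\<lambda>(j, k) V. sqrt (real (k - j - 1) / 3) * (Gamma_fun (real (k - j) / real (n + 1)) + \<kappa>) < \<bar>local_stat j k V\<bar>)"

text \<open>
  A bound for \<open>s + 4\<close> over all scales \<open>s\<close> that occur.
\<close>

definition log_scale :: "nat \<Rightarrow> real" where "log_scale n = log 2 (real n) + 5"

text \<open>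
  Smaller than any power of \<open>n\<close>, which keeps the pairs closer than this few enough for a union bound, and larger than any
  power of \<open>ln n\<close>, which makes the error terms of all other pairs negligible.
\<close>

definition cutoff :: "nat \<Rightarrow> real" where "cutoff n = exp (sqrt (ln (real n + 1)))"

text \<open>
  What the comparison requires of \<open>n\<close> and of the finest level \<open>R\<close>.  It holds if \<open>n / 2 ^ R\<close> is of the order
  \<open>(ln n) ^ 3\<close>.
\<close>

definition large_enough :: "real \<Rightarrow> nat \<Rightarrow> nat \<Rightarrow> bool" where
  "large_enough lam n R \<longleftrightarrow> n \<ge> 3 \<and> real R + 4 \<le> log_scale n \<and>
     (let \<rho> = real n / 2 ^ R; y = cutoff n / (8 * (log_scale n)\<^sup>2) in
       1 \<le> \<rho> \<and> lam * log_scale n \<le> 2 * sqrt \<rho> \<and> 6 * \<rho> + 1 \<le> sqrt (cutoff n) \<and> 24 * \<rho> + 8 \<le> y \<and>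
       (336 * lam * log_scale n)\<^sup>2 < y \<and> 126 * lam * log_scale n + 2 \<le> sqrt (cutoff n))"

lemma modulus_le:
  assumes "lam * (real R + 4) \<le> 2 * sqrt (real n / 2 ^ R)"
  shows "modulus n lam R q \<le> 21 * lam * (real q + 4) * sqrt (real n / 2 ^ q) + 6 * (real n / 2 ^ R)"
proof -
  have "level_bound n lam R \<le> 2 * sqrt (real n / 2 ^ R) * sqrt (real n / 2 ^ R)"
    unfolding level_bound_def by (rule mult_right_mono[OF assms]) simp
  also have "\<dots> = 2 * (real n / 2 ^ R)"
    unfolding mult.assoc by (subst real_sqrt_mult_self) simp
  finally show ?thesis unfolding modulus_def by (simp add: level_bound_def)
qed

lemma dyadic_scale:
  assumes "1 \<le> l" "l \<le> (m::nat)"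
  shows "\<exists>s. real l \<le> real m / 2 ^ s \<and> real m / 2 ^ (s + 1) < real l"
proof -
  have "1 \<le> m div l" using assms by (simp add: Suc_le_eq div_greater_zero_iff)
  then obtain s where s: "2 ^ s \<le> m div l" "m div l < 2 ^ (s + 1)"
    using ex_power_ivl1[of 2 "m div l"] by auto
  have "2 ^ s * l \<le> m" using s(1) by (metis div_times_less_eq_dividend mult_le_mono1 order_trans)
  then have 1: "real (2 ^ s * l) \<le> real m" by (simp only: of_nat_le_iff)
  have "m < 2 ^ (s + 1) * l" using s(2) assms by (simp add: div_less_iff_less_mult)
  then have 2: "real m < real (2 ^ (s + 1) * l)" by (simp only: of_nat_less_iff)
  show ?thesis using 1 2 by (intro exI[of _ s]) (simp add: field_simps)
qed

text \<open>
  Let \<open>l = k - j\<close> be about \<open>n / 2 ^ s\<close>, and let \<open>(j', k')\<close> be the largest pair of multiples of the mesh inside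
  \<open>(j, k)\<close>.  Within a mesh of either end the order statistics deviate from linear interpolation by the modulus at level
  \<open>s + 2 * grid_exp s\<close>, which is of the order \<open>(s + 4) * sqrt l / 2 ^ grid_exp s\<close>, that is \<open>sqrt l\<close>.  The error
  of \<open>V k - V j\<close> itself is of the larger order \<open>(s + 4) * sqrt l\<close>, but near the ends it is multiplied by the
  small ratio of mesh and \<open>l\<close>.  By \<open>local_stat_inner_grid\<close> the two local statistics differ by at most a constant times \<open>sqrt l\<close>, which
  increases \<open>\<kappa>\<close> by a constant.
\<close>

lemma not_exceeds_from_grid:
  fixes \<kappa> lam :: real
  assumes gen: "generic n x" and cr: "cells_regular n lam R x" and lam: "lam \<ge> 1" and \<kappa>: "\<kappa> \<ge> 0"
    and le: "large_enough lam n R"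
    and small: "\<And>jk. jk \<in> index_pairs n \<Longrightarrow> real (snd jk - fst jk) < cutoff n \<Longrightarrow> \<not> exceeds n \<kappa> jk ((!) (unif_list n x))"
    and grid: "\<And>s jk. jk \<in> grid_pairs n s \<Longrightarrow> real n / 2 ^ (s + 2 * grid_exp s) \<ge> 8 \<Longrightarrow> \<not> exceeds n \<kappa> jk ((!) (unif_list n x))"
    and jk: "(j, k) \<in> index_pairs n"
  shows "\<not> exceeds n (\<kappa> + 1 + 40 * (63 * lam + 1)) (j, k) ((!) (unif_list n x))"
proof -
  define V where "V = (!) (unif_list n x)"
  define N where "N = real (n + 1)"
  define l where "l = real k - real j"
  define K where "K = \<kappa> + 1 + 40 * (63 * lam + 1)"
  have jk': "j < k" "k \<le> n + 1" "k - j > 1" using jk by (auto simp: index_pairs_def)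
  have l: "real (k - j) = l" "l \<ge> 2" "l \<le> N" "real (k - j - 1) = l - 1"
    using jk' by (auto simp: l_def N_def of_nat_diff)
  have lN: "0 < l / N" "l / N \<le> 1" using l by (auto simp: N_def)
  show ?thesis
  proof (cases "l < cutoff n")
    case True
    then have "\<not> exceeds n \<kappa> (j, k) V" using small[OF jk] l(1) by (simp add: V_def)
    then have "\<bar>local_stat j k V\<bar> \<le> sqrt ((l - 1) / 3) * (Gamma_fun (l / N) + \<kappa>)"
      unfolding exceeds_def prod.case l N_def[symmetric] by simp
    also have "\<dots> \<le> sqrt ((l - 1) / 3) * (Gamma_fun (l / N) + K)"
      using lam l by (intro mult_left_mono) (auto simp: K_def)
    finally show ?thesis unfolding exceeds_def prod.case l N_def[symmetric] V_def[symmetric] K_def[symmetric] by simp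
  next
    case False
    define L where "L = log_scale n"
    define \<rho> where "\<rho> = real n / 2 ^ R"
    define y0 where "y0 = cutoff n / (8 * L\<^sup>2)"
    have le': "n \<ge> 3" "real R + 4 \<le> L" "1 \<le> \<rho>" "lam * L \<le> 2 * sqrt \<rho>" "6 * \<rho> + 1 \<le> sqrt (cutoff n)" "24 * \<rho> + 8 \<le> y0"
      "(336 * lam * L)\<^sup>2 < y0" "126 * lam * L + 2 \<le> sqrt (cutoff n)"
      using le unfolding large_enough_def Let_def L_def \<rho>_def y0_def by auto
    have lcut: "cutoff n \<le> l" using False by simp
    have sl: "sqrt (cutoff n) \<le> sqrt l" using lcut by simp
    have n0: "real n \<ge> 3" using le' by simp
    obtain s where s: "l \<le> N / 2 ^ s" "N / 2 ^ (s + 1) < l"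
    proof -
      have "1 \<le> k - j" "k - j \<le> n + 1" using jk' by auto
      from dyadic_scale[OF this] show ?thesis using that unfolding l(1) N_def by blast
    qed
    define u where "u = real n / 2 ^ s"
    have Nn: "N \<le> 4 / 3 * real n" "N = real n + 1" using n0 by (auto simp: N_def)
    have u1: "u \<le> 2 * l"
    proof -
      have "u \<le> N / 2 ^ s" unfolding u_def N_def by (intro divide_right_mono) auto
      also have "\<dots> = 2 * (N / 2 ^ (s + 1))" by simp
      finally show ?thesis using s(2) by linarith
    qed
    have u2: "l \<le> 4 / 3 * u"
    proof -
      have "N / 2 ^ s \<le> (4 / 3 * real n) / 2 ^ s" using Nn(1) by (intro divide_right_mono) auto
      then show ?thesis using s(1) by (simp add: u_def)
    qed
    have u0: "u > 0" using u2 l by linarith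
    define c where "c = grid_exp s"
    define q where "q = s + 2 * c"
    define C where "C = (2::real) ^ c"
    note ge = grid_exp_bounds[of s, folded c_def]
    have Cb: "real s + 4 \<le> C" "C \<le> 2 * (real s + 4)" "4 \<le> C"
    proof -
      have "real (s + 4) \<le> real (2 ^ c)" using ge(1) by (simp only: of_nat_le_iff)
      then show "real s + 4 \<le> C" by (simp add: C_def)
      have "real (2 ^ c) \<le> real (2 * (s + 4))" using ge(2) by (simp only: of_nat_le_iff)
      then show "C \<le> 2 * (real s + 4)" by (simp add: C_def)
      show "4 \<le> C" using \<open>real s + 4 \<le> C\<close> by simp
    qed
    have c2: "2 * real c \<le> C"
    proof -
      have "2 * c \<le> 2 ^ c" using ge(3)
      proof (induction c rule: dec_induct)
        case (step m)
        have "(2::nat) \<le> 2 ^ m" using step.hyps using power_increasing[of 1 m "2::nat"] by simp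
        then show ?case using step by simp
      qed simp
      then have "real (2 * c) \<le> real (2 ^ c)" by (simp only: of_nat_le_iff)
      then show ?thesis by (simp add: C_def)
    qed
    define y where "y = real n / 2 ^ q"
    have y: "y = u / C\<^sup>2" by (simp add: y_def q_def u_def C_def power_add power_even_eq)
    have q4: "real q + 4 \<le> 2 * C" using Cb c2 by (simp add: q_def)
    have s4: "real s + 4 \<le> L"
    proof -
      have "2 ^ s \<le> N / l" using s(1) l by (simp add: field_simps)
      also have "\<dots> \<le> N / 2" using l by (intro divide_left_mono) (auto simp: N_def)
      also have "\<dots> \<le> real n" using Nn n0 by simp
      finally have "2 powr real s \<le> real n" by (simp add: powr_realpow)
      then have "real s \<le> log 2 (real n)" using n0 by (subst le_log_iff) auto
      then show ?thesis by (simp add: L_def log_scale_def)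
    qed
    have L0: "L \<ge> 4" using s4 by simp
    have CL: "C \<le> 2 * L" using Cb s4 by simp
    have yy0: "y0 \<le> y"
    proof -
      have "C\<^sup>2 \<le> (2 * L)\<^sup>2" using CL Cb by (intro power_mono) auto
      then have C2: "C\<^sup>2 \<le> 4 * L\<^sup>2" by (simp add: power_mult_distrib)
      have "y0 \<le> (2 * u) / (8 * L\<^sup>2)" unfolding y0_def using lcut u2 u0 by (intro divide_right_mono) auto
      also have "\<dots> = u / (4 * L\<^sup>2)" by simp
      also have "\<dots> \<le> y" unfolding y using C2 u0 Cb L0 by (intro divide_left_mono) auto
      finally show ?thesis .
    qed
    have y8: "y \<ge> 24 * \<rho> + 8" using le' yy0 by linarith
    have y0: "y > 0" using y8 le' by linarith
    have qR: "q \<le> R"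
    proof -
      have "real n / 2 ^ R \<le> real n / 2 ^ q" using y8 le' unfolding y_def[symmetric] \<rho>_def[symmetric] by linarith
      then have "(2::real) ^ q \<le> 2 ^ R" using n0 by (simp add: field_simps)
      then show ?thesis by simp
    qed
    have reg: "lam * (real R + 4) \<le> 2 * sqrt (real n / 2 ^ R)"
      using le'(2,4) lam mult_left_mono[OF le'(2), of lam] unfolding \<rho>_def[symmetric] by linarith
    \<comment> \<open>Deviation of order statistics whose indices differ by at most one mesh.\<close>
    define E1 where "E1 = modulus n lam R q + 1"
    have sy: "sqrt y = sqrt u / C" unfolding y real_sqrt_divide using Cb by simp
    have E1a: "E1 \<le> 42 * lam * sqrt u + (6 * \<rho> + 1)"
    proof -
      have "21 * lam * (real q + 4) * sqrt y \<le> 21 * lam * (2 * C) * sqrt y"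
        using q4 lam y0 by (intro mult_right_mono mult_left_mono) auto
      also have "\<dots> = 42 * lam * sqrt u" using Cb by (simp add: sy)
      finally show ?thesis using modulus_le[OF reg, of q] unfolding E1_def y_def[symmetric] \<rho>_def[symmetric] by linarith
    qed
    have su: "sqrt u \<le> 3/2 * sqrt l"
    proof (rule real_le_lsqrt)
      show "u \<le> (3/2 * sqrt l)\<^sup>2" using u1 l by (simp add: power_mult_distrib power2_eq_square)
    qed (use l in auto)
    have E1: "E1 \<le> (63 * lam + 1) * sqrt l"
    proof -
      have "42 * lam * sqrt u \<le> 42 * lam * (3/2 * sqrt l)" using su lam by (intro mult_left_mono) auto
      also have "\<dots> = 63 * lam * sqrt l" by simp
      finally show ?thesis using E1a le'(5) sl unfolding distrib_right mult_1_left by linarith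
    qed
    have E1y: "E1 < y / 2"
    proof -
      have "336 * lam * L < sqrt y" using le'(7) yy0 lam L0 by (intro real_less_rsqrt) linarith
      then have "336 * lam * L * sqrt y < sqrt y * sqrt y" using y0 by (intro mult_strict_right_mono) auto
      then have 1: "84 * lam * L * sqrt y < y / 4" using y0 by simp
      have "sqrt u = C * sqrt y" unfolding sy using Cb by simp
      also have "\<dots> \<le> 2 * L * sqrt y" using CL y0 by (intro mult_right_mono) auto
      finally have "42 * lam * sqrt u \<le> 42 * lam * (2 * L * sqrt y)" using lam by (intro mult_left_mono) auto
      also have "\<dots> = 84 * lam * L * sqrt y" by simp
      finally show ?thesis using 1 E1a y8 by linarith
    qed
    define P where "P = mesh n s"
    have Pfl: "P = nat \<lfloor>y / 2\<rfloor>" by (simp add: P_def mesh_def y_def q_def c_def)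
    have Py: "real P \<le> y / 2" unfolding Pfl using y0 by (intro of_nat_floor) simp
    have P1: "P \<ge> 1" unfolding Pfl using y8 le' by (simp add: le_nat_iff le_floor_iff)
    define q2 where "q2 = s - 2"
    have q2: "q2 \<le> R" using qR by (simp add: q2_def q_def)
    \<comment> \<open>Deviation of the length of the whole interval.  The level \<open>s - 2\<close> leaves room for intervals longer
      than expected; where the subtraction is truncated, the level 0 is always sufficient.\<close>
    define E2 where "E2 = modulus n lam R q2 + 1"
    have v: "real n / 2 ^ q2 \<le> 4 * u"
    proof (cases "s \<ge> 2")
      case True
      then have "2 ^ s = (2::real) ^ q2 * 4" by (simp add: q2_def power_diff)
      then show ?thesis by (simp add: u_def)
    next
      case False
      then have "s = 0 \<or> s = 1" by auto
      then show ?thesis by (auto simp: q2_def u_def)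
    qed
    have E2a: "E2 \<le> 63 * lam * (real s + 4) * sqrt l + sqrt l"
    proof -
      have "sqrt (real n / 2 ^ q2) \<le> 3 * sqrt l"
      proof (rule real_le_lsqrt)
        have "real n / 2 ^ q2 \<le> 8 * l" using v u1 by linarith
        also have "\<dots> \<le> (3 * sqrt l)\<^sup>2" using l by (simp add: power_mult_distrib)
        finally show "real n / 2 ^ q2 \<le> (3 * sqrt l)\<^sup>2" .
      qed (use l in auto)
      then have "21 * lam * (real q2 + 4) * sqrt (real n / 2 ^ q2) \<le> 21 * lam * (real s + 4) * (3 * sqrt l)"
        using lam by (intro mult_mono mult_left_mono) (auto simp: q2_def)
      also have "\<dots> = 63 * lam * (real s + 4) * sqrt l" by simp
      finally show ?thesis using modulus_le[OF reg, of q2] le'(5) sl unfolding E2_def \<rho>_def[symmetric] by linarith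
    qed
    have E2l: "E2 \<le> l / 2"
    proof -
      have "E2 \<le> (63 * lam * L + 1) * sqrt l"
      proof -
        have "63 * lam * (real s + 4) * sqrt l \<le> 63 * lam * L * sqrt l"
          using s4 lam l by (intro mult_right_mono mult_left_mono) auto
        then show ?thesis using E2a unfolding distrib_right[of _ _ "sqrt l"] mult_1_left by linarith
      qed
      also have "\<dots> \<le> (sqrt l / 2) * sqrt l"
      proof (rule mult_right_mono)
        show "63 * lam * L + 1 \<le> sqrt l / 2" using le'(8) sl by linarith
      qed (use l in simp)
      also have "\<dots> = l / 2" using l by simp
      finally show ?thesis .
    qed
    have dev2: "\<bar>real n * (V k - V j) - l\<bar> \<le> E2"
    proof -
      have "q2 = 0 \<or> modulus n lam R q2 + 1 + real (k - j) < real n / 2 ^ q2"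
      proof (cases "s \<ge> 3")
        case True
        then have "2 ^ s = (2::real) ^ q2 * 4" by (simp add: q2_def power_diff)
        then have "real n / 2 ^ q2 = 4 * u" by (simp add: u_def)
        moreover have "E2 + l < 4 * u" using E2l u2 u0 by linarith
        ultimately show ?thesis by (simp add: E2_def l)
      qed (simp add: q2_def)
      from order_stat_modulus[OF gen cr _ _ jk'(2) q2 this] lam jk' show ?thesis
        unfolding V_def E2_def l(1) by simp
    qed
    have dev1: "\<bar>real n * (V i' - V i) - real (i' - i)\<bar> \<le> E1" if "i \<le> i'" "i' \<le> n + 1" "i' - i \<le> P" for i i'
    proof -
      have "real (i' - i) \<le> real P" using that(3) by (simp only: of_nat_le_iff)
      then have "q = 0 \<or> modulus n lam R q + 1 + real (i' - i) < real n / 2 ^ q"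
        using E1y Py unfolding E1_def[symmetric] y_def[symmetric] by linarith
      from order_stat_modulus[OF gen cr _ that(1,2) qR this] lam show ?thesis
        unfolding V_def E1_def by simp
    qed
    have Pl: "real P / l * E2 \<le> (63 * lam + 1) * sqrt l"
    proof -
      have "real P \<le> l / C\<^sup>2"
      proof -
        have "y / 2 \<le> l / C\<^sup>2" unfolding y using u1 Cb by (simp add: field_simps)
        then show ?thesis using Py by linarith
      qed
      then have "real P / l \<le> 1 / C\<^sup>2" using l by (simp add: field_simps)
      moreover have "E2 \<le> (63 * lam * C + C) * sqrt l"
      proof -
        have "63 * lam * (real s + 4) * sqrt l \<le> 63 * lam * C * sqrt l"
          using Cb lam l by (intro mult_right_mono mult_left_mono) auto
        moreover have "1 * sqrt l \<le> C * sqrt l" using Cb l by (intro mult_right_mono) auto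
        ultimately show ?thesis using E2a unfolding distrib_right[of _ _ "sqrt l"] mult_1_left by linarith
      qed
      moreover have "0 \<le> E2" using dev2 abs_ge_zero order_trans by blast
      ultimately have "real P / l * E2 \<le> 1 / C\<^sup>2 * ((63 * lam * C + C) * sqrt l)"
        using l by (intro mult_mono) auto
      also have "\<dots> = (63 * lam + 1) * sqrt l / C" using Cb by (simp add: power2_eq_square field_simps)
      also have "\<dots> \<le> (63 * lam + 1) * sqrt l / 1" using Cb lam l by (intro divide_left_mono) auto
      finally show ?thesis by simp
    qed
    \<comment> \<open>The multiples of the mesh next to \<open>j\<close> from above and next to \<open>k\<close> from below.\<close>
    define j' where "j' = ((j + P - 1) div P) * P"
    define k' where "k' = (k div P) * P"
    have j': "j \<le> j'" "j' \<le> j + P" "P dvd j'"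
    proof -
      have "(j + P - 1) div P * P + (j + P - 1) mod P = j + P - 1" by simp
      moreover have "(j + P - 1) mod P < P" using P1 by simp
      ultimately show "j \<le> j'" "j' \<le> j + P" using P1 unfolding j'_def by linarith+
      show "P dvd j'" by (simp add: j'_def)
    qed
    have k': "k' \<le> k" "k \<le> k' + P" "P dvd k'"
    proof -
      have "k div P * P + k mod P = k" by simp
      moreover have "k mod P < P" using P1 by simp
      ultimately show "k' \<le> k" "k \<le> k' + P" unfolding k'_def by linarith+
      show "P dvd k'" by (simp add: k'_def)
    qed
    have P16: "real P \<le> l / 16"
    proof -
      have "y / 2 \<le> l / 16"
      proof -
        have "4\<^sup>2 \<le> C\<^sup>2" using Cb by (intro power_mono) auto
        then have "u / C\<^sup>2 \<le> u / 16" using u0 Cb by (intro divide_left_mono) auto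
        then have "u / C\<^sup>2 / 2 \<le> u / 16 / 2" by (rule divide_right_mono) simp
        also have "\<dots> \<le> l / 16" using u1 by simp
        finally show ?thesis unfolding y .
      qed
      then show ?thesis using Py by linarith
    qed
    have rj: "real j' \<le> real j + real P" "real j \<le> real j'" using j' by (auto simp flip: of_nat_add simp: of_nat_le_iff)
    have rk: "real k \<le> real k' + real P" "real k' \<le> real k" using k' by (auto simp flip: of_nat_add simp: of_nat_le_iff)
    define l' where "l' = real k' - real j'"
    have l': "l' \<ge> 7/8 * l" "l' \<le> l" using rj rk P16 by (auto simp: l'_def l_def)
    have l8: "l \<ge> 8"
    proof -
      have "126 * 1 * 4 \<le> 126 * lam * L" using lam L0 by (intro mult_mono) auto
      then have "3 \<le> sqrt l" using le'(8) sl by linarith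
      then have "3 * 3 \<le> sqrt l * sqrt l" using l(2) by (intro mult_mono) auto
      then show ?thesis using l by simp
    qed
    have jk2: "j' < k'" "k' - j' > 1" "k' \<le> n + 1" "real (k' - j') = l'" "real (k' - j' - 1) = l' - 1"
    proof -
      have "l' > 1" using l' l8 by linarith
      then have "real (j' + 1) < real k'" by (simp add: l'_def)
      then have *: "j' + 1 < k'" by (simp only: of_nat_less_iff)
      then show "j' < k'" "k' - j' > 1" by auto
      show "k' \<le> n + 1" using k' jk' by simp
      show "real (k' - j') = l'" "real (k' - j' - 1) = l' - 1" using * by (auto simp: l'_def of_nat_diff)
    qed
    have gp: "(j', k') \<in> grid_pairs n s"
    proof -
      have "N / 2 ^ (s + 2) \<le> l'"
      proof -
        define h where "h = N / 2 ^ (s + 1)"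
        have "N / 2 ^ (s + 2) = h / 2" by (simp add: h_def)
        moreover have "h < l" using s(2) by (simp add: h_def)
        ultimately show ?thesis using l'(1) l(2) by linarith
      qed
      moreover have "l' \<le> N / 2 ^ s" using l' s by linarith
      ultimately show ?thesis using jk2 j'(3) k'(3) by (simp add: grid_pairs_def index_pairs_def P_def N_def)
    qed
    have "real n / 2 ^ (s + 2 * grid_exp s) \<ge> 8" using y8 le' unfolding c_def[symmetric] q_def[symmetric] y_def[symmetric] by linarith
    from grid[OF gp this] have "\<not> exceeds n \<kappa> (j', k') V" unfolding V_def .
    then have T': "\<bar>local_stat j' k' V\<bar> \<le> sqrt ((l' - 1) / 3) * (Gamma_fun (l' / N) + \<kappa>)"
      unfolding exceeds_def prod.case jk2 N_def[symmetric] by simp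
    define D where "D = 2 * E1 + 2 * (real P / l) * E2"
    have D: "D \<le> 4 * (63 * lam + 1) * sqrt l" unfolding D_def mult.assoc using E1 Pl by linarith
    have V: "V i < V i'" if "i < i'" "i' \<le> n + 1" for i i'
      unfolding V_def using sorted_wrt_nth_less[OF unif_list_facts(1)[OF gen] that(1)] that(2) unif_list_facts(2)[OF gen] by simp
    have "\<bar>local_stat j k V\<bar> \<le> \<bar>local_stat j' k' V\<bar> + 4 * D"
    proof (rule local_stat_inner_grid[OF j'(1) jk2(1) k'(1)])
      show "V i < V i'" if "j \<le> i" "i < i'" "i' \<le> k" for i i' using V that jk' by simp
      have Vjk: "V j < V k" using V jk' by simp
      have n1: "real n > 0" using n0 by simp
      fix i assume "i \<in> {j..j'} \<union> {k'..k}"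
      \<comment> \<open>Near the right end, positions are measured from \<open>k\<close>, since the error of a difference of
        order statistics is small only if their indices are close.\<close>
      then consider "i \<in> {j..j'}" | "i \<in> {k'..k}" by blast
      then show "\<bar>(V i - V j) / (V k - V j) - (real i - real j) / (real k - real j)\<bar> \<le> D / (real k - real j)"
      proof cases
        case 1
        have ia: "i \<le> n + 1" "i - j \<le> P" using 1 j' jk2 by auto
        have ri: "real (i - j) = real i - real j" using 1 by (simp add: of_nat_diff)
        have rP: "real i - real j \<le> real P" using ia(2) unfolding ri[symmetric] by (simp only: of_nat_le_iff)
        have d1: "\<bar>real n * (V i - V j) - (real i - real j)\<bar> \<le> E1" using dev1[of j i] 1 ia ri by simp
        have "\<bar>real n * (V i - V j) / (real n * (V k - V j)) - (real i - real j) / l\<bar> \<le> (2 * E1 + 2 * (real P / l) * E2) / l"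
          using l rP 1 by (intro relative_deviation[OF _ d1 dev2 E2l]) auto
        then show ?thesis using n1 by (simp add: D_def l_def)
      next
        case 2
        have ia: "k - i \<le> P" using 2 k' by auto
        have ri: "real (k - i) = real k - real i" using 2 by (simp add: of_nat_diff)
        have rP: "real k - real i \<le> real P" using ia unfolding ri[symmetric] by (simp only: of_nat_le_iff)
        have d1: "\<bar>real n * (V k - V i) - (real k - real i)\<bar> \<le> E1" using dev1[of i k] 2 ia ri jk' by simp
        have "\<bar>real n * (V k - V i) / (real n * (V k - V j)) - (real k - real i) / l\<bar> \<le> (2 * E1 + 2 * (real P / l) * E2) / l"
          using l rP 2 by (intro relative_deviation[OF _ d1 dev2 E2l]) auto
        then have a: "\<bar>(V k - V i) / (V k - V j) - (real k - real i) / l\<bar> \<le> D / l" using n1 by (simp add: D_def)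
        have e1: "(V i - V j) / (V k - V j) = 1 - (V k - V i) / (V k - V j)" using Vjk by (simp add: field_simps)
        have e2: "(real i - real j) / l = 1 - (real k - real i) / l" using l by (simp add: l_def field_simps)
        show ?thesis using a unfolding e1 l_def[symmetric] e2 by linarith
      qed
    qed
    also have "\<dots> \<le> sqrt ((l - 1) / 3) * (Gamma_fun (l / N) + 1 + \<kappa>) + 16 * (63 * lam + 1) * sqrt l"
    proof -
      have "Gamma_fun (l' / N) \<le> Gamma_fun (l / N) + 1"
      proof (rule Gamma_fun_half[OF lN])
        have "l / 2 \<le> l'" using l' l by linarith
        then have "l / 2 / N \<le> l' / N" by (intro divide_right_mono) (auto simp: N_def)
        then show "l / N / 2 \<le> l' / N" by simp
      qed
      moreover have "0 \<le> Gamma_fun (l' / N)"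
        using Gamma_fun_ge(1)[of "l' / N"] l' l l8 lN by (simp add: N_def)
      ultimately have "sqrt ((l' - 1) / 3) * (Gamma_fun (l' / N) + \<kappa>) \<le> sqrt ((l - 1) / 3) * (Gamma_fun (l / N) + 1 + \<kappa>)"
        using l' l8 \<kappa> by (intro mult_mono real_sqrt_le_mono divide_right_mono) auto
      then show ?thesis using T' D by linarith
    qed
    also have "16 * (63 * lam + 1) * sqrt l \<le> sqrt ((l - 1) / 3) * (40 * (63 * lam + 1))"
    proof -
      have "sqrt l \<le> 5/2 * sqrt ((l - 1) / 3)"
      proof (rule real_le_lsqrt)
        have "(5/2 * sqrt ((l - 1) / 3))\<^sup>2 = 25/12 * (l - 1)" using l by (simp add: power_mult_distrib power2_eq_square)
        then show "l \<le> (5/2 * sqrt ((l - 1) / 3))\<^sup>2" using l by simp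
      qed (use l in auto)
      then have "16 * (63 * lam + 1) * sqrt l \<le> 16 * (63 * lam + 1) * (5/2 * sqrt ((l - 1) / 3))" using lam by (intro mult_left_mono) auto
      moreover have "16 * X * (5/2 * z) = z * (40 * X)" for X z :: real by simp
      ultimately show ?thesis by (simp only:)
    qed
    finally have "\<bar>local_stat j k V\<bar> \<le> sqrt ((l - 1) / 3) * (Gamma_fun (l / N) + K)"
      by (simp add: K_def distrib_left add_ac)
    then show ?thesis unfolding exceeds_def prod.case l N_def[symmetric] V_def[symmetric] K_def[symmetric] by simp
  qed
qed

section \<open>Boundedness of the quantiles\<close>

abbreviation unif_stats :: "nat \<Rightarrow> (nat \<Rightarrow> real) \<Rightarrow> nat \<Rightarrow> real" where
  "unif_stats n x \<equiv> ext_order_stats (Some 0) (Some 1) n x"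

lemma measurable_unif_stats [measurable]: "(\<lambda>x. unif_stats n x i) \<in> borel_measurable (uniform_sample n)"
  by (rule measurable_ext_order_stats) (rule uniform_sample_coord)

lemma measurable_unif_local_stat: "(\<lambda>x. local_stat j k (unif_stats n x)) \<in> borel_measurable (uniform_sample n)"
  by (rule measurable_local_stat) (rule measurable_unif_stats)

lemma exceeds_event: "{x \<in> space (uniform_sample n). exceeds n \<kappa> jk (unif_stats n x)} \<in> sets (uniform_sample n)"
proof -
  obtain j k where jk: "jk = (j, k)" by (cases jk)
  note [measurable] = measurable_unif_local_stat[of j k n]
  show ?thesis unfolding exceeds_def jk prod.case by measurable
qed

text \<open>
  With \<open>z = Gamma_fun d + \<kappa>\<close>, the bound \<open>2 * exp (- z\<^sup>2 / 2)\<close> factors, and \<open>2 * exp (- (Gamma_fun d)\<^sup>2 / 2) = 2 * d / e\<close>.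
\<close>

lemma prob_exceeds:
  assumes jk: "(j, k) \<in> index_pairs n" and \<kappa>: "\<kappa> \<ge> 0" and d: "d = real (k - j) / real (n + 1)"
  shows "measure (uniform_sample n) {x \<in> space (uniform_sample n). exceeds n \<kappa> (j, k) (unif_stats n x)}
    \<le> d * exp (- \<kappa> * Gamma_fun d) * exp (- \<kappa>\<^sup>2 / 2)"
proof -
  have d01: "0 < d" "d \<le> 1" using jk by (auto simp: d index_pairs_def)
  note G = Gamma_fun_ge[OF d01]
  define z where "z = Gamma_fun d + \<kappa>"
  have "measure (uniform_sample n) {x \<in> space (uniform_sample n). exceeds n \<kappa> (j, k) (unif_stats n x)}
      = measure (uniform_sample n) {x \<in> space (uniform_sample n). z * sqrt (real (k - j - 1) / 3) < \<bar>local_stat j k (unif_stats n x)\<bar>}"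
    unfolding exceeds_def prod.case d[symmetric] z_def by (simp only: mult.commute)
  also have "\<dots> \<le> 2 * exp (- z\<^sup>2 / 2)"
    by (rule local_stat_uniform_tail[OF jk]) (use G \<kappa> in \<open>simp add: z_def\<close>)
  also have "\<dots> = 2 * exp (- ln (exp 1 / d)) * exp (- \<kappa> * Gamma_fun d) * exp (- \<kappa>\<^sup>2 / 2)"
  proof -
    have "- z\<^sup>2 / 2 = - ln (exp 1 / d) + - \<kappa> * Gamma_fun d + - \<kappa>\<^sup>2 / 2"
      unfolding z_def power2_sum G(2) by simp
    then show ?thesis by (simp only: exp_add mult.assoc)
  qed
  also have "2 * exp (- ln (exp 1 / d)) \<le> d"
  proof -
    have "2 \<le> exp (1::real)" using exp_ge_add_one_self[of 1] by simp
    then have "2 / exp 1 \<le> (1::real)" by simp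
    then have "2 / exp 1 * d \<le> 1 * d" using d01 by (intro mult_right_mono) auto
    moreover have "exp (- ln (exp 1 / d)) = d / exp 1" using d01 by (simp add: exp_minus)
    ultimately show ?thesis by simp
  qed
  finally show ?thesis by (simp add: mult_right_mono)
qed

text \<open>
  There are at most \<open>N * cutoff n\<close> such pairs, where \<open>N = n + 1\<close>, each of them with \<open>d \<le> d0 = cutoff n / N\<close>.  As
  \<open>cutoff n = exp w\<close> for \<open>w = sqrt (ln N)\<close>, the sum is at most \<open>exp (2 * w - 4 * Gamma_fun d0)\<close> times
  \<open>exp (- \<kappa>\<^sup>2 / 2)\<close>, and \<open>Gamma_fun d0\<close> is at least \<open>w / 2\<close>.
\<close>

lemma small_pairs_bound:
  assumes n: "n \<ge> 3" and \<kappa>: "\<kappa> \<ge> 4"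
  defines "A \<equiv> {jk \<in> index_pairs n. real (snd jk - fst jk) < cutoff n}"
  shows "(\<Sum>jk\<in>A. measure (uniform_sample n) {x \<in> space (uniform_sample n). exceeds n \<kappa> jk (unif_stats n x)}) \<le> exp (- \<kappa>\<^sup>2 / 2)"
proof -
  define N where "N = real (n + 1)"
  define w where "w = sqrt (ln N)"
  have N4: "N \<ge> 4" using n by (simp add: N_def)
  have lnN: "ln N \<ge> 1"
  proof -
    have "exp 1 \<le> N" using exp_le N4 by linarith
    then have "ln (exp 1) \<le> ln N" using N4 by (subst ln_le_cancel_iff) auto
    then show ?thesis by simp
  qed
  have w: "w \<ge> 1" "w\<^sup>2 = ln N" using lnN by (auto simp: w_def)
  have cut: "cutoff n = exp w" by (simp add: cutoff_def w_def N_def add.commute)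
  have expN: "exp (w\<^sup>2) = N" using N4 by (simp add: w)
  define d0 where "d0 = cutoff n / N"
  have d0: "d0 = exp (w - w\<^sup>2)" by (simp add: d0_def cut exp_diff expN)
  have "w \<le> w\<^sup>2" using w(1) by (rule self_le_power) simp
  then have d01: "0 < d0" "d0 \<le> 1" by (auto simp: d0)
  have "finite A" unfolding A_def using finite_index_pairs by simp
  have cardA: "real (card A) \<le> N * cutoff n"
  proof -
    define g where "g = (\<lambda>(j::nat, k::nat). (j, k - j))"
    have "inj_on g A" by (auto simp: inj_on_def g_def A_def index_pairs_def)
    moreover have "g ` A \<subseteq> {..<n+1} \<times> {1..nat \<lfloor>cutoff n\<rfloor>}"
      by (auto simp: g_def A_def index_pairs_def le_nat_floor less_imp_le)
    ultimately have "card A \<le> card ({..<n+1} \<times> {1..nat \<lfloor>cutoff n\<rfloor>})"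
      by (metis card_image card_mono finite_SigmaI finite_atLeastAtMost finite_lessThan)
    also have "\<dots> = (n + 1) * nat \<lfloor>cutoff n\<rfloor>" by simp
    finally have "real (card A) \<le> real ((n + 1) * nat \<lfloor>cutoff n\<rfloor>)" by (simp only: of_nat_le_iff)
    also have "\<dots> = N * real (nat \<lfloor>cutoff n\<rfloor>)" by (simp only: of_nat_mult N_def)
    also have "\<dots> \<le> N * cutoff n" using N4 by (intro mult_left_mono of_nat_floor) (auto simp: cutoff_def)
    finally show ?thesis .
  qed
  have each: "measure (uniform_sample n) {x \<in> space (uniform_sample n). exceeds n \<kappa> jk (unif_stats n x)}
     \<le> d0 * exp (- 4 * Gamma_fun d0) * exp (- \<kappa>\<^sup>2 / 2)" if "jk \<in> A" for jk
  proof -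
    obtain j k where jk: "jk = (j, k)" by (cases jk)
    have ip: "(j, k) \<in> index_pairs n" "real (k - j) < cutoff n" using that by (auto simp: A_def jk)
    define d where "d = real (k - j) / real (n + 1)"
    have d: "0 < d" "d \<le> d0" using ip by (auto simp: d_def d0_def N_def index_pairs_def divide_right_mono)
    have "\<kappa> * Gamma_fun d \<ge> 4 * Gamma_fun d0"
      using \<kappa> Gamma_fun_antimono[OF d] Gamma_fun_ge(1)[OF d01] by (intro mult_mono) auto
    then have "d * exp (- \<kappa> * Gamma_fun d) \<le> d0 * exp (- 4 * Gamma_fun d0)"
      using d by (intro mult_mono) auto
    then have "d * exp (- \<kappa> * Gamma_fun d) * exp (- \<kappa>\<^sup>2 / 2) \<le> d0 * exp (- 4 * Gamma_fun d0) * exp (- \<kappa>\<^sup>2 / 2)"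
      by (rule mult_right_mono) simp
    moreover have "0 \<le> \<kappa>" using \<kappa> by simp
    ultimately show ?thesis using prob_exceeds[OF ip(1) \<open>0 \<le> \<kappa>\<close> d_def] unfolding jk by linarith
  qed
  have "(\<Sum>jk\<in>A. measure (uniform_sample n) {x \<in> space (uniform_sample n). exceeds n \<kappa> jk (unif_stats n x)})
     \<le> real (card A) * (d0 * exp (- 4 * Gamma_fun d0) * exp (- \<kappa>\<^sup>2 / 2))"
    using sum_bounded_above[of A, OF each] by simp
  also have "\<dots> \<le> (N * cutoff n) * (d0 * exp (- 4 * Gamma_fun d0) * exp (- \<kappa>\<^sup>2 / 2))"
    using cardA d01 by (intro mult_right_mono) auto
  also have "\<dots> = exp (2 * w - 4 * Gamma_fun d0) * exp (- \<kappa>\<^sup>2 / 2)"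
  proof -
    have "N * cutoff n * d0 * exp (- 4 * Gamma_fun d0) = exp (w\<^sup>2 + w + (w - w\<^sup>2) + - 4 * Gamma_fun d0)"
      unfolding d0 cut exp_add expN ..
    also have "w\<^sup>2 + w + (w - w\<^sup>2) + - 4 * Gamma_fun d0 = 2 * w - 4 * Gamma_fun d0" by simp
    finally show ?thesis by (simp add: mult.assoc)
  qed
  also have "exp (2 * w - 4 * Gamma_fun d0) \<le> 1"
  proof -
    have "w / 2 \<le> Gamma_fun d0" unfolding Gamma_fun_def
    proof (rule real_le_rsqrt)
      have "ln (exp 1 / d0) = 1 - (w - w\<^sup>2)" unfolding d0 by (simp add: exp_diff[symmetric])
      \<comment> \<open>Completing the square in \<open>7/4 * w\<^sup>2 - 2 * w + 2 \<ge> 0\<close>.\<close>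
      moreover have "0 \<le> (w - 8/7)\<^sup>2" by simp
      then have "0 \<le> w\<^sup>2 - 16/7 * w + 64/49" by (simp add: power2_eq_square algebra_simps)
      ultimately show "(w / 2)\<^sup>2 \<le> 2 * ln (exp 1 / d0)" using w(1) unfolding power_divide by simp
    qed
    then show ?thesis by simp
  qed
  finally show ?thesis by simp
qed

text \<open>
  At scale \<open>s\<close> there are at most \<open>2 ^ s * 4096 * (s + 4) ^ 4\<close> grid pairs, each contributing at most
  \<open>exp (- sqrt s) / 2 ^ s\<close> times \<open>exp (- \<kappa>\<^sup>2 / 2)\<close>.
\<close>

definition grid_weight :: "nat \<Rightarrow> real" where
  "grid_weight s = 4096 * (real s + 4) ^ 4 * exp (- sqrt (real s))"

lemma summable_grid_weight: "summable grid_weight"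
proof (rule summable_comparison_test_ev)
  show "summable (\<lambda>s. inverse (real s ^ 2))" by (rule inverse_power_summable) simp
  have "eventually (\<lambda>s. 4096 * (real s + 4) ^ 4 * exp (- sqrt (real s)) \<le> inverse (real s ^ 2)) sequentially"
    by real_asymp
  then show "eventually (\<lambda>s. norm (grid_weight s) \<le> inverse (real s ^ 2)) sequentially"
    by eventually_elim (simp add: grid_weight_def abs_mult)
qed

text \<open>
  A grid pair is determined by the multiples \<open>j div P\<close> and \<open>(k - j) div P\<close> of the mesh \<open>P\<close>, the first of which is of the
  order \<open>n / P\<close> at most, and the second of the order \<open>n / (P * 2 ^ s)\<close>.
\<close>

lemma card_grid_pairs:
  assumes n: "n \<ge> 1" and y: "real n / 2 ^ (s + 2 * grid_exp s) \<ge> 8"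
  shows "finite (grid_pairs n s)" "real (card (grid_pairs n s)) \<le> 2 ^ s * (4096 * (real s + 4) ^ 4)"
proof -
  define c where "c = grid_exp s"
  define q where "q = s + 2 * c"
  define P where "P = mesh n s"
  define N where "N = real (n + 1)"
  define y where "y = real n / 2 ^ q"
  show "finite (grid_pairs n s)" by (rule finite_subset[OF _ finite_index_pairs[of n]]) (auto simp: grid_pairs_def)
  have y8: "y \<ge> 8" using y by (simp add: y_def q_def c_def)
  have P: "real P \<ge> y / 4"
  proof -
    have "y / 2 - 1 \<le> of_int \<lfloor>y / 2\<rfloor>" by linarith
    also have "\<dots> = real P" using y8 by (simp add: P_def mesh_def y_def q_def c_def)
    finally show ?thesis using y8 by linarith
  qed
  then have P0: "real P > 0" "P > 0" using y8 by auto
  have N2: "N \<le> 2 * real n" using n by (simp add: N_def)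
  have NP: "N / real P \<le> 8 * 2 ^ q"
  proof -
    have "N / real P \<le> (2 * real n) / (y / 4)" using N2 P P0 y8 by (intro frac_le) auto
    also have "\<dots> = 8 * 2 ^ q" using n by (simp add: y_def field_simps)
    finally show ?thesis .
  qed
  define g where "g = (\<lambda>(j::nat, k::nat). (j div P, (k - j) div P))"
  have inj: "inj_on g (grid_pairs n s)"
  proof (rule inj_onI)
    fix x x' assume x: "x \<in> grid_pairs n s" "x' \<in> grid_pairs n s" "g x = g x'"
    obtain j k j' k' where xx: "x = (j, k)" "x' = (j', k')" by (cases x, cases x')
    have a: "(j, k) \<in> grid_pairs n s" "(j', k') \<in> grid_pairs n s"
      and e: "j div P = j' div P" "(k - j) div P = (k' - j') div P" using x by (simp_all add: xx g_def)
    have d: "P dvd j" "P dvd k" "P dvd j'" "P dvd k'" "j < k" "j' < k'" using a by (auto simp: grid_pairs_def index_pairs_def P_def)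
    have "j = j div P * P" "j' = j' div P * P" using d(1,3) by (simp_all only: dvd_div_mult_self)
    moreover have "j div P * P = j' div P * P" by (simp only: e(1))
    ultimately have "j = j'" by linarith
    moreover have "P dvd k - j" "P dvd k' - j'" using d(1-4) by (blast intro: dvd_diff_nat)+
    then have "k - j = (k - j) div P * P" "k' - j' = (k' - j') div P * P" by (simp_all only: dvd_div_mult_self)
    then have "k - j = k' - j'" using arg_cong[OF e(2), of "\<lambda>z. z * P"] by linarith
    ultimately show "x = x'" using d xx by simp
  qed
  have sub: "g ` grid_pairs n s \<subseteq> {..8 * 2 ^ q} \<times> {..8 * 2 ^ (2 * c)}"
  proof (rule image_subsetI)
    fix x assume x: "x \<in> grid_pairs n s"
    obtain j k where xx: "x = (j, k)" by (cases x)
    have a: "(j, k) \<in> grid_pairs n s" using x by (simp only: xx)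
    have jk: "real j \<le> N" "real (k - j) \<le> N / 2 ^ s" using a by (auto simp: grid_pairs_def index_pairs_def N_def)
    have "real (j div P) \<le> real j / real P" by (rule of_nat_div_le_of_nat)
    also have "\<dots> \<le> N / real P" using jk P0 by (intro divide_right_mono) auto
    also have "\<dots> \<le> 8 * 2 ^ q" by (rule NP)
    finally have 1: "real (j div P) \<le> real (8 * 2 ^ q)" by simp
    have "real ((k - j) div P) \<le> real (k - j) / real P" by (rule of_nat_div_le_of_nat)
    also have "\<dots> \<le> (N / 2 ^ s) / real P" using jk P0 by (intro divide_right_mono) auto
    also have "\<dots> = (N / real P) / 2 ^ s" by simp
    also have "\<dots> \<le> (8 * 2 ^ q) / 2 ^ s" by (intro divide_right_mono NP) auto
    also have "\<dots> = real (8 * 2 ^ (2 * c))" by (simp add: q_def power_add)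
    finally have 2: "real ((k - j) div P) \<le> real (8 * 2 ^ (2 * c))" .
    from 1 2 have "j div P \<le> 8 * 2 ^ q" "(k - j) div P \<le> 8 * 2 ^ (2 * c)" by (simp_all only: of_nat_le_iff)
    then show "g x \<in> {..8 * 2 ^ q} \<times> {..8 * 2 ^ (2 * c)}" by (simp add: xx g_def)
  qed
  have "card (grid_pairs n s) = card (g ` grid_pairs n s)" by (rule card_image[OF inj, symmetric])
  also have "\<dots> \<le> card ({..(8::nat) * 2 ^ q} \<times> {..(8::nat) * 2 ^ (2 * c)})" by (rule card_mono[OF _ sub]) simp
  also have "\<dots> = (8 * 2 ^ q + 1) * (8 * 2 ^ (2 * c) + 1)" by simp
  also have "\<dots> \<le> (16 * 2 ^ q) * (16 * 2 ^ (2 * c))"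
  proof -
    have "8 * 2 ^ i + 1 \<le> 16 * (2 ^ i :: nat)" for i using one_le_power[of "2::nat" i] by simp
    then show ?thesis by (intro mult_mono) auto
  qed
  finally have "real (card (grid_pairs n s)) \<le> real ((16 * 2 ^ q) * (16 * 2 ^ (2 * c)))" by (simp only: of_nat_le_iff)
  also have "\<dots> = 2 ^ s * (256 * real (2 ^ c) ^ 4)"
  proof -
    have "(2::real) ^ (2 * c) = (2 ^ c) ^ 2" by (simp add: power_mult mult.commute)
    then show ?thesis by (simp add: q_def power_add power2_eq_square power4_eq_xxxx)
  qed
  also have "\<dots> \<le> 2 ^ s * (256 * (2 * (real s + 4)) ^ 4)"
  proof -
    have "real (2 ^ c) \<le> real (2 * (s + 4))" using grid_exp_bounds(2)[of s, folded c_def] by (simp only: of_nat_le_iff)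
    then have "real (2 ^ c) \<le> 2 * (real s + 4)" by simp
    then show ?thesis by (intro mult_left_mono power_mono) auto
  qed
  also have "\<dots> = 2 ^ s * (4096 * (real s + 4) ^ 4)" by (simp only: power_mult_distrib) simp
  finally show "real (card (grid_pairs n s)) \<le> 2 ^ s * (4096 * (real s + 4) ^ 4)" .
qed

lemma grid_pairs_bound:
  assumes n: "n \<ge> 1" and y: "real n / 2 ^ (s + 2 * grid_exp s) \<ge> 8" and \<kappa>: "\<kappa> \<ge> 1"
  shows "(\<Sum>jk\<in>grid_pairs n s. measure (uniform_sample n) {x \<in> space (uniform_sample n). exceeds n \<kappa> jk (unif_stats n x)})
     \<le> grid_weight s * exp (- \<kappa>\<^sup>2 / 2)"
proof -
  define d0 where "d0 = 1 / (2::real) ^ s"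
  have d01: "0 < d0" "d0 \<le> 1" by (auto simp: d0_def)
  have G0: "sqrt (real s) \<le> Gamma_fun d0"
  proof -
    have "1/2 \<le> ln (2::real)"
    proof -
      have "- ln (1/2::real) \<ge> - (1/2 - 1)" using ln_le_minus_one[of "1/2"] by simp
      then show ?thesis by (simp add: ln_div)
    qed
    then have "real s * (1/2) \<le> real s * ln 2" by (intro mult_left_mono) auto
    moreover have "ln (exp 1 / d0) = 1 + real s * ln 2" by (simp add: d0_def ln_mult ln_realpow)
    ultimately show ?thesis unfolding Gamma_fun_def by (intro real_sqrt_le_mono) simp
  qed
  have each: "measure (uniform_sample n) {x \<in> space (uniform_sample n). exceeds n \<kappa> jk (unif_stats n x)}
     \<le> d0 * exp (- sqrt (real s)) * exp (- \<kappa>\<^sup>2 / 2)" if "jk \<in> grid_pairs n s" for jk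
  proof -
    obtain j k where jk: "jk = (j, k)" by (cases jk)
    have ip: "(j, k) \<in> index_pairs n" "real (k - j) \<le> real (n + 1) / 2 ^ s" using that by (auto simp: grid_pairs_def jk)
    define d where "d = real (k - j) / real (n + 1)"
    have "d \<le> real (n + 1) / 2 ^ s / real (n + 1)" unfolding d_def using ip by (intro divide_right_mono) auto
    then have d: "0 < d" "d \<le> d0" using ip by (auto simp: d_def d0_def index_pairs_def)
    have "sqrt (real s) \<le> Gamma_fun d" using G0 Gamma_fun_antimono[OF d] by linarith
    then have "1 * sqrt (real s) \<le> \<kappa> * Gamma_fun d" using \<kappa> by (intro mult_mono) auto
    then have "d * exp (- \<kappa> * Gamma_fun d) \<le> d0 * exp (- sqrt (real s))"
      using d by (intro mult_mono) auto
    then have "d * exp (- \<kappa> * Gamma_fun d) * exp (- \<kappa>\<^sup>2 / 2) \<le> d0 * exp (- sqrt (real s)) * exp (- \<kappa>\<^sup>2 / 2)"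
      by (rule mult_right_mono) simp
    moreover have "0 \<le> \<kappa>" using \<kappa> by simp
    ultimately show ?thesis using prob_exceeds[OF ip(1) \<open>0 \<le> \<kappa>\<close> d_def] unfolding jk by linarith
  qed
  have "(\<Sum>jk\<in>grid_pairs n s. measure (uniform_sample n) {x \<in> space (uniform_sample n). exceeds n \<kappa> jk (unif_stats n x)})
     \<le> real (card (grid_pairs n s)) * (d0 * exp (- sqrt (real s)) * exp (- \<kappa>\<^sup>2 / 2))"
    using sum_bounded_above[of "grid_pairs n s", OF each] by simp
  also have "\<dots> \<le> 2 ^ s * (4096 * (real s + 4) ^ 4) * (d0 * exp (- sqrt (real s)) * exp (- \<kappa>\<^sup>2 / 2))"
    using card_grid_pairs(2)[OF n y] d01 by (intro mult_right_mono) auto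
  also have "\<dots> = grid_weight s * exp (- \<kappa>\<^sup>2 / 2)" by (simp add: grid_weight_def d0_def)
  finally show ?thesis .
qed

lemma multiscale_stat_le:
  assumes n: "n \<ge> 1" and "\<And>jk. jk \<in> index_pairs n \<Longrightarrow> \<not> exceeds n K jk V"
  shows "multiscale_stat n V \<le> K"
  unfolding multiscale_stat_def
proof (rule Max.boundedI)
  have "(0, 2) \<in> index_pairs n" using n by (auto simp: index_pairs_def)
  then show "(\<lambda>(j, k). sqrt (3 / real (k - j - 1)) * \<bar>local_stat j k V\<bar> - Gamma_fun (real (k - j) / real (n + 1))) ` index_pairs n \<noteq> {}" by blast
  fix a assume "a \<in> (\<lambda>(j, k). sqrt (3 / real (k - j - 1)) * \<bar>local_stat j k V\<bar> - Gamma_fun (real (k - j) / real (n + 1))) ` index_pairs n"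
  then obtain j k where jk: "(j, k) \<in> index_pairs n" and a: "a = sqrt (3 / real (k - j - 1)) * \<bar>local_stat j k V\<bar> - Gamma_fun (real (k - j) / real (n + 1))" by auto
  define m where "m = real (k - j - 1)"
  have m: "m > 0" using jk by (auto simp: m_def index_pairs_def)
  have "\<bar>local_stat j k V\<bar> \<le> sqrt (m / 3) * (Gamma_fun (real (k - j) / real (n + 1)) + K)"
    using assms(2)[OF jk] by (simp add: exceeds_def m_def)
  then have "sqrt (3 / m) * \<bar>local_stat j k V\<bar> \<le> sqrt (3 / m) * (sqrt (m / 3) * (Gamma_fun (real (k - j) / real (n + 1)) + K))"
    using m by (intro mult_left_mono) auto
  also have "\<dots> = sqrt (3 / m * (m / 3)) * (Gamma_fun (real (k - j) / real (n + 1)) + K)"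
    by (simp only: real_sqrt_mult mult.assoc)
  also have "3 / m * (m / 3) = 1" using m by simp
  finally show "a \<le> K" unfolding a m_def[symmetric] by simp
qed (simp add: finite_index_pairs)

lemma kappa_le:
  assumes n: "n \<ge> 1" and \<alpha>: "\<alpha> < 1"
    and K: "1 - \<alpha> \<le> measure (uniform_sample n) {x \<in> space (uniform_sample n). multiscale_stat n (unif_stats n x) \<le> K}"
  shows "kappa n \<alpha> \<le> K"
  unfolding kappa_def quantile_def
proof (rule cInf_lower)
  define G where "G = Gamma_fun (real 2 / real (n + 1))"
  have low: "- G \<le> multiscale_stat n V" for V
  proof -
    have i: "(0, 2) \<in> index_pairs n" using n by (auto simp: index_pairs_def)
    have "sqrt 3 * \<bar>local_stat 0 2 V\<bar> - G \<le> multiscale_stat n V"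
      unfolding multiscale_stat_def
      by (intro Max_ge finite_imageI finite_index_pairs image_eqI[OF _ i]) (simp add: G_def)
    moreover have "0 \<le> sqrt 3 * \<bar>local_stat 0 2 V\<bar>" by simp
    ultimately show ?thesis by linarith
  qed
  show "bdd_below {q. 1 - \<alpha> \<le> measure (uniform_sample n) {\<omega> \<in> space (uniform_sample n). multiscale_stat n (unif_stats n \<omega>) \<le> q}}"
  proof (rule bdd_belowI[of _ "- G"], rule ccontr)
    fix q assume q: "q \<in> {q. 1 - \<alpha> \<le> measure (uniform_sample n) {\<omega> \<in> space (uniform_sample n). multiscale_stat n (unif_stats n \<omega>) \<le> q}}"
      and "\<not> - G \<le> q"
    then have "q < multiscale_stat n V" for V using low[of V] by linarith
    then have "\<not> multiscale_stat n V \<le> q" for V by (simp only: not_le)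
    with q have "1 - \<alpha> \<le> measure (uniform_sample n) {}" by simp
    with \<alpha> show False by simp
  qed
qed (use K in simp)

lemma eventually_large_enough:
  assumes lam: "lam \<ge> 1"
  shows "eventually (\<lambda>n. \<exists>R. large_enough lam n R) sequentially"
proof -
  have lam0: "lam > 0" using lam by simp
  have "eventually (\<lambda>n::nat. lam * (log 2 (real n) + 5) \<le> 2 * sqrt (ln (real n) ^ 3)) sequentially"
    using lam0 by real_asymp
  moreover have "eventually (\<lambda>n::nat. 12 * ln (real n) ^ 3 + 1 \<le> sqrt (exp (sqrt (ln (real n + 1))))) sequentially"
    by real_asymp
  moreover have "eventually (\<lambda>n::nat. 48 * ln (real n) ^ 3 + 8 \<le> exp (sqrt (ln (real n + 1))) / (8 * (log 2 (real n) + 5)\<^sup>2)) sequentially"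
    by real_asymp
  moreover have "eventually (\<lambda>n::nat. (336 * lam * (log 2 (real n) + 5))\<^sup>2 < exp (sqrt (ln (real n + 1))) / (8 * (log 2 (real n) + 5)\<^sup>2)) sequentially"
    using lam0 by real_asymp
  moreover have "eventually (\<lambda>n::nat. 126 * lam * (log 2 (real n) + 5) + 2 \<le> sqrt (exp (sqrt (ln (real n + 1))))) sequentially"
    using lam0 by real_asymp
  moreover have "eventually (\<lambda>n::nat. ln (real n) ^ 3 \<le> real n) sequentially" by real_asymp
  moreover have "eventually (\<lambda>n::nat. 1 \<le> ln (real n) ^ 3) sequentially" by real_asymp
  ultimately show ?thesis using eventually_ge_at_top[of 3]
  proof eventually_elim
    case (elim n)
    define g where "g = ln (real n) ^ 3"
    define r where "r = real n / g"
    have g: "1 \<le> g" "g \<le> real n" using elim by (auto simp: g_def)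
    have r1: "1 \<le> r" using g by (simp add: r_def)
    then have "1 \<le> nat \<lfloor>r\<rfloor>" by (simp add: le_nat_iff le_floor_iff)
    then obtain R where R: "2 ^ R \<le> nat \<lfloor>r\<rfloor>" "nat \<lfloor>r\<rfloor> < 2 ^ (R + 1)" using ex_power_ivl1[of 2 "nat \<lfloor>r\<rfloor>"] by auto
    have "real (2 ^ R) \<le> real (nat \<lfloor>r\<rfloor>)" using R(1) by (simp only: of_nat_le_iff)
    also have "\<dots> \<le> r" using r1 by (intro of_nat_floor) simp
    finally have Rr: "2 ^ R \<le> r" by simp
    have "real (nat \<lfloor>r\<rfloor> + 1) \<le> real (2 ^ (R + 1))" using R(2) unfolding of_nat_le_iff by simp
    moreover have "r < real (nat \<lfloor>r\<rfloor> + 1)" using r1 by linarith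
    ultimately have rR: "r < 2 * 2 ^ R" by simp
    define \<rho> where "\<rho> = real n / 2 ^ R"
    have \<rho>: "g \<le> \<rho>" "\<rho> \<le> 2 * g"
    proof -
      have "2 ^ R * g \<le> real n" using Rr g by (simp add: r_def field_simps)
      then show "g \<le> \<rho>" by (simp add: \<rho>_def field_simps)
      have "real n < 2 * 2 ^ R * g" using rR g by (simp add: r_def field_simps)
      then show "\<rho> \<le> 2 * g" by (simp add: \<rho>_def field_simps)
    qed
    have "r \<le> real n" using g by (simp add: r_def divide_le_eq mult_left_le)
    with Rr have "2 ^ R \<le> real n" by (rule order_trans)
    then have "2 powr real R \<le> real n" by (simp only: powr_realpow zero_less_numeral)
    then have "real R \<le> log 2 (real n)" using elim by (subst le_log_iff) auto
    then have 1: "real R + 4 \<le> log_scale n" by (simp add: log_scale_def)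
    have 2: "sqrt g \<le> sqrt \<rho>" using \<rho> by simp
    note e = elim[folded g_def log_scale_def cutoff_def]
    have "large_enough lam n R"
      unfolding large_enough_def Let_def \<rho>_def[symmetric]
    proof (intro conjI)
      show "3 \<le> n" "real R + 4 \<le> log_scale n" by (fact, fact 1)
      show "1 \<le> \<rho>" using \<rho>(1) g(1) by linarith
      show "lam * log_scale n \<le> 2 * sqrt \<rho>" using e(1) 2 by linarith
      show "6 * \<rho> + 1 \<le> sqrt (cutoff n)" using e(2) \<rho>(2) by linarith
      show "24 * \<rho> + 8 \<le> cutoff n / (8 * (log_scale n)\<^sup>2)" using e(3) \<rho>(2) by linarith
      show "(336 * lam * log_scale n)\<^sup>2 < cutoff n / (8 * (log_scale n)\<^sup>2)" by (rule e(4))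
      show "126 * lam * log_scale n + 2 \<le> sqrt (cutoff n)" by (rule e(5))
    qed
    then show ?case ..
  qed
qed

text \<open>
  The parameters \<open>lam\<close> and \<open>\<kappa>\<close> are chosen such that the dyadic cells are irregular with probability at most \<open>\<alpha> / 2\<close>, and that
  some close pair or some grid pair exceeds \<open>\<kappa>\<close> with probability at most \<open>\<alpha> / 2\<close>.  Off these events no pair
  exceeds the constant of \<open>not_exceeds_from_grid\<close>.
\<close>

theorem kappa_bounded:
  assumes \<alpha>: "0 < \<alpha>" "\<alpha> < 1"
  shows "\<exists>K\<ge>0. eventually (\<lambda>n. kappa n \<alpha> \<le> K) sequentially"
proof -
  have "eventually (\<lambda>lam::real. 4 * exp (- lam\<^sup>2) < \<alpha> / 2) at_top" using \<alpha>
    by real_asymp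
  moreover have "eventually (\<lambda>lam::real. 2 * exp (- lam\<^sup>2) < 1/2) at_top" by real_asymp
  ultimately have "eventually (\<lambda>lam::real. 4 * exp (- lam\<^sup>2) < \<alpha> / 2 \<and> 2 * exp (- lam\<^sup>2) < 1/2 \<and> 1 \<le> lam) at_top"
    using eventually_ge_at_top[of "1::real"] by eventually_elim auto
  from eventually_happens[OF this] obtain lam :: real
    where lam': "4 * exp (- lam\<^sup>2) < \<alpha> / 2" "2 * exp (- lam\<^sup>2) < 1/2" and "1 \<le> lam" by auto
  note lam = less_imp_le[OF lam'(1)] less_imp_le[OF lam'(2)] \<open>1 \<le> lam\<close>
  define W where "W = suminf grid_weight"
  have gw: "grid_weight s \<ge> 0" for s by (simp add: grid_weight_def)
  have W0: "W \<ge> 0" unfolding W_def by (rule suminf_nonneg[OF summable_grid_weight gw])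
  have "eventually (\<lambda>\<kappa>::real. (1 + W) * exp (- \<kappa>\<^sup>2 / 2) < \<alpha> / 2) at_top"
    using \<alpha> W0 by real_asymp
  then have "eventually (\<lambda>\<kappa>::real. (1 + W) * exp (- \<kappa>\<^sup>2 / 2) < \<alpha> / 2 \<and> 4 \<le> \<kappa>) at_top"
    using eventually_ge_at_top[of "4::real"] by eventually_elim auto
  from eventually_happens[OF this] obtain \<kappa> :: real
    where \<kappa>': "(1 + W) * exp (- \<kappa>\<^sup>2 / 2) < \<alpha> / 2" and "4 \<le> \<kappa>" by auto
  note \<kappa> = less_imp_le[OF \<kappa>'] \<open>4 \<le> \<kappa>\<close>
  define K where "K = \<kappa> + 1 + 40 * (63 * lam + 1)"
  have "eventually (\<lambda>n. kappa n \<alpha> \<le> K) sequentially"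
    using eventually_large_enough[OF lam(3)]
  proof eventually_elim
    case (elim n)
    then obtain R where le: "large_enough lam n R" ..
    have n3: "n \<ge> 3" using le by (simp add: large_enough_def)
    then have n1: "n \<ge> 1" by simp
    interpret prob_space "uniform_sample n" by (rule prob_space_uniform_sample)
    define P where "P = uniform_sample n"
    define Ex where "Ex jk = {x \<in> space P. exceeds n \<kappa> jk (unif_stats n x)}" for jk
    define A where "A = {jk \<in> index_pairs n. real (snd jk - fst jk) < cutoff n}"
    define Sc where "Sc = {s. real n / 2 ^ (s + 2 * grid_exp s) \<ge> 8}"
    define Ir where "Ir = {x \<in> space P. \<not> cells_regular n lam R x}"
    have finA: "finite A" unfolding A_def using finite_index_pairs by simp
    have finSc: "finite Sc"
    proof (rule finite_subset[of _ "{..n}"])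
      show "Sc \<subseteq> {..n}"
      proof
        fix s assume "s \<in> Sc"
        then have "8 \<le> real n / 2 ^ (s + 2 * grid_exp s)" by (simp add: Sc_def)
        also have "\<dots> \<le> real n / 2 ^ s" by (intro divide_left_mono) (auto intro: power_increasing)
        finally have "8 * 2 ^ s \<le> real n" by (simp add: field_simps)
        moreover have "(0::real) \<le> 2 ^ s" by simp
        moreover have "real s < 2 ^ s" by (rule of_nat_less_two_power)
        ultimately have "real s \<le> real n" by linarith
        then show "s \<in> {..n}" by simp
      qed
    qed simp
    have Ex: "Ex jk \<in> events" for jk unfolding Ex_def P_def by (rule exceeds_event)
    have reg: "lam * (real r + 4) \<le> 2 * sqrt (real n / 2 ^ r)" if "r \<le> R" for r
    proof -
      have "lam * (real r + 4) \<le> lam * log_scale n"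
        using le that lam(3) unfolding large_enough_def by (intro mult_left_mono) auto
      also have "\<dots> \<le> 2 * sqrt (real n / 2 ^ R)" using le by (simp add: large_enough_def Let_def)
      also have "\<dots> \<le> 2 * sqrt (real n / 2 ^ r)"
        using that by (intro mult_left_mono real_sqrt_le_mono divide_left_mono power_increasing) auto
      finally show ?thesis .
    qed
    have lam0: "0 \<le> lam" using lam(3) by linarith
    note irr = prob_cells_irregular[OF n1 lam0 lam(2), of R, OF reg]
    have Ir: "Ir \<in> events" "prob Ir \<le> \<alpha> / 2"
      unfolding Ir_def P_def by (rule irr(1), assumption) (rule order_trans[OF irr(2) lam(1)])
    have gfin: "finite (grid_pairs n s)" if "s \<in> Sc" for s
      using card_grid_pairs(1)[OF n1] that by (simp add: Sc_def)
    define BA where "BA = (\<Union>jk\<in>A. Ex jk)"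
    define BG where "BG s = (\<Union>jk\<in>grid_pairs n s. Ex jk)" for s
    have BA: "BA \<in> events" "prob BA \<le> exp (- \<kappa>\<^sup>2 / 2)"
    proof -
      show "BA \<in> events" unfolding BA_def by (intro sets.finite_UN finA Ex)
      have "prob BA \<le> (\<Sum>jk\<in>A. prob (Ex jk))"
        unfolding BA_def by (rule finite_measure_subadditive_finite[OF finA]) (blast intro: Ex)
      also have "\<dots> \<le> exp (- \<kappa>\<^sup>2 / 2)"
        unfolding A_def Ex_def P_def by (rule small_pairs_bound[OF n3 \<kappa>(2)])
      finally show "prob BA \<le> exp (- \<kappa>\<^sup>2 / 2)" .
    qed
    have BG: "BG s \<in> events" "prob (BG s) \<le> grid_weight s * exp (- \<kappa>\<^sup>2 / 2)" if s: "s \<in> Sc" for s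
    proof -
      show "BG s \<in> events" unfolding BG_def by (intro sets.finite_UN gfin[OF s] Ex)
      have "prob (BG s) \<le> (\<Sum>jk\<in>grid_pairs n s. prob (Ex jk))"
        unfolding BG_def by (rule finite_measure_subadditive_finite[OF gfin[OF s]]) (blast intro: Ex)
      also have "\<dots> \<le> grid_weight s * exp (- \<kappa>\<^sup>2 / 2)"
        unfolding Ex_def P_def by (rule grid_pairs_bound[OF n1]) (use s \<kappa>(2) in \<open>auto simp: Sc_def\<close>)
      finally show "prob (BG s) \<le> grid_weight s * exp (- \<kappa>\<^sup>2 / 2)" .
    qed
    define BGs where "BGs = (\<Union>s\<in>Sc. BG s)"
    have BGs: "BGs \<in> events" "prob BGs \<le> W * exp (- \<kappa>\<^sup>2 / 2)"
    proof -
      show "BGs \<in> events" unfolding BGs_def by (intro sets.finite_UN finSc BG)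
      have "prob BGs \<le> (\<Sum>s\<in>Sc. prob (BG s))"
        unfolding BGs_def by (rule finite_measure_subadditive_finite[OF finSc]) (blast intro: BG)
      also have "\<dots> \<le> (\<Sum>s\<in>Sc. grid_weight s * exp (- \<kappa>\<^sup>2 / 2))" by (intro sum_mono BG)
      also have "\<dots> = (\<Sum>s\<in>Sc. grid_weight s) * exp (- \<kappa>\<^sup>2 / 2)" by (simp only: sum_distrib_right)
      also have "\<dots> \<le> W * exp (- \<kappa>\<^sup>2 / 2)"
        unfolding W_def by (intro mult_right_mono sum_le_suminf summable_grid_weight finSc gw) auto
      finally show "prob BGs \<le> W * exp (- \<kappa>\<^sup>2 / 2)" .
    qed
    define Good where "Good = {x \<in> space P. multiscale_stat n (unif_stats n x) \<le> K}"
    have Good: "Good \<in> events"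
    proof -
      have [measurable]: "(\<lambda>x. multiscale_stat n (unif_stats n x)) \<in> borel_measurable P"
        unfolding P_def by (rule measurable_multiscale_stat) (rule measurable_unif_stats)
      have "Good \<in> sets P" unfolding Good_def by measurable
      then show ?thesis by (simp add: P_def)
    qed
    have UB: "Ir \<union> BA \<union> BGs \<in> events" using Ir BA BGs by auto
    have "1 - prob Good = prob (space (uniform_sample n) - Good)" using prob_compl[OF Good] by simp
    also have "\<dots> \<le> prob (Ir \<union> BA \<union> BGs)"
    proof (rule finite_measure_mono_AE[OF _ UB])
      show "AE x in uniform_sample n. x \<in> space (uniform_sample n) - Good \<longrightarrow> x \<in> Ir \<union> BA \<union> BGs"
        using AE_generic[of n]
      proof eventually_elim
        case (elim x)
        show ?case
        proof (intro impI, rule ccontr)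
          assume x: "x \<in> space (uniform_sample n) - Good" and nb: "x \<notin> Ir \<union> BA \<union> BGs"
          have xs: "x \<in> space P" using x by (simp add: P_def)
          have cr: "cells_regular n lam R x" using nb xs by (simp add: Ir_def)
          have small: "\<not> exceeds n \<kappa> jk ((!) (unif_list n x))" if "jk \<in> index_pairs n" "real (snd jk - fst jk) < cutoff n" for jk
          proof -
            have "jk \<in> A" using that by (simp add: A_def)
            then have "x \<notin> Ex jk" using nb unfolding BA_def by blast
            then show ?thesis using xs by (simp add: Ex_def ext_order_stats_nth)
          qed
          have grid: "\<not> exceeds n \<kappa> jk ((!) (unif_list n x))" if "jk \<in> grid_pairs n s" "real n / 2 ^ (s + 2 * grid_exp s) \<ge> 8" for s jk
          proof -
            have "s \<in> Sc" using that by (simp add: Sc_def)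
            then have "x \<notin> Ex jk" using nb that(1) unfolding BGs_def BG_def by blast
            then show ?thesis using xs by (simp add: Ex_def ext_order_stats_nth)
          qed
          have "\<not> exceeds n K jk ((!) (unif_list n x))" if "jk \<in> index_pairs n" for jk
          proof -
            obtain j k where jk: "jk = (j, k)" by (cases jk)
            show ?thesis unfolding jk K_def
              by (rule not_exceeds_from_grid[OF elim cr lam(3) _ le small grid]) (use \<kappa> that jk in auto)
          qed
          then have "multiscale_stat n ((!) (unif_list n x)) \<le> K" by (rule multiscale_stat_le[OF n1])
          then have "x \<in> Good" using xs by (simp add: Good_def ext_order_stats_nth)
          with x show False by simp
        qed
      qed
    qed
    also have "\<dots> \<le> prob Ir + prob BA + prob BGs"
      using measure_Un_le[of "Ir \<union> BA" "uniform_sample n" BGs] measure_Un_le[of Ir "uniform_sample n" BA] Ir BA BGs by auto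
    also have "\<dots> \<le> \<alpha> / 2 + (1 + W) * exp (- \<kappa>\<^sup>2 / 2)" using Ir BA BGs by (simp add: distrib_right)
    also have "\<dots> \<le> \<alpha>" using \<kappa> by simp
    finally have "1 - \<alpha> \<le> prob Good" by simp
    then show ?case unfolding Good_def P_def by (rule kappa_le[OF n1 \<alpha>(2)])
  qed
  moreover have "K \<ge> 0" using \<kappa> lam by (simp add: K_def)
  ultimately show ?thesis by blast
qed

section \<open>The observations in an interval with a lower slope bound\<close>

text \<open>
  Each of the three alternatives has probability at most \<open>exp (- L)\<close>.  The length \<open>l0\<close> is such that the slope bound gives
  \<open>(a, a']\<close> at least the mass \<open>L / m\<close>, and \<open>t\<close> is the optimal Chernoff parameter for the variance \<open>1/3\<close>.
\<close>

lemma (in prob_space) single_interval_tail: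
  fixes Y :: "nat \<Rightarrow> 'a \<Rightarrow> real" and f :: "real \<Rightarrow> real"
  assumes I: "indep_vars (\<lambda>_. borel) Y {..<m}"
    and D: "\<And>i. i < m \<Longrightarrow> distributed M lborel (Y i) (\<lambda>x. ennreal (f x))"
    and f: "\<And>x. f x \<ge> 0"
    and sl: "slope_ge f {a<..<c} s" and ac: "a < c" and s: "s > 0" and m: "m > 0"
    and F: "F = mass f {a<..<c}" and L: "L > 0"
    and l0: "l0 = sqrt (2 * L / (m * (s * (c - a)\<^sup>2)))" "l0 < 1"
    and t: "t = sqrt (6 * L / (m * F))" "t \<le> 1/2"
    and a': "a' = a + l0 * (c - a)"
  defines "S \<equiv> \<lambda>\<omega>. \<Sum>i<m. if Y i \<omega> \<in> {a'<..<c} then rel_pos a' c (Y i \<omega>) else 0"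
  shows "{\<omega> \<in> space M. obs_count Y {..<m} {a<..a'} \<omega> = 0
       \<or> m * F + 2 * sqrt (m * F * L) \<le> obs_count Y {..<m} {a'<..<c} \<omega>
       \<or> S \<omega> \<le> m * s * (c - a')\<^sup>2 / 6 - sqrt (2 * L * m * F / 3) * (1 + t / 2)} \<in> events" (is "?ev \<in> _")
    "prob {\<omega> \<in> space M. obs_count Y {..<m} {a<..a'} \<omega> = 0
       \<or> m * F + 2 * sqrt (m * F * L) \<le> obs_count Y {..<m} {a'<..<c} \<omega>
       \<or> S \<omega> \<le> m * s * (c - a')\<^sup>2 / 6 - sqrt (2 * L * m * F / 3) * (1 + t / 2)} \<le> 3 * exp (- L)"
proof -
  have D': "\<And>i. i \<in> {..<m} \<Longrightarrow> distributed M lborel (Y i) (\<lambda>x. ennreal (f x))" using D by auto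
  note df = density_facts[OF D[OF m] f]
  have Ym [measurable]: "Y i \<in> borel_measurable M" if "i \<in> {..<m}" for i
    using I that by (auto simp: indep_vars_def)
  have aa': "a < a'" "a' < c"
  proof -
    have "l0 > 0" unfolding l0 using L m s ac by simp
    then show "a < a'" unfolding a' using ac by simp
    have "l0 * (c - a) < 1 * (c - a)" using l0(2) ac by (intro mult_strict_right_mono) auto
    then show "a' < c" unfolding a' by simp
  qed
  have Fpos: "F > 0"
    using slope_mass_lower[OF f df(2) sl] s ac F by (smt (verit) half_gt_zero mult_pos_pos zero_less_power)
  define E1 where "E1 = {\<omega> \<in> space M. obs_count Y {..<m} {a<..a'} \<omega> = 0}"
  define E2 where "E2 = {\<omega> \<in> space M. m * F + 2 * sqrt (m * F * L) \<le> obs_count Y {..<m} {a'<..<c} \<omega>}"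
  define x where "x = sqrt (2 * L * m * F / 3) * (1 + t / 2)"
  define E3 where "E3 = {\<omega> \<in> space M. S \<omega> \<le> m * s * (c - a')\<^sup>2 / 6 - x}"
  have Nm: "(\<lambda>\<omega>. real (obs_count Y {..<m} J \<omega>)) \<in> borel_measurable M" if [measurable]: "J \<in> sets borel" for J
    by (subst obs_count_real) auto
  have [measurable]: "S \<in> borel_measurable M" unfolding S_def by measurable
  have ev: "E1 \<in> events" "E2 \<in> events" "E3 \<in> events"
  proof -
    note Nm[measurable]
    have "{\<omega> \<in> space M. real (obs_count Y {..<m} {a<..a'} \<omega>) = 0} \<in> events" by measurable
    then show "E1 \<in> events" by (simp add: E1_def)
    show "E2 \<in> events" "E3 \<in> events" unfolding E2_def E3_def by measurable
  qed
  have eq: "?ev = E1 \<union> E2 \<union> E3" by (auto simp: E1_def E2_def E3_def x_def)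
  show "?ev \<in> events" unfolding eq using ev by auto
  have p1: "prob E1 \<le> exp (- L)"
  proof -
    have "prob E1 \<le> exp (- real (card {..<m}) * mass f {a<..a'})"
      unfolding E1_def by (rule obs_count_zero[OF _ I D' f]) auto
    also have "\<dots> \<le> exp (- L)"
    proof -
      have "L = m * (s * (a' - a)\<^sup>2 / 2)"
        using L m s ac by (simp add: a' power_mult_distrib l0(1))
      also have "\<dots> \<le> m * mass f {a<..<a'}"
        using aa' by (intro mult_left_mono slope_mass_lower f df slope_ge_subset[OF sl]) auto
      also have "\<dots> \<le> m * mass f {a<..a'}"
        by (intro mult_left_mono mass_mono f df) auto
      finally show ?thesis by simp
    qed
    finally show ?thesis .
  qed
  have mJ: "mass f {a'<..<c} \<le> F"
    unfolding F by (intro mass_mono f df) (use aa' in auto)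
  have mF: "real m * F > 0" using m Fpos by simp
  have p2: "prob E2 \<le> exp (- L)"
  proof -
    define r where "r = sqrt (L / (m * F))"
    have "6 * (L / (m * F)) \<le> (1/2)\<^sup>2"
      using t by (metis power_mono real_sqrt_ge_0_iff real_sqrt_pow2 L mF divide_nonneg_pos less_imp_le mult_nonneg_nonneg zero_le_numeral times_divide_eq_right)
    then have "L / (m * F) \<le> 1" by (simp add: power2_eq_square)
    then have r: "0 \<le> r" "r \<le> 1" using L mF by (auto simp: r_def)
    have "prob E2 \<le> exp (real (card {..<m}) * F * r\<^sup>2 - r * (2 * sqrt (m * F * L)))"
      using obs_count_deviation(1)[OF _ I D' f _ mJ _ r] Fpos by (simp add: E2_def)
    also have "real (card {..<m}) * F * r\<^sup>2 - r * (2 * sqrt (m * F * L)) = - L"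
    proof -
      have "r * sqrt (m * F * L) = sqrt (L\<^sup>2)"
        unfolding r_def real_sqrt_mult[symmetric] using mF by (intro arg_cong[of _ _ sqrt]) (auto simp: power2_eq_square)
      moreover have "real m * F * r\<^sup>2 = L" using mF L m Fpos by (simp add: r_def)
      ultimately show ?thesis using L by simp
    qed
    finally show ?thesis .
  qed
  have t0: "0 \<le> t" using t L mF by simp
  have p3: "prob E3 \<le> exp (- L)"
  proof -
    define \<mu> where "\<mu> = s * (c - a')\<^sup>2 / 6"
    define B where "B = F * (t\<^sup>2 * (1 + t) / 6) - t * \<mu>"
    have "prob E3 = prob {\<omega> \<in> space M. t * x - t * (m * \<mu>) \<le>
        (\<Sum>i\<in>{..<m}. if Y i \<omega> \<in> {a'<..<c} then - t * rel_pos a' c (Y i \<omega>) else 0)}"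
    proof -
      have "(\<Sum>i\<in>{..<m}. if Y i \<omega> \<in> {a'<..<c} then - t * rel_pos a' c (Y i \<omega>) else 0) = - t * S \<omega>" for \<omega>
        unfolding S_def sum_distrib_left by (intro sum.cong) auto
      moreover have "S \<omega> \<le> m * s * (c - a')\<^sup>2 / 6 - x \<longleftrightarrow> t * x - t * (m * \<mu>) \<le> - t * S \<omega>" for \<omega>
      proof -
        have "t > 0" using t L mF by simp
        then have "S \<omega> \<le> m * \<mu> - x \<longleftrightarrow> t * S \<omega> \<le> t * (m * \<mu> - x)" by simp
        then show ?thesis by (simp add: \<mu>_def algebra_simps)
      qed
      ultimately show ?thesis unfolding E3_def by (intro arg_cong[of _ _ prob]) (simp only:)
    qed
    also have "\<dots> \<le> exp (real (card {..<m}) * B - (t * x - t * (m * \<mu>)))"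
    proof (rule exp_markov_density[OF _ I D' f])
      show "\<bar>- t * rel_pos a' c x\<bar> \<le> t" if "x \<in> {a'<..<c}" for x
        using rel_pos_bound[of a' c x] that t0 by (simp add: abs_mult mult_left_le)
      have "(LBINT x:{a'<..<c}. f x * (exp (- t * rel_pos a' c x) - 1))
          \<le> mass f {a'<..<c} * (t\<^sup>2 * (1 + t) / 6) - t * s * (c - a')\<^sup>2 / 6"
        by (rule slope_exp_moment[OF f df(2) slope_ge_subset[OF sl] aa'(2) t0 t(2)]) (use aa' in auto)
      also have "\<dots> \<le> B"
        using mult_right_mono[OF mJ, of "t\<^sup>2 * (1 + t) / 6"] t0 by (simp add: B_def \<mu>_def)
      finally show "(LBINT x:{a'<..<c}. f x * (exp (- t * rel_pos a' c x) - 1)) \<le> B" .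
    qed auto
    also have "real (card {..<m}) * B - (t * x - t * (m * \<mu>)) = - L"
    proof -
      have "t * sqrt (2 * L * m * F / 3) = sqrt ((2 * L)\<^sup>2)"
        unfolding t real_sqrt_mult[symmetric] using mF
        by (intro arg_cong[of _ _ sqrt]) (auto simp: power2_eq_square field_simps)
      also have "\<dots> = 2 * L" using L by (subst real_sqrt_abs) simp
      finally have "t * x = 2 * L * (1 + t / 2)" by (simp add: x_def flip: mult.assoc)
      moreover have "m * F * t\<^sup>2 = 6 * L" using mF L m Fpos by (simp add: t)
      then have "m * (F * (t\<^sup>2 * (1 + t) / 6)) = L * (1 + t)" by (simp add: field_simps)
      ultimately show ?thesis by (simp add: B_def algebra_simps)
    qed
    finally show ?thesis .
  qed
  have "prob ?ev \<le> prob E1 + prob E2 + prob E3"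
    unfolding eq using ev measure_Un_le[of "E1 \<union> E2" M E3] measure_Un_le[of E1 M E2]
    by (smt (verit) sets.Un)
  with p1 p2 p3 show "prob ?ev \<le> 3 * exp (- L)" by simp
qed

text \<open>
  This monotonicity allows \<open>Gamma_fun\<close> of the random ratio \<open>(k - j) / (n + 1)\<close> to be replaced by \<open>Gamma_fun\<close> of the mass \<open>F\<close>.
\<close>

lemma mult_ln_inverse_mono:
  fixes x y :: real assumes "0 < x" "x \<le> y" "y \<le> 1"
  shows "x * ln (exp 1 / x) \<le> y * ln (exp 1 / y)"
proof -
  have "ln (y / x) \<le> y / x - 1" using assms by (intro ln_le_minus_one) auto
  then have "x * ln (y / x) \<le> x * (y / x - 1)" using assms by (intro mult_left_mono) auto
  then have 1: "x * (ln y - ln x) \<le> y - x" using assms by (simp add: ln_div right_diff_distrib)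
  have "(y - x) * ln y \<le> 0" using assms by (intro mult_nonneg_nonpos) auto
  with 1 show ?thesis using assms by (simp add: ln_div algebra_simps)
qed

text \<open>
  The two requirements on \<open>Nb\<close> correspond to two cases.  If \<open>(k - j) / (n + 1) \<le> F\<close>, then
  monotonicity of \<open>x * ln (e / x)\<close> is used; otherwise the logarithm itself is smaller than the one for \<open>F\<close>.
\<close>

lemma crit_val_le:
  fixes F Nb K :: real
  assumes jk: "j < k" "k \<le> n + 1" "k - j > 1" and F: "0 < F" "F \<le> 1"
    and Nb: "real (k - j) \<le> Nb" "real (n + 1) * F \<le> Nb" and K: "kappa n \<alpha> \<le> K" "0 \<le> K"
  shows "crit_val n \<alpha> j k \<le> sqrt (Nb / 3) * (sqrt 2 * sqrt (ln (exp 1 / F)) + K)"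
proof -
  define N where "N = real (k - j)"
  define x where "x = N / real (n + 1)"
  have N: "N \<ge> 2" "N \<le> n + 1" "real (k - j - 1) = N - 1" using jk by (auto simp: N_def of_nat_diff)
  have x: "0 < x" "x \<le> 1" using N by (auto simp: x_def)
  have lF: "ln (exp 1 / F) \<ge> 1" and lx: "ln (exp 1 / x) \<ge> 1" using F x by (simp_all add: ln_div)
  have "N * ln (exp 1 / x) = real (n + 1) * (x * ln (exp 1 / x))" by (simp add: x_def)
  also have "\<dots> \<le> Nb * ln (exp 1 / F)"
  proof (cases "x \<le> F")
    case True
    have "real (n + 1) * (x * ln (exp 1 / x)) \<le> real (n + 1) * (F * ln (exp 1 / F))"
      by (intro mult_left_mono mult_ln_inverse_mono x True F) auto
    also have "\<dots> \<le> Nb * ln (exp 1 / F)" using mult_right_mono[OF Nb(2), of "ln (exp 1 / F)"] lF by (simp add: mult.assoc)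
    finally show ?thesis .
  next
    case False
    then have "ln (exp 1 / x) \<le> ln (exp 1 / F)" using x F by (simp add: ln_div)
    then have "N * ln (exp 1 / x) \<le> Nb * ln (exp 1 / F)"
      using Nb N lF lx by (intro mult_mono) (auto simp: N_def)
    then show ?thesis by (simp add: x_def)
  qed
  finally have *: "N * ln (exp 1 / x) \<le> Nb * ln (exp 1 / F)" .
  have "(N - 1) * ln (exp 1 / x) \<le> N * ln (exp 1 / x)" using lx by (intro mult_right_mono) auto
  with * have **: "(N - 1) / 3 * (2 * ln (exp 1 / x)) \<le> Nb / 3 * (2 * ln (exp 1 / F))" by simp
  have "crit_val n \<alpha> j k = sqrt ((N - 1) / 3) * Gamma_fun x + sqrt ((N - 1) / 3) * kappa n \<alpha>"
    unfolding crit_val_def N(3) by (simp add: x_def N_def distrib_left)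
  also have "sqrt ((N - 1) / 3) * Gamma_fun x = sqrt ((N - 1) / 3 * (2 * ln (exp 1 / x)))"
    unfolding Gamma_fun_def by (simp only: real_sqrt_mult)
  also have "\<dots> \<le> sqrt (Nb / 3 * (2 * ln (exp 1 / F)))" using ** by (rule real_sqrt_le_mono)
  also have "\<dots> = sqrt (Nb / 3) * (sqrt 2 * sqrt (ln (exp 1 / F)))" by (simp only: real_sqrt_mult)
  also have "sqrt ((N - 1) / 3) * kappa n \<alpha> \<le> sqrt (Nb / 3) * K"
  proof (cases "kappa n \<alpha> \<ge> 0")
    case True
    then show ?thesis using K N Nb by (intro mult_mono real_sqrt_le_mono divide_right_mono) (auto simp: N_def)
  next
    case False
    then have "sqrt ((N - 1) / 3) * kappa n \<alpha> \<le> 0" using N by (intro mult_nonneg_nonpos) auto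
    also have "0 \<le> sqrt (Nb / 3) * K" using K Nb by simp
    finally show ?thesis .
  qed
  finally show ?thesis by (simp add: distrib_left)
qed

section \<open>Signal, noise and critical value\<close>

text \<open>
  The inequality, multiplied by \<open>Q = sqrt (n * F)\<close>, says that the signal \<open>C * Q * (l + b) / 6\<close> exceeds the critical
  value with \<open>l = sqrt (ln (e / F))\<close> and \<open>kappa n \<alpha> \<le> K\<close> even after three losses, due to the piece cut off at the
  left end, to noise of \<open>u\<close> standard deviations, and to the point missing in the local statistic.  The ratio
  \<open>u / Q\<close> measures the relative fluctuation of the number of observations.  The first two conditions bound the
  piece cut off and the Chernoff parameter.
\<close>

definition power_condition :: "real \<Rightarrow> real \<Rightarrow> real \<Rightarrow> real \<Rightarrow> real \<Rightarrow> real \<Rightarrow> real \<Rightarrow> bool" where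
  "power_condition n C l b K Q u \<longleftrightarrow> 18 * u\<^sup>2 \<le> C * Q * (l + b) \<and> 24 * u\<^sup>2 \<le> Q\<^sup>2 \<and>
     (1 + 1 / n + u / Q) * (sqrt (2/3) * l + K / sqrt 3)
       < C * (l + b) / 6 - sqrt (C * (l + b) / (2 * Q)) * u - sqrt (2/3) * (1 + 1 / n) * (1 + 5/4 * (u / Q)) * u - 1 / Q"

text \<open>
  The condition is stated in terms of \<open>Q\<close> only.  Here it is translated to the quantities of \<open>single_interval_tail\<close>
  with \<open>L = u\<^sup>2\<close>, where the sample size \<open>m\<close> is between \<open>n\<close> and \<open>n + 2\<close> and \<open>\<sigma> = s * (c - a)\<^sup>2\<close>.
\<close>

lemma critical_value_below_signal:
  fixes n m F \<sigma> C l b K u Q :: real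
  assumes n: "n \<ge> 1" "n \<le> m" "m \<le> n + 2" and F: "0 < F"
    and Q: "Q = sqrt (n * F)" and \<sigma>: "\<sigma> = C * sqrt F * (l + b) / sqrt n"
    and u: "u > 0" and l: "l \<ge> 1" and b: "b \<ge> 1" and C: "C > 0" and K: "K \<ge> 0"
    and pc: "power_condition n C l b K Q u"
  defines "l0 \<equiv> sqrt (2 * u\<^sup>2 / (m * \<sigma>))" and "t \<equiv> sqrt (6 * u\<^sup>2 / (m * F))"
  shows "l0 < 1" "t \<le> 1/2"
    "sqrt (((n + 2) * F + 2 * sqrt ((n + 2) * F * u\<^sup>2)) / 3) * (sqrt 2 * l + K)
     < (1 - l0) * (m * (\<sigma> * (1 - l0)\<^sup>2) / 6 - sqrt (2 * u\<^sup>2 * m * F / 3) * (1 + t / 2)) - 1"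
proof -
  note u18 = pc[unfolded power_condition_def, THEN conjunct1]
    and u24 = pc[unfolded power_condition_def, THEN conjunct2, THEN conjunct1]
    and H = pc[unfolded power_condition_def, THEN conjunct2, THEN conjunct2]
  define B where "B = l + b"
  define g where "g = sqrt (2/3::real)"
  define x0 where "x0 = sqrt (2 * u\<^sup>2 * m * F / 3) * (1 + t / 2)"
  have B: "B \<ge> 2" using l b by (simp add: B_def)
  have Q0: "Q > 0" and Q2: "Q\<^sup>2 = n * F" using n F by (auto simp: Q)
  have sq: "sqrt n > 0" "sqrt n * sqrt n = n" using n by auto
  have "n * \<sigma> = n / sqrt n * (C * sqrt F * B)" by (simp add: \<sigma> B_def)
  also have "n / sqrt n = sqrt n" using n by (simp add: real_div_sqrt)
  also have "sqrt n * (C * sqrt F * B) = C * Q * B" by (simp add: Q real_sqrt_mult)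
  finally have n\<sigma>: "n * \<sigma> = C * Q * B" .
  have \<sigma>0: "\<sigma> > 0" unfolding \<sigma> using C F n l b by (intro divide_pos_pos mult_pos_pos) auto
  define M where "M = m * \<sigma>"
  define y where "y = C * Q * B"
  have My: "y \<le> M" unfolding y_def M_def n\<sigma>[symmetric] using n \<sigma>0 by (intro mult_right_mono) auto
  have y18: "18 * u\<^sup>2 \<le> y" using u18 by (simp add: y_def B_def)
  have ypos: "y > 0" using y18 u by (smt (verit) zero_less_power)
  define p where "p = sqrt M"
  define q where "q = sqrt y"
  have pq: "q \<le> p" "p > 0" "p\<^sup>2 = M" "q\<^sup>2 = y" "q > 0" using My ypos by (auto simp: p_def q_def)
  have l0p: "l0 = sqrt 2 * u / p" using u by (simp add: l0_def p_def M_def real_sqrt_divide real_sqrt_mult)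
  have q18: "3 * (sqrt 2 * u) \<le> q"
    unfolding q_def using y18 by (intro real_le_rsqrt) (simp add: power_mult_distrib)
  have l03: "l0 \<le> 1/3" "l0 > 0" using q18 pq u by (auto simp: l0p field_simps)
  show "l0 < 1" using l03 by simp
  have mF: "Q\<^sup>2 \<le> m * F" "m * F \<le> (n + 2) * F" unfolding Q2 using n F by auto
  have mF0: "m * F > 0" using n F by auto
  have tt: "t \<le> sqrt 6 * u / Q"
  proof -
    have "6 * u\<^sup>2 / (m * F) \<le> 6 * u\<^sup>2 / Q\<^sup>2" using mF mult_pos_pos[OF mF0, of "Q\<^sup>2"] Q0 by (intro divide_left_mono) auto
    then have "t \<le> sqrt (6 * u\<^sup>2 / Q\<^sup>2)" unfolding t_def by (rule real_sqrt_le_mono)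
    also have "\<dots> = sqrt 6 * u / Q" using u Q0 by (simp add: real_sqrt_divide real_sqrt_mult)
    finally show ?thesis .
  qed
  show "t \<le> 1/2"
  proof -
    have "t\<^sup>2 = 6 * u\<^sup>2 / (m * F)" using mF0 by (simp add: t_def)
    also have "\<dots> \<le> (1/2)\<^sup>2" unfolding pos_divide_le_eq[OF mF0] using u24 mF by (simp add: power_divide)
    finally show ?thesis by (rule power2_le_imp_le) simp
  qed
  have t0: "0 \<le> t" using mF0 by (simp add: t_def)
  have s6: "sqrt 6 \<le> 5/2" by (rule real_le_lsqrt) (auto simp: power2_eq_square)
  have t2: "1 + t / 2 \<le> 1 + 5/4 * (u / Q)"
    using tt mult_right_mono[OF s6, of "u / Q"] u Q0 by simp
  have sn: "sqrt ((n + 2) * F) \<le> Q * (1 + 1 / n)"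
  proof (rule real_le_lsqrt)
    have "(n + 2) * F \<le> (n * F) * (1 + 1 / n)\<^sup>2"
      using n F by (simp add: power2_eq_square field_simps)
    also have "\<dots> = (Q * (1 + 1 / n))\<^sup>2" by (simp add: power_mult_distrib Q2)
    finally show "(n + 2) * F \<le> (Q * (1 + 1 / n))\<^sup>2" .
  qed (use n Q0 in auto)
  have x0: "x0 \<le> Q * (g * (1 + 1 / n) * (1 + 5/4 * (u / Q)) * u)"
  proof -
    have "sqrt (2 * u\<^sup>2 * m * F / 3) = g * u * sqrt (m * F)"
      using u by (simp add: g_def real_sqrt_mult[symmetric] real_sqrt_divide[symmetric])
         (simp add: real_sqrt_mult real_sqrt_divide)
    also have "\<dots> \<le> g * u * (Q * (1 + 1 / n))"
      using sn mF u by (intro mult_left_mono order_trans[OF real_sqrt_le_mono[OF mF(2)]]) (auto simp: g_def)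
    finally have "x0 \<le> g * u * (Q * (1 + 1 / n)) * (1 + 5/4 * (u / Q))"
      unfolding x0_def using t2 u Q0 n t0 by (intro mult_mono) (auto simp: g_def)
    then show ?thesis by (simp add: mult_ac)
  qed
  have x0nn: "x0 \<ge> 0" unfolding x0_def using mF0 by (simp add: t_def mult.assoc)
  define Nb where "Nb = (n + 2) * F + 2 * sqrt ((n + 2) * F * u\<^sup>2)"
  have sNb: "sqrt Nb \<le> Q * (1 + 1 / n + u / Q)"
  proof -
    have "Nb \<le> (sqrt ((n + 2) * F) + u)\<^sup>2"
    proof -
      have "sqrt ((n + 2) * F * u\<^sup>2) = sqrt ((n + 2) * F) * u"
        unfolding real_sqrt_mult[of _ "u\<^sup>2"] using u by simp
      moreover have "(sqrt ((n + 2) * F))\<^sup>2 = (n + 2) * F" using n F by simp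
      ultimately show ?thesis by (simp add: Nb_def power2_sum)
    qed
    then have "sqrt Nb \<le> sqrt ((n + 2) * F) + u"
      using n F u by (intro real_le_lsqrt) auto
    also have "\<dots> \<le> Q * (1 + 1 / n) + u" using sn by simp
    also have "\<dots> = Q * (1 + 1 / n + u / Q)" using Q0 by (simp add: field_simps)
    finally show ?thesis .
  qed
  have sig: "Q * (C * B / 6 - sqrt (C * B / (2 * Q)) * u) \<le> M / 6 - M * l0 / 2"
  proof -
    have "sqrt (C * B / (2 * Q)) * Q = sqrt (C * B / (2 * Q) * Q\<^sup>2)"
      unfolding real_sqrt_mult[of _ "Q\<^sup>2"] using Q0 by simp
    also have "C * B / (2 * Q) * Q\<^sup>2 = y / 2" using Q0 by (simp add: y_def power2_eq_square)
    also have "sqrt (y / 2) = q * (sqrt 2 / 2)"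
    proof -
      have "1 / sqrt 2 = sqrt 2 / (2::real)" by (simp add: field_simps)
      then show ?thesis unfolding q_def real_sqrt_divide by (metis mult_1_right times_divide_eq_right)
    qed
    finally have 1: "Q * (C * B / 6 - sqrt (C * B / (2 * Q)) * u) = q\<^sup>2 / 6 - q * (sqrt 2 * u) / 2"
      unfolding pq by (simp add: right_diff_distrib y_def mult_ac)
    have 2: "M * l0 = p * (sqrt 2 * u)" using pq by (simp add: l0p power2_eq_square flip: pq(3))
    define z where "z = sqrt 2 * u"
    have "3 * z \<le> q" "z \<ge> 0" using q18 u by (auto simp: z_def)
    then have "0 \<le> (p - q) * ((p + q) / 6 - z / 2)"
      using pq by (intro mult_nonneg_nonneg) auto
    also have "\<dots> = p\<^sup>2 / 6 - p * z / 2 - (q\<^sup>2 / 6 - q * z / 2)"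
      by (simp add: field_simps power2_eq_square)
    finally show ?thesis unfolding 1 2 z_def[symmetric] pq(3) by simp
  qed
  have "sqrt (Nb / 3) * (sqrt 2 * l + K) = sqrt Nb * (g * l + K / sqrt 3)"
    by (simp add: g_def real_sqrt_divide field_simps)
  also have "\<dots> \<le> Q * (1 + 1 / n + u / Q) * (g * l + K / sqrt 3)"
    using sNb l K by (intro mult_right_mono) (auto simp: g_def)
  also have "\<dots> < Q * (C * B / 6 - sqrt (C * B / (2 * Q)) * u - g * (1 + 1 / n) * (1 + 5/4 * (u / Q)) * u - 1 / Q)"
    using H Q0 by (simp add: B_def g_def mult.assoc)
  also have "\<dots> \<le> M / 6 - M * l0 / 2 - x0 - 1"
    using sig x0 Q0 by (simp add: right_diff_distrib)
  also have "\<dots> \<le> (1 - l0) * (m * (\<sigma> * (1 - l0)\<^sup>2) / 6 - x0) - 1"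
  proof -
    have "0 \<le> l0\<^sup>2 * (3 - l0)" using l03 by (intro mult_nonneg_nonneg) auto
    then have "1 - 3 * l0 \<le> (1 - l0) ^ 3" by (simp add: power3_eq_cube power2_eq_square algebra_simps)
    then have "M / 6 * (1 - 3 * l0) \<le> M / 6 * (1 - l0) ^ 3"
      using My ypos by (intro mult_left_mono) auto
    moreover have "0 \<le> l0 * x0" using l03 x0nn by simp
    moreover have "(1 - l0) * (m * (\<sigma> * (1 - l0)\<^sup>2) / 6 - x0) = M / 6 * (1 - l0) ^ 3 - x0 + l0 * x0"
      by (simp add: M_def power3_eq_cube power2_eq_square) (simp add: algebra_simps)
    moreover have "M / 6 * (1 - 3 * l0) = M / 6 - M * l0 / 2" by (simp add: algebra_simps)
    ultimately show ?thesis by linarith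
  qed
  finally show "sqrt (((n + 2) * F + 2 * sqrt ((n + 2) * F * u\<^sup>2)) / 3) * (sqrt 2 * l + K)
     < (1 - l0) * (m * (\<sigma> * (1 - l0)\<^sup>2) / 6 - sqrt (2 * u\<^sup>2 * m * F / 3) * (1 + t / 2)) - 1"
    by (simp add: Nb_def x0_def)
qed

text \<open>
  With \<open>B = l + b\<close> the signal is at least \<open>34/6 * B\<close>.  The assumption on \<open>Q\<close> gives \<open>Q \<ge> 17 * B\<close>, and so the critical
  value and the losses are at most \<open>1.7 * B\<close>, \<open>B\<close>, \<open>1.77 * B\<close> and \<open>1/34\<close>.
\<close>

lemma power_condition_large_constant:
  fixes n C l b K u Q :: real
  assumes n: "n \<ge> 1" and C: "C \<ge> 34" and l: "l \<ge> 1" and b: "b \<ge> 1" "b \<ge> K" and K: "K \<ge> 0"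
    and Q: "C * (l + b) \<le> 2 * Q" and u: "0 < u" "u \<le> l + b"
  shows "power_condition n C l b K Q u"
proof -
  define B where "B = l + b"
  have B: "B \<ge> 2" "l \<le> B" "K \<le> B" "l + K \<le> B" using l b by (auto simp: B_def)
  have CB: "34 * B \<le> C * B" using C B by (intro mult_right_mono) auto
  then have Q17: "17 * B \<le> Q" using Q by (simp add: B_def)
  have uB: "u \<le> B" using u by (simp add: B_def)
  have u2: "u\<^sup>2 \<le> B\<^sup>2" using u uB by (intro power_mono) auto
  have "17\<^sup>2 * B\<^sup>2 \<le> Q\<^sup>2" using Q17 B by (subst power_mult_distrib[symmetric], intro power_mono) auto
  moreover have "24 * B\<^sup>2 \<le> 17\<^sup>2 * B\<^sup>2" by (intro mult_right_mono) auto
  ultimately have r2: "24 * u\<^sup>2 \<le> Q\<^sup>2" using u2 by linarith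
  have "18 * u\<^sup>2 \<le> (34 * 17) * B\<^sup>2" using u2 by (intro mult_mono) auto
  also have "\<dots> = 34 * (17 * B) * B" by (simp add: power2_eq_square)
  also have "\<dots> \<le> C * Q * B" using C Q17 B by (intro mult_mono) auto
  finally have r1: "18 * u\<^sup>2 \<le> C * Q * (l + b)" by (simp add: B_def)
  define g where "g = sqrt (2/3::real)"
  have g: "0 \<le> g" "g \<le> 41/50" unfolding g_def by simp (rule real_le_lsqrt; simp add: power2_eq_square)
  have Q0: "Q > 0" using Q17 B by simp
  have uQ: "0 \<le> u / Q" "u / Q \<le> 1/17" using uB Q17 u Q0 by (auto simp: field_simps)
  have n1: "1 / n \<le> 1" "0 \<le> 1 / n" using n by auto
  have s3: "K / sqrt 3 \<le> K * 3/5"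
  proof -
    have "5/3 \<le> sqrt 3" by (rule real_le_rsqrt) (simp add: power2_eq_square)
    then have "1 / sqrt 3 \<le> 3/5" by (simp add: field_simps)
    from mult_left_mono[OF this K] show ?thesis by simp
  qed
  have "(1 + 1 / n + u / Q) * (g * l + K / sqrt 3) \<le> (2 + 1/17) * (41/50 * l + K * 3/5)"
    using uQ n1 g s3 l K by (intro mult_mono add_mono mult_right_mono) auto
  also have "\<dots> \<le> 17/10 * B" using B K l by simp
  finally have 1: "(1 + 1 / n + u / Q) * (g * l + K / sqrt 3) \<le> 17/10 * B" .
  have "sqrt (C * (l + b) / (2 * Q)) \<le> 1" using Q Q0 by simp
  then have 2: "sqrt (C * (l + b) / (2 * Q)) * u \<le> 1 * B" using u uB by (intro mult_mono) auto
  have 3: "g * (1 + 1 / n) * (1 + 5/4 * (u / Q)) * u \<le> 41/50 * 2 * (1 + 5/4 * (1/17)) * B"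
    using g n1 uQ u uB by (intro mult_mono) auto
  have 4: "1 / Q \<le> 1/34" using Q17 B Q0 by (simp add: field_simps)
  have "41/50 * 2 * (1 + 5/4 * (1/17)) * B \<le> 177/100 * B" using B by simp
  with 1 2 3 4 CB B have r3: "(1 + 1 / n + u / Q) * (sqrt (2/3) * l + K / sqrt 3)
       < C * (l + b) / 6 - sqrt (C * (l + b) / (2 * Q)) * u - sqrt (2/3) * (1 + 1 / n) * (1 + 5/4 * (u / Q)) * u - 1 / Q"
    unfolding g_def[symmetric] B_def[symmetric] by linarith
  show ?thesis unfolding power_condition_def by (intro conjI r1 r2 r3)
qed

text \<open>
  As \<open>\<eta>\<close> tends to zero, the critical value and the noise are at most \<open>sqrt (2 / 3) * (l + b)\<close> each, up to a vanishing part, and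
  all else is negligible; the signal is \<open>C / 6 * (l + b)\<close> with \<open>C / 6 > 2 * sqrt (2 / 3)\<close>.
\<close>

lemma power_condition_medium_constant:
  fixes C :: real
  assumes C: "C > 2 * sqrt 24"
  obtains \<eta> where "0 < \<eta>" "\<eta> \<le> 1"
    "\<forall>n l b K u Q. n \<ge> (1::real) \<longrightarrow> 1 / n \<le> \<eta> \<longrightarrow> l \<ge> 1 \<longrightarrow> b \<ge> 1 \<longrightarrow> 1 \<le> \<eta> * b \<longrightarrow> K \<ge> 0 \<longrightarrow> K \<le> \<eta> * b \<longrightarrow>
       C * (l + b) \<le> 2 * Q \<longrightarrow> 0 < u \<longrightarrow> u \<le> l + b \<longrightarrow> u \<le> \<eta> * Q \<longrightarrow> power_condition n C l b K Q u"
proof -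
  define g where "g = sqrt (2/3::real)"
  have g: "0 \<le> g" "g \<le> 1" unfolding g_def by auto
  have g24: "sqrt 24 = 6 * g"
  proof -
    have "sqrt 24 = sqrt (36 * (2/3))" by simp
    also have "\<dots> = sqrt 36 * g" unfolding g_def by (rule real_sqrt_mult)
    also have "sqrt 36 = (6::real)" by (rule real_sqrt_unique) auto
    finally show ?thesis .
  qed
  have C0: "C > 0" using C g24 g by simp
  have "((\<lambda>\<eta>. sqrt (C / 2 * \<eta>) + g * (1 + \<eta>) * (1 + 5/4 * \<eta>) + \<eta> + (1 + \<eta> + \<eta>) * (g + \<eta>)) \<longlongrightarrow>
      sqrt (C / 2 * 0) + g * (1 + 0) * (1 + 5/4 * 0) + 0 + (1 + 0 + 0) * (g + 0)) (at_right 0)"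
    by (intro tendsto_intros)
  then have ev1: "eventually (\<lambda>\<eta>. sqrt (C / 2 * \<eta>) + g * (1 + \<eta>) * (1 + 5/4 * \<eta>) + \<eta> + (1 + \<eta> + \<eta>) * (g + \<eta>) < C / 6) (at_right 0)"
    by (rule order_tendstoD) (use C g24 in auto)
  have ev2: "eventually (\<lambda>\<eta>::real. \<eta> \<in> {0<..<min (1/18) (C/18)}) (at_right 0)"
    using C0 by (intro eventually_at_rightI[where b = "min (1/18) (C/18)"]) auto
  obtain \<eta> where \<eta>: "0 < \<eta>" "\<eta> \<le> 1/18" "\<eta> \<le> C/18"
    "sqrt (C / 2 * \<eta>) + g * (1 + \<eta>) * (1 + 5/4 * \<eta>) + \<eta> + (1 + \<eta> + \<eta>) * (g + \<eta>) < C / 6"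
    using eventually_happens[OF eventually_conj[OF ev1 ev2]] by auto
  show thesis
  proof (rule that[OF \<eta>(1)])
    show "\<eta> \<le> 1" using \<eta>(2) by simp
    show "\<forall>n l b K u Q. n \<ge> (1::real) \<longrightarrow> 1 / n \<le> \<eta> \<longrightarrow> l \<ge> 1 \<longrightarrow> b \<ge> 1 \<longrightarrow> 1 \<le> \<eta> * b \<longrightarrow> K \<ge> 0 \<longrightarrow> K \<le> \<eta> * b \<longrightarrow>
       C * (l + b) \<le> 2 * Q \<longrightarrow> 0 < u \<longrightarrow> u \<le> l + b \<longrightarrow> u \<le> \<eta> * Q \<longrightarrow> power_condition n C l b K Q u"
    proof (intro allI impI)
      fix n l b K u Q :: real
      assume n: "n \<ge> 1" "1 / n \<le> \<eta>" and l: "l \<ge> 1" and b: "b \<ge> 1" "1 \<le> \<eta> * b" and K: "K \<ge> 0" "K \<le> \<eta> * b"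
        and Q: "C * (l + b) \<le> 2 * Q" and u: "0 < u" "u \<le> l + b" "u \<le> \<eta> * Q"
      define B where "B = l + b"
      have B: "B \<ge> 2" "l \<le> B" "b \<le> B" using l b by (auto simp: B_def)
      have "C * B > 0" using C0 B by simp
      then have Q0: "Q > 0" using Q by (simp add: B_def)
      have uB: "u \<le> B" using u by (simp add: B_def)
      have uQ: "0 \<le> u / Q" "u / Q \<le> \<eta>" using u Q0 by (auto simp: field_simps)
      have n0: "0 \<le> 1 / n" using n by simp
      have K3: "K / sqrt 3 \<le> \<eta> * B"
      proof -
        have "K / sqrt 3 \<le> K / 1" using K by (intro divide_left_mono) auto
        moreover have "\<eta> * b \<le> \<eta> * B" using B \<eta> by (intro mult_left_mono) auto
        ultimately show ?thesis using K by linarith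
      qed
      have uu: "u\<^sup>2 \<le> B * (\<eta> * Q)" unfolding power2_eq_square using u uB B by (intro mult_mono) auto
      have "18 * u\<^sup>2 \<le> (18 * \<eta>) * (Q * B)" using uu by (simp add: mult_ac)
      also have "\<dots> \<le> C * (Q * B)" using \<eta> Q0 B by (intro mult_right_mono) auto
      finally have r1: "18 * u\<^sup>2 \<le> C * Q * (l + b)" by (simp add: B_def mult.assoc)
      have u18: "u\<^sup>2 \<le> (1/18 * Q)\<^sup>2" using u \<eta> Q0 by (intro power_mono order_trans[OF u(3)] mult_right_mono) auto
      have "324 * u\<^sup>2 \<le> Q\<^sup>2" using u18 unfolding power_mult_distrib by (simp add: power_divide)
      then have r2: "24 * u\<^sup>2 \<le> Q\<^sup>2" using zero_le_power2[of u] by linarith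
      have 1: "(1 + 1 / n + u / Q) * (g * l + K / sqrt 3) \<le> (1 + \<eta> + \<eta>) * ((g + \<eta>) * B)"
      proof (intro mult_mono)
        have "g * l \<le> g * B" using g B by (intro mult_left_mono) auto
        then show "g * l + K / sqrt 3 \<le> (g + \<eta>) * B" using K3 by (simp add: distrib_right)
      qed (use n uQ n0 g l K \<eta> in auto)
      have 2: "sqrt (C * B / (2 * Q)) * u \<le> sqrt (C / 2 * \<eta>) * B"
      proof -
        have "sqrt (C * B / (2 * Q)) * u = sqrt (C * B / (2 * Q) * u\<^sup>2)"
          unfolding real_sqrt_mult[of _ "u\<^sup>2"] using u by simp
        also have "\<dots> \<le> sqrt (C * B / (2 * Q) * (B * (\<eta> * Q)))"
          using uu C0 B Q0 by (intro real_sqrt_le_mono mult_left_mono) auto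
        also have "C * B / (2 * Q) * (B * (\<eta> * Q)) = C / 2 * \<eta> * B\<^sup>2" using Q0 by (simp add: power2_eq_square)
        also have "sqrt (C / 2 * \<eta> * B\<^sup>2) = sqrt (C / 2 * \<eta>) * B"
          unfolding real_sqrt_mult[of _ "B\<^sup>2"] using B by simp
        finally show ?thesis .
      qed
      have 3: "g * (1 + 1 / n) * (1 + 5/4 * (u / Q)) * u \<le> g * (1 + \<eta>) * (1 + 5/4 * \<eta>) * B"
        using g n n0 uQ u uB \<eta> by (intro mult_mono) auto
      have 4: "1 / Q \<le> \<eta> * B"
      proof -
        have "2 \<le> sqrt (24::real)" by (rule real_le_rsqrt) simp
        then have "2 * 1 \<le> sqrt 24 * B" using B by (intro mult_mono) auto
        have "sqrt 24 * B \<le> C * B" using C B by (intro mult_right_mono) (auto intro: order_trans[of _ "2 * sqrt 24"])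
        with \<open>2 * 1 \<le> sqrt 24 * B\<close> Q have "1 \<le> Q" by (simp add: B_def)
        then have "1 / Q \<le> 1" by simp
        moreover have "\<eta> * b \<le> \<eta> * B" using B \<eta> by (intro mult_left_mono) auto
        ultimately show ?thesis using b by linarith
      qed
      have "(sqrt (C / 2 * \<eta>) + g * (1 + \<eta>) * (1 + 5/4 * \<eta>) + \<eta> + (1 + \<eta> + \<eta>) * (g + \<eta>)) * B < C / 6 * B"
        using \<eta>(4) B by (intro mult_strict_right_mono) auto
      then have "(1 + 1 / n + u / Q) * (g * l + K / sqrt 3)
         < C * B / 6 - sqrt (C * B / (2 * Q)) * u - g * (1 + 1 / n) * (1 + 5/4 * (u / Q)) * u - 1 / Q"
        using 1 2 3 4 unfolding distrib_right[of _ _ B] mult.assoc by linarith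
      with r1 r2 show "power_condition n C l b K Q u"
        by (simp add: power_condition_def g_def B_def)
    qed
  qed
qed

text \<open>
  Here \<open>C / 6 = sqrt (2 / 3)\<close>, so that \<open>C * l / 6\<close> balances the main term of the critical value exactly.  What remains of
  the signal is \<open>sqrt (2 / 3) * b\<close>, and everything else is a small fraction of \<open>b\<close>.  The condition \<open>Q\<^sup>2 \<le> n\<close> gives
  \<open>l \<le> n\<close>, which bounds the term \<open>l / n\<close>.
\<close>

lemma power_condition_critical_constant:
  fixes n l b K u Q \<eta> :: real
  defines "C \<equiv> sqrt 24"
  assumes \<eta>: "\<eta> = 1/20" and n: "n \<ge> 1" and nQ: "Q\<^sup>2 \<le> n" and l: "l \<ge> 1" and b: "b \<ge> 1" "1 \<le> \<eta> * b"
    and K: "K \<ge> 0" "K \<le> \<eta> * b"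
    and Q: "C * (l + b) \<le> 2 * Q" and u: "0 < u" "u \<le> \<eta> * b"
  shows "power_condition n C l b K Q u"
proof -
  define B where "B = l + b"
  define g where "g = sqrt (2/3::real)"
  have g: "4/5 \<le> g" "g \<le> 41/50" unfolding g_def
    by (rule real_le_rsqrt real_le_lsqrt; simp add: power2_eq_square)+
  have g24: "C = 6 * g"
  proof -
    have "sqrt 24 = sqrt (36 * (2/3))" by simp
    also have "\<dots> = sqrt 36 * g" unfolding g_def by (rule real_sqrt_mult)
    also have "sqrt 36 = (6::real)" by (rule real_sqrt_unique) auto
    finally show ?thesis by (simp add: C_def)
  qed
  have B: "B \<ge> 2" "l \<le> B" "b \<le> B" using l b by (auto simp: B_def)
  have "4 * B \<le> C * B" using g g24 B by (intro mult_right_mono) auto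
  then have Q2: "2 * B \<le> Q" using Q by (simp add: B_def)
  have Q0: "Q > 0" "1 \<le> Q" using Q2 B by auto
  have ub: "u \<le> b / 20" using u \<eta> by simp
  define w where "w = u / Q"
  have uQ: "0 \<le> w" "w \<le> 1/20" unfolding w_def using ub B Q2 Q0 u by (auto simp: field_simps)
  have u2: "u\<^sup>2 \<le> (B / 20)\<^sup>2" using u ub B by (intro power_mono) auto
  have "(2 * B)\<^sup>2 \<le> Q\<^sup>2" using Q2 B by (intro power_mono) auto
  then have Q4: "4 * B\<^sup>2 \<le> Q\<^sup>2" by (simp add: power_mult_distrib)
  have u400: "400 * u\<^sup>2 \<le> B\<^sup>2" using u2 by (simp add: power_divide)
  have r2: "24 * u\<^sup>2 \<le> Q\<^sup>2" using Q4 u400 zero_le_power2[of u] by linarith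
  have "4 * (2 * B) * B \<le> C * Q * B" using Q2 Q0 B g g24 by (intro mult_mono) auto
  then have "8 * B\<^sup>2 \<le> C * Q * B" by (simp add: power2_eq_square)
  then have r1: "18 * u\<^sup>2 \<le> C * Q * (l + b)" unfolding B_def[symmetric] using u400 zero_le_power2[of u] by linarith
  define v where "v = 1 / n"
  have n0: "0 \<le> v" "v \<le> 1" using n by (auto simp: v_def)
  have nl: "v * l \<le> 1"
  proof -
    have "l\<^sup>2 \<le> Q\<^sup>2" using l B Q2 by (intro power_mono) auto
    moreover have "l \<le> l\<^sup>2" using l by (simp add: power2_eq_square)
    ultimately have "l \<le> n" using nQ by linarith
    then show ?thesis using n by (simp add: v_def)
  qed
  have ul: "w * l \<le> u"
  proof -
    have "u * l \<le> u * Q" using u B Q2 by (intro mult_left_mono) auto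
    then show ?thesis using Q0 by (simp add: w_def field_simps)
  qed
  have K3: "0 \<le> K / sqrt 3" "K / sqrt 3 \<le> b / 20"
  proof -
    have "K / sqrt 3 \<le> K / 1" using K by (intro divide_left_mono) auto
    then show "K / sqrt 3 \<le> b / 20" using K(2) unfolding \<eta> by linarith
  qed (use K in simp)
  define K' where "K' = K / sqrt 3"
  have "(1 + v + w) * (g * l + K') = g * l + g * (v * l) + g * (w * l) + (1 + v + w) * K'"
    by (simp add: algebra_simps)
  also have "\<dots> \<le> g * l + 41/50 * 1 + 41/50 * u + 3 * (b / 20)"
    using g nl ul K3 n0 uQ u n l unfolding K'_def[symmetric] by (intro add_mono mult_mono order_refl) auto
  finally have 1: "(1 + v + w) * (g * l + K') \<le> g * l + 41/50 + 41/50 * u + 3 * (b / 20)" by simp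
  have "sqrt (C * B / (2 * Q)) \<le> 1" using Q Q0 by (simp add: B_def)
  then have 2: "sqrt (C * B / (2 * Q)) * u \<le> 1 * u" using u by (intro mult_right_mono) auto
  have 3: "g * (1 + v) * (1 + 5/4 * w) * u \<le> 41/50 * 2 * (1 + 5/4 * (1/20)) * u"
    using g n0 uQ u by (intro mult_mono) auto
  have 4: "1 / Q \<le> 1" using Q0 by simp
  have 5: "1 \<le> b / 20" using b \<eta> by simp
  have 6: "4/5 * b \<le> g * b" using g b by (intro mult_right_mono) auto
  have 7: "C * B / 6 = g * l + g * b" by (simp add: g24 B_def distrib_left)
  have 8: "41/50 * 2 * (1 + 5/4 * (1/20)) * u \<le> 7/4 * u" using u by simp
  have fin: "X < A + g * b - Y - Z - W"
    if "X \<le> A + 41/50 + 41/50 * u + 3 * (b / 20)" "Y \<le> 1 * u" "Z \<le> 7/4 * u" "W \<le> 1" for X A Y Z W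
    using that 5 6 ub by linarith
  have r3: "(1 + 1 / n + u / Q) * (sqrt (2/3) * l + K / sqrt 3)
       < C * (l + b) / 6 - sqrt (C * (l + b) / (2 * Q)) * u - sqrt (2/3) * (1 + 1 / n) * (1 + 5/4 * (u / Q)) * u - 1 / Q"
    unfolding g_def[symmetric] B_def[symmetric] v_def[symmetric] w_def[symmetric] K'_def[symmetric] 7
    by (rule fin[OF 1 2 order_trans[OF 3 8] 4])
  show ?thesis unfolding power_condition_def by (intro conjI r1 r2 r3)
qed

section \<open>Detection of all intervals\<close>

lemma mass_nonneg: "(\<And>x. f x \<ge> 0) \<Longrightarrow> mass f A \<ge> 0"
  unfolding mass_def set_lebesgue_integral_def by (intro Bochner_Integration.integral_nonneg) (auto simp: indicator_def)

lemma mass_UNIV: "mass f UNIV = integral\<^sup>L lborel f"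
  by (simp add: mass_def set_lebesgue_integral_def)

lemma mass_Un_disjoint:
  assumes f: "integrable lborel f" and A: "A \<in> sets borel" "B \<in> sets borel" "A \<inter> B = {}"
  shows "mass f (A \<union> B) = mass f A + mass f B"
  unfolding mass_def
  using assms by (intro set_integral_Un) (auto simp: set_integrable_def intro!: integrable_mult_indicator simp del: real_scaleR_def)

lemma mass_outside_support:
  assumes f: "\<And>x. f x \<ge> 0" "integrable lborel f" "integral\<^sup>L lborel f = 1"
    and S: "mass f S = 1" "S \<in> sets borel" and J: "J \<in> sets borel" "J \<inter> S = {}"
  shows "mass f J = 0"
proof -
  have "mass f J + mass f S = mass f (J \<union> S)" using assms by (intro mass_Un_disjoint[symmetric]) auto
  also have "\<dots> \<le> mass f UNIV" using assms by (intro mass_mono) auto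
  finally show ?thesis using mass_nonneg[of f J] f S by (simp add: mass_UNIV)
qed

lemma support_set_borel: "support_set lo hi \<in> sets borel"
  by (cases lo; cases hi) auto

text \<open>
  An end point of the support inside the interval would leave an interval without mass beside it, contrary to the
  positive slope.  Therefore all points of the extended vector in \<open>(a, c)\<close> are observations.
\<close>

lemma support_endpoints_outside:
  assumes f: "\<And>x. f x \<ge> 0" "integrable lborel f" "integral\<^sup>L lborel f = 1"
    and S: "mass f (support_set lo hi) = 1"
    and sl: "slope_ge f {a<..<c} s" "s > 0"
  shows "set_option lo \<inter> {a<..<c} = {}" "set_option hi \<inter> {a<..<c} = {}"
proof -
  note out = mass_outside_support[OF f S support_set_borel]
  have pos: "mass f {x<..<y} > 0" if "a \<le> x" "x < y" "y \<le> c" for x y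
  proof -
    have "s * (y - x)\<^sup>2 / 2 > 0" using sl that by simp
    also have "s * (y - x)\<^sup>2 / 2 \<le> mass f {x<..<y}"
      using that by (intro slope_mass_lower f slope_ge_subset[OF sl(1)]) auto
    finally show ?thesis .
  qed
  show "set_option lo \<inter> {a<..<c} = {}"
  proof (rule ccontr)
    assume "set_option lo \<inter> {a<..<c} \<noteq> {}"
    then obtain z where z: "lo = Some z" "a < z" "z < c" by auto
    then have "{a<..<z} \<inter> support_set lo hi = {}" by (cases hi) auto
    from out[OF _ this] pos[of a z] z show False by simp
  qed
  show "set_option hi \<inter> {a<..<c} = {}"
  proof (rule ccontr)
    assume "set_option hi \<inter> {a<..<c} \<noteq> {}"
    then obtain z where z: "hi = Some z" "a < z" "z < c" by auto
    then have "{z<..<c} \<inter> support_set lo hi = {}" by (cases lo) auto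
    from out[OF _ this] pos[of z c] z show False by simp
  qed
qed

lemma (in prob_space) AE_in_support:
  fixes f :: "real \<Rightarrow> real"
  assumes D: "distributed M lborel Y (\<lambda>x. ennreal (f x))" and f: "\<And>x. f x \<ge> 0"
    and S: "mass f S = 1" "S \<in> sets borel"
  shows "AE \<omega> in M. Y \<omega> \<in> S"
proof -
  note df = density_facts[OF D f]
  have "mass f (- S) = 0" using S by (intro mass_outside_support[OF f df(2,3) S]) auto
  then have "AE x in lborel. indicator (- S) x *\<^sub>R f x = 0"
    unfolding mass_def set_lebesgue_integral_def using S f df
    by (subst (asm) integral_nonneg_eq_0_iff_AE)
       (auto intro!: integrable_mult_indicator AE_I2 mult_nonneg_nonneg simp del: real_scaleR_def simp: scaleR_nonneg_nonneg)
  then have "AE x in density lborel (\<lambda>x. ennreal (f x)). x \<in> S"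
    using df(1) by (subst AE_density) (auto elim!: eventually_mono simp: indicator_def split: if_splits)
  moreover have "distr M lborel Y = density lborel (\<lambda>x. ennreal (f x))"
    using D by (simp add: distributed_def)
  ultimately have "AE x in distr M lborel Y. x \<in> S" by metis
  then show ?thesis
    using D S by (subst (asm) AE_distr_iff) (auto simp: distributed_def)
qed

lemma (in prob_space) AE_strict_sorted_ext_list:
  fixes Y :: "nat \<Rightarrow> 'a \<Rightarrow> real" and f :: "real \<Rightarrow> real"
  assumes I: "indep_vars (\<lambda>_. borel) Y {..<m}" and m: "m > 0"
    and D: "\<And>i. i < m \<Longrightarrow> distributed M lborel (Y i) (\<lambda>x. ennreal (f x))"
    and f: "\<And>x. f x \<ge> 0" and S: "mass f (support_set lo hi) = 1"
  shows "AE \<omega> in M. sorted_wrt (<) (ext_list lo hi m (\<lambda>i. Y i \<omega>)) \<and> inj_on (\<lambda>i. Y i \<omega>) {..<m}"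
proof -
  have "AE \<omega> in M. \<forall>i\<in>{..<m}. Y i \<omega> \<in> support_set lo hi \<and> Some (Y i \<omega>) \<noteq> lo \<and> Some (Y i \<omega>) \<noteq> hi"
  proof (intro AE_finite_allI)
    fix i assume i: "i \<in> {..<m}"
    have 1: "AE \<omega> in M. Some (Y i \<omega>) \<noteq> z" for z
      using AE_distributed_neq_const[OF D, of i "the z"] i by (cases z) auto
    have "AE \<omega> in M. Y i \<omega> \<in> support_set lo hi"
      using i by (intro AE_in_support[OF D f S support_set_borel]) auto
    with 1[of lo] 1[of hi] show "AE \<omega> in M. Y i \<omega> \<in> support_set lo hi \<and> Some (Y i \<omega>) \<noteq> lo \<and> Some (Y i \<omega>) \<noteq> hi"
      by eventually_elim simp
  qed simp
  moreover have "AE \<omega> in M. inj_on (\<lambda>i. Y i \<omega>) {..<m}"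
    using I D by (intro AE_indep_inj[where g = "\<lambda>x. ennreal (f x)"]) auto
  ultimately show ?thesis
  proof eventually_elim
    case (elim \<omega>)
    have lo: "a < Y i \<omega>" if "i < m" "lo = Some a" for i a
      using elim(1) that by (cases hi) (force simp: less_le)+
    have hi: "Y i \<omega> < b" if "i < m" "hi = Some b" for i b
      using elim(1) that by (cases lo) (force simp: less_le)+
    show ?case
      using elim(2) lo hi m by (auto intro!: strict_sorted_ext_list intro: less_trans[of _ "Y 0 \<omega>"])
  qed
qed

lemma slope_ge_of_H_fun:
  assumes H: "H_fun f {a<..<c} \<ge> ereal r" and ac: "a < c" and F: "mass f {a<..<c} > 0"
  shows "slope_ge f {a<..<c} (r * sqrt (mass f {a<..<c}) / (c - a)\<^sup>2)"
  unfolding slope_ge_def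
proof (intro ballI impI)
  fix x y assume xy: "x \<in> {a<..<c}" "y \<in> {a<..<c}" "x < y"
  define d where "d = (c - a)\<^sup>2 / sqrt (mass f {a<..<c})"
  have d: "d > 0" using ac F by (simp add: d_def)
  have "inf_slope f {a<..<c} \<le> ereal ((f y - f x) / (y - x))"
    unfolding inf_slope_def using xy by (intro INF_lower2[of "(x, y)"]) auto
  then have "inf_slope f {a<..<c} * ereal d \<le> ereal ((f y - f x) / (y - x)) * ereal d"
    using d by (intro ereal_mult_right_mono) auto
  moreover have "ereal r \<le> inf_slope f {a<..<c} * ereal d"
    using H ac by (simp add: H_fun_def d_def)
  ultimately have "ereal r \<le> ereal ((f y - f x) / (y - x)) * ereal d" by (rule order_trans[rotated])
  then have "r \<le> (f y - f x) / (y - x) * d" by simp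
  then have "r / d \<le> (f y - f x) / (y - x)" using d by (simp add: field_simps)
  then have "r / d * (y - x) \<le> f y - f x" using xy by (simp add: field_simps)
  then show "r * sqrt (mass f {a<..<c}) / (c - a)\<^sup>2 * (y - x) \<le> f y - f x"
    by (simp add: d_def)
qed

text \<open>
  If the mass is zero, then so is \<open>H_fun f I\<close>, by the convention for division by zero.
\<close>

lemma mass_pos_of_H_fun:
  assumes "H_fun f I \<ge> ereal r" "r > 0" "\<And>x. f x \<ge> 0"
  shows "mass f I > 0"
proof (rule ccontr)
  assume "\<not> mass f I > 0"
  then have "mass f I = 0" using mass_nonneg[of f I] assms(3) by auto
  then have "H_fun f I = 0" by (simp add: H_fun_def)
  with assms show False by simp
qed

text \<open>
  The exceptional event is that of \<open>single_interval_tail\<close>.  Off it, \<open>local_stat_inner_interval\<close> yields a pair of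
  observations in the interval whose local statistic is at least the signal minus the losses, and
  \<open>crit_val_le\<close> bounds its critical value.
\<close>

lemma (in prob_space) interval_detected:
  fixes Y :: "nat \<Rightarrow> 'a \<Rightarrow> real" and f :: "real \<Rightarrow> real"
  assumes n: "n \<ge> 1" and m: "m = sample_size n lo hi"
    and I: "indep_vars (\<lambda>_. borel) Y {..<m}"
    and D: "\<And>i. i < m \<Longrightarrow> distributed M lborel (Y i) (\<lambda>x. ennreal (f x))"
    and f: "\<And>x. f x \<ge> 0" and S: "mass f (support_set lo hi) = 1"
    and ac: "a < c" and F: "F = mass f {a<..<c}" "F > 0"
    and l: "l = sqrt (ln (exp 1 / F))" and b: "b \<ge> 1" and C: "C > 0"
    and H: "H_fun f {a<..<c} \<ge> ereal (C * (l + b) / sqrt (real n))"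
    and K: "K \<ge> 0" "kappa n \<alpha> \<le> K" and Q: "Q = sqrt (real n * F)" and u: "u > 0"
    and pc: "power_condition (real n) C l b K Q u"
  shows "\<exists>E\<in>events. prob E \<le> 3 * exp (- u\<^sup>2) \<and> (\<forall>\<omega>\<in>space M - E.
      sorted_wrt (<) (ext_list lo hi m (\<lambda>i. Y i \<omega>)) \<longrightarrow> inj_on (\<lambda>i. Y i \<omega>) {..<m} \<longrightarrow>
      (\<exists>J\<in>D_plus n \<alpha> (ext_order_stats lo hi m (\<lambda>i. Y i \<omega>)). J \<subseteq> {a<..<c}))"
proof -
  have mn: "n \<le> m" "m \<le> n + 2" "m > 0" using n by (auto simp: m sample_size_def)
  note df = density_facts[OF D[OF mn(3)] f]
  have F1: "F \<le> 1"
    using mass_mono[of f "{a<..<c}" UNIV] f df by (simp add: F mass_UNIV)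
  have l1: "l \<ge> 1" using F F1 by (simp add: l ln_div)
  define \<sigma> where "\<sigma> = C * sqrt F * (l + b) / sqrt (real n)"
  define s where "s = \<sigma> / (c - a)\<^sup>2"
  have \<sigma>: "\<sigma> > 0" using C F l1 b n by (simp add: \<sigma>_def)
  have s: "s > 0" "s * (c - a)\<^sup>2 = \<sigma>" using \<sigma> ac by (auto simp: s_def)
  have sl: "slope_ge f {a<..<c} s"
    using slope_ge_of_H_fun[OF H ac] F by (simp add: s_def \<sigma>_def mult_ac)
  define l0 where "l0 = sqrt (2 * u\<^sup>2 / (real m * \<sigma>))"
  define t where "t = sqrt (6 * u\<^sup>2 / (real m * F))"
  define a' where "a' = a + l0 * (c - a)"
  have "real m \<le> real n + 2" using mn by linarith
  note pa = critical_value_below_signal[where n = "real n" and m = "real m" and \<sigma> = \<sigma> and F = F and u = u and C = C and l = l and b = b and K = K,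
      OF _ _ this F(2) Q \<sigma>_def u l1 b C K(1) pc, folded l0_def t_def]
  have pa1: "l0 < 1" "t \<le> 1/2" by (rule pa; use n mn in simp)+
  have pa3: "sqrt (((real n + 2) * F + 2 * sqrt ((real n + 2) * F * u\<^sup>2)) / 3) * (sqrt 2 * l + K)
     < (1 - l0) * (real m * (\<sigma> * (1 - l0)\<^sup>2) / 6 - sqrt (2 * u\<^sup>2 * real m * F / 3) * (1 + t / 2)) - 1"
    by (rule pa; use n mn in simp)
  have u2: "u\<^sup>2 > 0" using u by simp
  have l00: "l0 > 0" using u \<sigma> mn by (simp add: l0_def)
  have aa': "a < a'" "a' < c"
  proof -
    show "a < a'" using l00 ac by (simp add: a'_def)
    have "l0 * (c - a) < 1 * (c - a)" using pa1 ac by (intro mult_strict_right_mono) auto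
    then show "a' < c" unfolding a'_def by simp
  qed
  define Sm where "Sm \<omega> = (\<Sum>i<m. if Y i \<omega> \<in> {a'<..<c} then rel_pos a' c (Y i \<omega>) else 0)" for \<omega>
  define E where "E = {\<omega> \<in> space M. obs_count Y {..<m} {a<..a'} \<omega> = 0
       \<or> real m * F + 2 * sqrt (real m * F * u\<^sup>2) \<le> obs_count Y {..<m} {a'<..<c} \<omega>
       \<or> Sm \<omega> \<le> real m * s * (c - a')\<^sup>2 / 6 - sqrt (2 * u\<^sup>2 * real m * F / 3) * (1 + t / 2)}"
  have E: "E \<in> events" "prob E \<le> 3 * exp (- u\<^sup>2)"
    unfolding E_def Sm_def using l0_def t_def s(2) pa1
    by (intro single_interval_tail[OF I D f sl ac s(1) mn(3) F(1) u2 _ _ _ _ a'_def]; simp)+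
  moreover have "\<exists>J\<in>D_plus n \<alpha> (ext_order_stats lo hi m (\<lambda>i. Y i \<omega>)). J \<subseteq> {a<..<c}"
    if \<omega>: "\<omega> \<in> space M - E" and srt: "sorted_wrt (<) (ext_list lo hi m (\<lambda>i. Y i \<omega>))"
      and inj: "inj_on (\<lambda>i. Y i \<omega>) {..<m}" for \<omega>
  proof -
    define zs where "zs = ext_list lo hi m (\<lambda>i. Y i \<omega>)"
    note so = support_endpoints_outside[OF f df(2,3) S sl s(1)]
    have Z: "set zs \<inter> J = (\<lambda>i. Y i \<omega>) ` {i\<in>{..<m}. Y i \<omega> \<in> J}" if "J \<subseteq> {a<..<c}" for J
      using so that unfolding zs_def set_ext_list by auto
    have injJ: "inj_on (\<lambda>i. Y i \<omega>) {i\<in>{..<m}. Y i \<omega> \<in> J}" for J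
      by (rule inj_on_subset[OF inj]) auto
    have cardZ: "card (set zs \<inter> J) = obs_count Y {..<m} J \<omega>" if "J \<subseteq> {a<..<c}" for J
      unfolding Z[OF that] obs_count_def by (rule card_image[OF injJ])
    have J0: "{a'<..<c} \<subseteq> {a<..<c}" and J1: "{a<..a'} \<subseteq> {a<..<c}" using aa' by auto
    have Sm: "Sm \<omega> = (\<Sum>z\<in>set zs \<inter> {a'<..<c}. rel_pos a' c z)"
      unfolding Z[OF J0] sum.reindex[OF injJ] Sm_def by (simp add: sum.If_cases Int_def comp_def)
    have ne: "set zs \<inter> {a<..a'} \<noteq> {}"
      using \<omega> cardZ[OF J1] by (auto simp: E_def)
    define T where "T = (1 - l0) * Sm \<omega> - 1"
    have lam: "(c - a') / (c - a) = 1 - l0"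
      using ac by (simp add: a'_def field_simps)
    have sa': "s * (c - a')\<^sup>2 = \<sigma> * (1 - l0)\<^sup>2"
    proof -
      have "c - a' = (1 - l0) * (c - a)" using ac by (simp add: a'_def algebra_simps)
      then show ?thesis using s(2) by (simp add: power_mult_distrib mult_ac)
    qed
    define Nb where "Nb = (real n + 2) * F + 2 * sqrt ((real n + 2) * F * u\<^sup>2)"
    have Tlow: "sqrt (Nb / 3) * (sqrt 2 * l + K) < T"
    proof -
      have "Sm \<omega> > real m * (\<sigma> * (1 - l0)\<^sup>2) / 6 - sqrt (2 * u\<^sup>2 * real m * F / 3) * (1 + t / 2)"
        using \<omega> sa' by (auto simp: E_def mult.assoc)
      then have "(1 - l0) * (real m * (\<sigma> * (1 - l0)\<^sup>2) / 6 - sqrt (2 * u\<^sup>2 * real m * F / 3) * (1 + t / 2)) \<le> (1 - l0) * Sm \<omega>"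
        using pa1 by (intro mult_left_mono) auto
      with pa3 show ?thesis by (simp add: T_def Nb_def)
    qed
    have Nb0: "Nb \<ge> 0" using F by (simp add: Nb_def)
    then have "sqrt (Nb / 3) * (sqrt 2 * l + K) \<ge> 0" using l1 K by simp
    with Tlow have "T > 0" by linarith
    then have pos: "(c - a') / (c - a) * Sm \<omega> > 1" unfolding lam by (simp add: T_def)
    obtain j k where jk: "j < k" "k < length zs" "k - j = card (set zs \<inter> {a'<..<c})" "k - j > 1"
      "a < zs ! j" "zs ! k < c" "local_stat j k ((!) zs) \<ge> (c - a') / (c - a) * Sm \<omega> - 1"
      using local_stat_inner_interval[OF srt[folded zs_def] less_imp_le[OF aa'(1)] aa'(2) ne Sm pos] .
    have len: "length zs = n + 2" unfolding zs_def m by (rule length_ext_list)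
    have kn: "k \<le> n + 1" using jk len by simp
    have "real (k - j) \<le> Nb"
    proof -
      have "real (k - j) < real m * F + 2 * sqrt (real m * F * u\<^sup>2)"
        using \<omega> jk cardZ[OF J0] by (auto simp: E_def)
      also have "\<dots> \<le> Nb"
        unfolding Nb_def using mn F by (intro add_mono mult_left_mono real_sqrt_le_mono mult_right_mono) auto
      finally show ?thesis by simp
    qed
    moreover have "real (n + 1) * F \<le> Nb"
    proof -
      have "real (n + 1) * F \<le> (real n + 2) * F" using F by (intro mult_right_mono) auto
      moreover have "0 \<le> sqrt ((real n + 2) * F * u\<^sup>2)" using F by simp
      ultimately show ?thesis unfolding Nb_def by linarith
    qed
    ultimately have "crit_val n \<alpha> j k \<le> sqrt (Nb / 3) * (sqrt 2 * l + K)"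
      unfolding l by (intro crit_val_le jk(1,4) kn F(2) F1 K)
    also have "\<dots> < T" by (rule Tlow)
    also have "T \<le> local_stat j k ((!) zs)" using jk(7) unfolding lam by (simp add: T_def)
    finally have "crit_val n \<alpha> j k < local_stat j k ((!) zs)" .
    then have "{zs ! j <..< zs ! k} \<in> D_plus n \<alpha> ((!) zs)"
      unfolding D_plus_def using \<open>crit_val n \<alpha> j k < _\<close> jk(1,4) kn by (intro CollectI exI[of _ j] exI[of _ k]) (auto simp: index_pairs_def)
    moreover have "{zs ! j <..< zs ! k} \<subseteq> {a<..<c}" using jk by auto
    ultimately show ?thesis unfolding ext_order_stats_nth zs_def by blast
  qed
  ultimately show ?thesis by blast
qed

text \<open>
  A finite union over index pairs instead of intervals shows that the event is measurable.
\<close>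

lemma D_plus_subset_iff:
  "(\<exists>J\<in>D_plus n \<alpha> X. J \<subseteq> I) \<longleftrightarrow>
    (\<exists>jk\<in>index_pairs n. crit_val n \<alpha> (fst jk) (snd jk) < local_stat (fst jk) (snd jk) X
      \<and> {X (fst jk)<..<X (snd jk)} \<subseteq> I)" (is "?L \<longleftrightarrow> ?R")
proof
  assume ?L
  then obtain j k where "(j, k) \<in> index_pairs n" "crit_val n \<alpha> j k < local_stat j k X" "{X j<..<X k} \<subseteq> I"
    unfolding D_plus_def by blast
  then show ?R by (intro bexI[of _ "(j, k)"]) auto
next
  assume ?R
  then obtain j k where jk: "(j, k) \<in> index_pairs n" "crit_val n \<alpha> j k < local_stat j k X" "{X j<..<X k} \<subseteq> I"
    by auto
  then have "{X j<..<X k} \<in> D_plus n \<alpha> X" unfolding D_plus_def by blast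
  with jk show ?L by blast
qed

lemma (in prob_space) all_intervals_detected:
  fixes Y :: "nat \<Rightarrow> 'a \<Rightarrow> real" and f :: "real \<Rightarrow> real" and u :: "real set \<Rightarrow> real"
  assumes n: "n \<ge> 1" and m: "m = sample_size n lo hi"
    and I: "indep_vars (\<lambda>_. borel) Y {..<m}"
    and D: "\<And>i. i < m \<Longrightarrow> distributed M lborel (Y i) (\<lambda>x. ennreal (f x))"
    and f: "\<And>x. f x \<ge> 0" and S: "mass f (support_set lo hi) = 1"
    and fin: "finite \<I>" and ioi: "\<And>I. I \<in> \<I> \<Longrightarrow> bounded_open_interval I"
    and det: "\<And>I. I \<in> \<I> \<Longrightarrow> \<exists>E\<in>events. prob E \<le> p I \<and> (\<forall>\<omega>\<in>space M - E.
      sorted_wrt (<) (ext_list lo hi m (\<lambda>i. Y i \<omega>)) \<longrightarrow> inj_on (\<lambda>i. Y i \<omega>) {..<m} \<longrightarrow>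
      (\<exists>J\<in>D_plus n \<alpha> (ext_order_stats lo hi m (\<lambda>i. Y i \<omega>)). J \<subseteq> I))"
  shows "prob {\<omega> \<in> space M. \<forall>I\<in>\<I>. \<exists>J\<in>D_plus n \<alpha> (ext_order_stats lo hi m (\<lambda>i. Y i \<omega>)). J \<subseteq> I}
     \<ge> 1 - (\<Sum>I\<in>\<I>. p I)"
proof -
  define X where "X \<omega> = ext_order_stats lo hi m (\<lambda>i. Y i \<omega>)" for \<omega>
  define G where "G = {\<omega> \<in> space M. \<forall>I\<in>\<I>. \<exists>J\<in>D_plus n \<alpha> (X \<omega>). J \<subseteq> I}"
  have m0: "m > 0" using n by (simp add: m sample_size_def)
  have Ym: "Y i \<in> borel_measurable M" if "i < m" for i
    using I that by (auto simp: indep_vars_def)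
  have Xm [measurable]: "(\<lambda>\<omega>. X \<omega> i) \<in> borel_measurable M" for i
    unfolding X_def by (rule measurable_ext_order_stats[OF Ym])
  note [measurable] = measurable_local_stat[of X M, OF Xm]
  have G: "G \<in> events"
  proof -
    have "{\<omega> \<in> space M. \<exists>J\<in>D_plus n \<alpha> (X \<omega>). J \<subseteq> I} \<in> events" if "I \<in> \<I>" for I
    proof -
      obtain a c where I: "I = {a<..<c}" using ioi[OF \<open>I \<in> \<I>\<close>] by (auto simp: bounded_open_interval_def)
      have "{\<omega> \<in> space M. \<exists>jk\<in>index_pairs n. crit_val n \<alpha> (fst jk) (snd jk) < local_stat (fst jk) (snd jk) (X \<omega>)
           \<and> (X \<omega> (fst jk) < X \<omega> (snd jk) \<longrightarrow> a \<le> X \<omega> (fst jk) \<and> X \<omega> (snd jk) \<le> c)} \<in> events"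
        by (rule sets.sets_Collect_finite_Ex[OF _ finite_index_pairs]) measurable
      then show ?thesis
        unfolding D_plus_subset_iff I greaterThanLessThan_subseteq_greaterThanLessThan .
    qed
    then show ?thesis unfolding G_def by (rule sets.sets_Collect_finite_All[OF _ fin])
  qed
  obtain E where E: "\<And>I. I \<in> \<I> \<Longrightarrow> E I \<in> events" "\<And>I. I \<in> \<I> \<Longrightarrow> prob (E I) \<le> p I"
    "\<And>I \<omega>. I \<in> \<I> \<Longrightarrow> \<omega> \<in> space M - E I \<Longrightarrow> sorted_wrt (<) (ext_list lo hi m (\<lambda>i. Y i \<omega>)) \<Longrightarrow>
      inj_on (\<lambda>i. Y i \<omega>) {..<m} \<Longrightarrow> \<exists>J\<in>D_plus n \<alpha> (X \<omega>). J \<subseteq> I"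
    unfolding X_def using det by metis
  have UE: "(\<Union>I\<in>\<I>. E I) \<in> events" using E(1) fin by auto
  have "1 - prob G = prob (space M - G)" using prob_compl[OF G] by simp
  also have "\<dots> \<le> prob (\<Union>I\<in>\<I>. E I)"
  proof (rule finite_measure_mono_AE[OF _ UE])
    have "AE \<omega> in M. sorted_wrt (<) (ext_list lo hi m (\<lambda>i. Y i \<omega>)) \<and> inj_on (\<lambda>i. Y i \<omega>) {..<m}"
      by (rule AE_strict_sorted_ext_list[OF I m0 D f S])
    then show "AE \<omega> in M. \<omega> \<in> space M - G \<longrightarrow> \<omega> \<in> (\<Union>I\<in>\<I>. E I)"
    proof eventually_elim
      case (elim \<omega>)
      show ?case
      proof (intro impI)
        assume "\<omega> \<in> space M - G"
        then obtain I where "I \<in> \<I>" "\<omega> \<in> space M" "\<not> (\<exists>J\<in>D_plus n \<alpha> (X \<omega>). J \<subseteq> I)"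
          by (auto simp: G_def)
        then show "\<omega> \<in> (\<Union>I\<in>\<I>. E I)" using E(3)[of I \<omega>] elim by blast
      qed
    qed
  qed
  also have "\<dots> \<le> (\<Sum>I\<in>\<I>. prob (E I))"
    by (intro finite_measure_subadditive_finite fin) (use E in auto)
  also have "\<dots> \<le> (\<Sum>I\<in>\<I>. p I)" by (intro sum_mono E)
  finally show ?thesis by (simp add: G_def X_def)
qed

lemma sum_mass_le:
  assumes f: "\<And>x. f x \<ge> 0" "integrable lborel f" and "finite \<I>" "disjoint \<I>" "\<And>I. I \<in> \<I> \<Longrightarrow> I \<in> sets borel"
  shows "(\<Sum>I\<in>\<I>. mass f I) \<le> integral\<^sup>L lborel f"
proof -
  have "(\<Sum>I\<in>\<I>. mass f I) = mass f (\<Union>\<I>)"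
    using assms(3-5)
  proof (induction \<I> rule: finite_induct)
    case empty
    then show ?case by (simp add: mass_def set_lebesgue_integral_def)
  next
    case (insert A \<A>)
    have "mass f (A \<union> \<Union>\<A>) = mass f A + mass f (\<Union>\<A>)"
    proof (rule mass_Un_disjoint[OF f(2)])
      show "\<Union>\<A> \<in> sets borel" using insert by (intro sets.finite_Union) auto
      show "A \<inter> \<Union>\<A> = {}" using insert.prems(1) insert.hyps(2)
        by (fastforce simp: disjoint_def)
    qed (use insert in auto)
    moreover have "disjoint \<A>" using insert.prems(1) by (auto simp: disjoint_def)
    ultimately show ?case using insert by simp
  qed
  also have "\<dots> \<le> mass f UNIV" using assms by (intro mass_mono f) auto
  finally show ?thesis by (simp add: mass_UNIV)
qed

text \<open>
  Slope \<open>s\<close> enforces mass at least \<open>s * (c - a)\<^sup>2 / 2\<close>.  Hence the lower bound for \<open>H_fun\<close>, in which the mass is in the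
  denominator, is also a lower bound for the expected number of observations.
\<close>

lemma interval_mass_bound:
  assumes f: "\<And>x. f x \<ge> 0" "integrable lborel f" and n: "n > 0" and ac: "a < c"
    and H: "H_fun f {a<..<c} \<ge> ereal (r / sqrt n)" and r: "r > 0"
  shows "mass f {a<..<c} > 0" "r \<le> 2 * sqrt (n * mass f {a<..<c})"
proof -
  define F where "F = mass f {a<..<c}"
  show F0: "mass f {a<..<c} > 0"
    by (rule mass_pos_of_H_fun[OF H _ f(1)]) (use n r in simp)
  have "r / sqrt n * sqrt F / (c - a)\<^sup>2 * (c - a)\<^sup>2 / 2 \<le> F"
    unfolding F_def using slope_mass_lower[OF f slope_ge_of_H_fun[OF H ac F0]] ac by simp
  then have "r * sqrt F \<le> 2 * F * sqrt n" using ac n by (simp add: field_simps)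
  also have "\<dots> = 2 * sqrt (n * F) * sqrt F" using F0 n by (simp add: real_sqrt_mult F_def)
  finally show "r \<le> 2 * sqrt (n * mass f {a<..<c})" using F0 by (simp add: F_def)
qed

theorem theorem4p2:
  fixes \<alpha> C :: real
    and b \<delta> :: "nat \<Rightarrow> real"
    and f :: "nat \<Rightarrow> real \<Rightarrow> real"
    and lo hi :: "nat \<Rightarrow> real option"
    and \<I> :: "nat \<Rightarrow> real set set"
    and M :: "nat \<Rightarrow> 'a measure"
    and Y :: "nat \<Rightarrow> nat \<Rightarrow> 'a \<Rightarrow> real"
    and X :: "nat \<Rightarrow> 'a \<Rightarrow> nat \<Rightarrow> real"
  assumes alpha: "0 < \<alpha>" "\<alpha> < 1"
    and prob: "\<And>n. n \<ge> 1 \<Longrightarrow> prob_space (M n)"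
    and f_nonneg: "\<And>n x. n \<ge> 1 \<Longrightarrow> f n x \<ge> 0"
    and support: "\<And>n. n \<ge> 1 \<Longrightarrow> mass (f n) (support_set (lo n) (hi n)) = 1"
    and density: "\<And>n i. n \<ge> 1 \<Longrightarrow> i < sample_size n (lo n) (hi n) \<Longrightarrow>
        distributed (M n) lborel (Y n i) (\<lambda>x. ennreal (f n x))"
    and indep: "\<And>n. n \<ge> 1 \<Longrightarrow>
        prob_space.indep_vars (M n) (\<lambda>_. borel) (Y n) {..<sample_size n (lo n) (hi n)}"
    and X_def: "\<And>n \<omega>. X n \<omega> =
        ext_order_stats (lo n) (hi n) (sample_size n (lo n) (hi n)) (\<lambda>i. Y n i \<omega>)"
    and intervals: "\<And>n I. n \<ge> 1 \<Longrightarrow> I \<in> \<I> n \<Longrightarrow> bounded_open_interval I"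
    and finite: "\<And>n. n \<ge> 1 \<Longrightarrow> finite (\<I> n)"
    and nonoverlapping: "\<And>n. n \<ge> 1 \<Longrightarrow> disjoint (\<I> n)"
    and H_bound: "\<And>n I. n \<ge> 1 \<Longrightarrow> I \<in> \<I> n \<Longrightarrow>
        H_fun (f n) I \<ge> ereal (C * (sqrt (ln (exp 1 / mass (f n) I)) + b n) / sqrt (real n))"
    and b_nonneg: "\<And>n. n \<ge> 1 \<Longrightarrow> b n \<ge> 0"
    and b_lim: "filterlim b at_top sequentially"
    and C_ge: "C \<ge> sqrt 24"
    and \<delta>_def: "\<And>n. \<delta> n = Min (mass (f n) ` \<I> n)"
    and setting:
      "C \<ge> 34 \<or>
       (C > 2 * sqrt 24 \<and>
        filterlim (\<lambda>n. real n * \<delta> n / ln (exp 1 * real (card (\<I> n)))) at_top sequentially) \<or>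
       (C = sqrt 24 \<and>
        filterlim (\<lambda>n. real n * \<delta> n / ln (exp 1 * real (card (\<I> n)))) at_top sequentially \<and>
        (\<lambda>n. ln (real (card (\<I> n)))) \<in> o(\<lambda>n. (b n)\<^sup>2))"
  shows "(\<lambda>n. measure (M n) {\<omega> \<in> space (M n).
            \<forall>I\<in>\<I> n. \<exists>J\<in>D_plus n \<alpha> (X n \<omega>). J \<subseteq> I}) \<longlonglongrightarrow> 1"
proof -
  obtain K where K: "K \<ge> 0" "eventually (\<lambda>n. kappa n \<alpha> \<le> K) sequentially"
    using kappa_bounded[OF alpha] by blast
  have C4: "C \<ge> 4"
  proof -
    have "4 \<le> sqrt (24::real)" by (rule real_le_rsqrt) simp
    with C_ge show ?thesis by simp
  qed
  define F where "F n I = mass (f n) I" for n I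
  define l where "l n I = sqrt (ln (exp 1 / F n I))" for n I
  define Q where "Q n I = sqrt (real n * F n I)" for n I
  define N where "N n = real (card (\<I> n))" for n
  \<comment> \<open>A level \<open>u\<close> is suitable if its failure probability is summable over the intervals and the signal
    exceeds the critical value at this level.\<close>
  define suitable where "suitable n I u \<longleftrightarrow> u > 0 \<and> exp (- u\<^sup>2) \<le> (F n I + 1 / N n) * exp (- b n) \<and>
     power_condition (real n) C (l n I) (b n) K (Q n I) u" for n I u
  have large_b: "eventually (\<lambda>n. b n \<ge> c) sequentially" for c
    using b_lim by (auto simp: filterlim_at_top)
  have facts: "F n I > 0" "F n I \<le> 1" "l n I \<ge> 1" "(l n I)\<^sup>2 = 1 + ln (1 / F n I)"
      "C * (l n I + b n) \<le> 2 * Q n I" "(Q n I)\<^sup>2 = real n * F n I" "Q n I \<ge> 2 * b n" "N n \<ge> 1"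
    if n: "n \<ge> 1" and I: "I \<in> \<I> n" and b1: "b n \<ge> 1" for n I
  proof -
    interpret prob_space "M n" by (rule prob[OF n])
    have m: "0 < sample_size n (lo n) (hi n)" using n by (simp add: sample_size_def)
    note df = density_facts[OF density[OF n m] f_nonneg[OF n]]
    obtain a c where ac: "a < c" "I = {a<..<c}" using intervals[OF n I] by (auto simp: bounded_open_interval_def)
    have F1: "F n I \<le> 1"
      using mass_mono[of "f n" I UNIV] f_nonneg[OF n] df ac by (simp add: F_def mass_UNIV)
    have "sqrt (ln (exp 1 / F n I)) \<ge> 0"
    proof (cases "F n I > 0")
      case True
      then have "ln (F n I) \<le> 0" using F1 ln_le_zero_iff by blast
      moreover have "ln (exp 1 / F n I) = 1 - ln (F n I)" using True by (simp add: ln_div)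
      ultimately have "0 \<le> ln (exp 1 / F n I)" by linarith
      then show ?thesis by simp
    next
      case False
      then have "F n I = 0" using mass_nonneg[of "f n" I] f_nonneg[OF n] by (auto simp: F_def)
      then show ?thesis by simp
    qed
    then have pos: "C * (sqrt (ln (exp 1 / F n I)) + b n) > 0" using C4 b1 by (intro mult_pos_pos add_nonneg_pos) auto
    note imb = interval_mass_bound[OF f_nonneg[OF n] df(2) _ ac(1) H_bound[OF n I, unfolded ac(2)] pos[unfolded ac(2) F_def]]
    show F0: "F n I > 0" using imb(1) n by (simp add: F_def ac(2))
    show "F n I \<le> 1" by (rule F1)
    show CQ: "C * (l n I + b n) \<le> 2 * Q n I" using imb(2) n by (simp add: F_def ac(2) l_def Q_def)
    have F0': "F n I > 0" using F0 by (simp add: F_def)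
    have lnF: "ln (F n I) \<le> 0" using F0' F1 ln_le_zero_iff by blast
    have lnE: "ln (exp 1 / F n I) = 1 - ln (F n I)" using F0' by (simp add: ln_div)
    then have ge1: "ln (exp 1 / F n I) \<ge> 1" using lnF by linarith
    then show "l n I \<ge> 1" by (simp add: l_def)
    have "(l n I)\<^sup>2 = ln (exp 1 / F n I)" unfolding l_def using ge1 by simp
    then show "(l n I)\<^sup>2 = 1 + ln (1 / F n I)" using F0' unfolding lnE by (simp add: ln_div)
    show "(Q n I)\<^sup>2 = real n * F n I" using F0 by (simp add: Q_def)
    have "4 * b n \<le> C * (l n I + b n)" using C4 b1 \<open>l n I \<ge> 1\<close> by (intro mult_mono) auto
    with CQ show "Q n I \<ge> 2 * b n" by simp
    show "N n \<ge> 1" using I finite[OF n] by (auto simp: N_def Suc_le_eq card_gt_0_iff)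
  qed
  \<comment> \<open>The squared levels; the first one serves for \<open>C \<ge> 34\<close>, the second one for the other two settings.\<close>
  define L1 where "L1 n I = ln (1 / F n I) + b n" for n I
  define L2 where "L2 n I = min (ln (1 / F n I)) (ln (N n)) + b n" for n I
  have L1: "L1 n I > 0" "sqrt (L1 n I) \<le> l n I + b n"
       "exp (- (sqrt (L1 n I))\<^sup>2) \<le> (F n I + 1 / N n) * exp (- b n)"
    and L2: "L2 n I > 0" "sqrt (L2 n I) \<le> l n I + b n" "L2 n I \<le> ln (N n) + b n"
       "exp (- (sqrt (L2 n I))\<^sup>2) \<le> (F n I + 1 / N n) * exp (- b n)"
    if n: "n \<ge> 1" and I: "I \<in> \<I> n" and b1: "b n \<ge> 1" for n I
  proof -
    note fa = facts[OF that]
    have lnF: "ln (1 / F n I) \<ge> 0" using fa by simp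
    have lnN: "ln (N n) \<ge> 0" using fa by simp
    show p: "L1 n I > 0" "L2 n I > 0" using lnF lnN b1 by (auto simp: L1_def L2_def)
    have "L2 n I \<le> L1 n I" by (simp add: L1_def L2_def)
    have "b n \<le> (b n)\<^sup>2" using b1 by (simp add: power2_eq_square)
    moreover have "0 \<le> 2 * l n I * b n" using fa(3) b1 by (intro mult_nonneg_nonneg) auto
    ultimately have "L1 n I \<le> (l n I + b n)\<^sup>2" using fa(4) lnF unfolding L1_def power2_sum by linarith
    then show le: "sqrt (L1 n I) \<le> l n I + b n" using fa(3) b1 by (intro real_le_lsqrt) auto
    show "sqrt (L2 n I) \<le> l n I + b n" using \<open>L2 n I \<le> L1 n I\<close> le by (smt (verit) real_sqrt_le_mono)
    show "L2 n I \<le> ln (N n) + b n" by (simp add: L2_def)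
    have eF: "exp (- ln (1 / F n I)) = F n I" using fa(1) by (simp add: ln_div)
    have eN: "exp (- ln (N n)) = 1 / N n" using fa(8) by (simp add: exp_minus inverse_eq_divide)
    have "exp (- L1 n I) = F n I * exp (- b n)"
      by (simp only: L1_def minus_add_distrib exp_add eF)
    also have "\<dots> \<le> (F n I + 1 / N n) * exp (- b n)" using fa(8) by (intro mult_right_mono) auto
    finally show "exp (- (sqrt (L1 n I))\<^sup>2) \<le> (F n I + 1 / N n) * exp (- b n)" using p by simp
    have "exp (- L2 n I) = exp (- min (ln (1 / F n I)) (ln (N n))) * exp (- b n)"
      by (simp only: L2_def minus_add_distrib exp_add)
    also have "\<dots> \<le> (F n I + 1 / N n) * exp (- b n)"
      using eF eN fa(1,8) by (intro mult_right_mono) (auto simp: min_def)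
    finally show "exp (- (sqrt (L2 n I))\<^sup>2) \<le> (F n I + 1 / N n) * exp (- b n)" using p by simp
  qed
  have Fmin: "\<delta> n \<le> F n I" if "n \<ge> 1" "I \<in> \<I> n" for n I
    unfolding \<delta>_def F_def using finite[OF that(1)] that(2) by (intro Min_le) auto
  have "eventually (\<lambda>n. \<forall>I\<in>\<I> n. \<exists>u. suitable n I u) sequentially"
    using setting
  proof (elim disjE conjE)
    assume C: "C \<ge> 34"
    show ?thesis
      using eventually_ge_at_top[of 1] large_b[of 1] large_b[of K]
    proof eventually_elim
      case (elim n)
      show ?case
      proof
        fix I assume I: "I \<in> \<I> n"
        note fa = facts[OF elim(1) I elim(2)]
        note L = L1[OF elim(1) I elim(2)]
        have "real n \<ge> 1" "sqrt (L1 n I) > 0" using elim(1) L(1) by simp_all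
        then have "power_condition (real n) C (l n I) (b n) K (Q n I) (sqrt (L1 n I))"
          by (intro power_condition_large_constant C fa(3,5) elim(2,3) K(1) L(2))
        with \<open>sqrt (L1 n I) > 0\<close> L(3) have "suitable n I (sqrt (L1 n I))" by (simp only: suitable_def)
        then show "\<exists>u. suitable n I u" ..
      qed
    qed
  next
    \<comment> \<open>The growth of \<open>n * \<delta> n\<close> makes the level negligible against \<open>Q\<^sup>2\<close>: its part \<open>ln #\<I>\<close> by assumption, and its part
      \<open>b n\<close> because \<open>Q\<close> exceeds \<open>2 * b n\<close>.\<close>
    assume C: "C > 2 * sqrt 24"
      and lim: "filterlim (\<lambda>n. real n * \<delta> n / ln (exp 1 * real (card (\<I> n)))) at_top sequentially"
    obtain \<eta> where \<eta>: "0 < \<eta>" "\<eta> \<le> 1" and ar: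
      "\<forall>n l b K u Q. n \<ge> (1::real) \<longrightarrow> 1 / n \<le> \<eta> \<longrightarrow> l \<ge> 1 \<longrightarrow> b \<ge> 1 \<longrightarrow> 1 \<le> \<eta> * b \<longrightarrow> K \<ge> 0 \<longrightarrow> K \<le> \<eta> * b \<longrightarrow>
       C * (l + b) \<le> 2 * Q \<longrightarrow> 0 < u \<longrightarrow> u \<le> l + b \<longrightarrow> u \<le> \<eta> * Q \<longrightarrow> power_condition n C l b K Q u"
      by (rule power_condition_medium_constant[OF C])
    have "eventually (\<lambda>n. 1 / real n \<le> \<eta>) sequentially" using \<eta> by real_asymp
    moreover have "eventually (\<lambda>n. real n * \<delta> n / ln (exp 1 * real (card (\<I> n))) \<ge> 2 / \<eta>\<^sup>2) sequentially"
      using lim by (auto simp: filterlim_at_top)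
    ultimately show ?thesis
      using eventually_ge_at_top[of 1] large_b[of 1] large_b[of "K / \<eta>"] large_b[of "1 / \<eta>"] large_b[of "1 / (2 * \<eta>\<^sup>2)"]
    proof eventually_elim
      case (elim n)
      show ?case
      proof
        fix I assume I: "I \<in> \<I> n"
        note fa = facts[OF elim(3) I elim(4)]
        note L = L2[OF elim(3) I elim(4)]
        have "sqrt (L2 n I) \<le> \<eta> * Q n I"
        proof (rule real_le_lsqrt)
          have lnN: "ln (exp 1 * N n) = 1 + ln (N n)" using fa(8) by (simp add: ln_mult)
          have "0 < ln (exp 1 * N n)" unfolding lnN using fa(8) by (simp add: add_pos_nonneg)
          then have "2 / \<eta>\<^sup>2 * (1 + ln (N n)) \<le> real n * \<delta> n"
            using elim(2) unfolding N_def[symmetric] lnN by (simp add: pos_le_divide_eq)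
          also have "\<dots> \<le> (Q n I)\<^sup>2" unfolding fa(6) using Fmin[OF elim(3) I] by (intro mult_left_mono) auto
          finally have 1: "2 * (1 + ln (N n)) \<le> \<eta>\<^sup>2 * (Q n I)\<^sup>2" using \<eta> by (simp add: field_simps)
          have "2 * b n * (1 / (2 * \<eta>\<^sup>2)) \<le> 2 * b n * b n" using elim(4,7) by (intro mult_left_mono) auto
          then have "b n \<le> \<eta>\<^sup>2 * (2 * (b n)\<^sup>2)" using \<eta> by (simp add: field_simps power2_eq_square)
          moreover have "4 * (b n)\<^sup>2 \<le> (Q n I)\<^sup>2"
            using power_mono[OF fa(7), of 2] elim(4) by (simp add: power_mult_distrib)
          then have "\<eta>\<^sup>2 * (2 * (b n)\<^sup>2) \<le> \<eta>\<^sup>2 * ((Q n I)\<^sup>2 / 2)" by (intro mult_left_mono) auto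
          ultimately have "b n \<le> \<eta>\<^sup>2 * (Q n I)\<^sup>2 / 2" by simp
          with 1 L(3) show "L2 n I \<le> (\<eta> * Q n I)\<^sup>2" by (simp add: power_mult_distrib)
        qed (use \<eta> fa(7) elim(4) in auto)
        moreover have "1 \<le> \<eta> * b n" "K \<le> \<eta> * b n" using elim(5,6) \<eta> by (auto simp: field_simps)
        moreover have "real n \<ge> 1" "sqrt (L2 n I) > 0" using elim(3) L(1) by simp_all
        ultimately have "power_condition (real n) C (l n I) (b n) K (Q n I) (sqrt (L2 n I))"
          by (intro ar[rule_format] elim(1,4) fa(3,5) K(1) L(2))
        with \<open>sqrt (L2 n I) > 0\<close> L(4) have "suitable n I (sqrt (L2 n I))" by (simp only: suitable_def)
        then show "\<exists>u. suitable n I u" ..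
      qed
    qed
  next
    \<comment> \<open>The level is at most \<open>b n / 20\<close>, as \<open>ln #\<I>\<close> is negligible against the square of \<open>b n\<close>; the number 800
      is \<open>2 / \<eta>\<^sup>2\<close>.\<close>
    assume C: "C = sqrt 24" and o: "(\<lambda>n. ln (real (card (\<I> n)))) \<in> o(\<lambda>n. (b n)\<^sup>2)"
    define \<eta> where "\<eta> = (1/20 :: real)"
    have "eventually (\<lambda>n. norm (ln (real (card (\<I> n)))) \<le> \<eta>\<^sup>2 / 2 * norm ((b n)\<^sup>2)) sequentially"
      by (rule landau_o.smallD[OF o]) (simp add: \<eta>_def)
    then show ?thesis
      using eventually_ge_at_top[of 1] large_b[of 1] large_b[of "20 * K"] large_b[of "800"]
    proof eventually_elim
      case (elim n)
      show ?case
      proof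
        fix I assume I: "I \<in> \<I> n"
        note fa = facts[OF elim(2) I elim(3)]
        note L = L2[OF elim(2) I elim(3)]
        have u: "sqrt (L2 n I) \<le> \<eta> * b n"
        proof (rule real_le_lsqrt)
          have "ln (N n) \<le> \<eta>\<^sup>2 / 2 * (b n)\<^sup>2" using elim(1) unfolding N_def by simp
          moreover have "b n * 800 \<le> b n * b n" using elim(3,5) by (intro mult_left_mono) auto
          then have "b n \<le> \<eta>\<^sup>2 / 2 * (b n)\<^sup>2" by (simp add: \<eta>_def power2_eq_square)
          ultimately show "L2 n I \<le> (\<eta> * b n)\<^sup>2" using L(3) by (simp add: power_mult_distrib)
        qed (use elim(3) in \<open>auto simp: \<eta>_def\<close>)
        have Qn: "(Q n I)\<^sup>2 \<le> real n" unfolding fa(6) using fa(2) by (simp add: mult_left_le)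
        have r: "real n \<ge> 1" "sqrt (L2 n I) > 0" using elim(2) L(1) by simp_all
        have nb: "1 \<le> \<eta> * b n" "K \<le> \<eta> * b n" using elim(4,5) by (simp_all add: \<eta>_def)
        have "power_condition (real n) C (l n I) (b n) K (Q n I) (sqrt (L2 n I))"
          unfolding C
          by (rule power_condition_critical_constant[OF \<eta>_def r(1) Qn fa(3) elim(3) nb(1) K(1) nb(2) fa(5)[unfolded C] r(2) u])
        with r(2) L(4) have "suitable n I (sqrt (L2 n I))" by (simp only: suitable_def)
        then show "\<exists>u. suitable n I u" ..
      qed
    qed
  qed
  then have ev: "eventually (\<lambda>n. 1 - 6 * exp (- b n) \<le> measure (M n) {\<omega> \<in> space (M n).
            \<forall>I\<in>\<I> n. \<exists>J\<in>D_plus n \<alpha> (X n \<omega>). J \<subseteq> I}) sequentially"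
    using eventually_ge_at_top[of 1] large_b[of 1] K(2)
  proof eventually_elim
    case (elim n)
    interpret prob_space "M n" by (rule prob[OF elim(2)])
    define m where "m = sample_size n (lo n) (hi n)"
    have m: "0 < m" using elim(2) by (simp add: sample_size_def m_def)
    have D: "\<And>i. i < m \<Longrightarrow> distributed (M n) lborel (Y n i) (\<lambda>x. ennreal (f n x))"
      using density[OF elim(2)] by (simp add: m_def)
    note df = density_facts[OF D[OF m] f_nonneg[OF elim(2)]]
    obtain u where u: "\<And>I. I \<in> \<I> n \<Longrightarrow> suitable n I (u I)" using elim(1) by metis
    have "1 - (\<Sum>I\<in>\<I> n. 3 * exp (- (u I)\<^sup>2)) \<le> prob {\<omega> \<in> space (M n).
            \<forall>I\<in>\<I> n. \<exists>J\<in>D_plus n \<alpha> (X n \<omega>). J \<subseteq> I}"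
      unfolding X_def m_def[symmetric]
    proof (rule all_intervals_detected[OF elim(2) m_def indep[OF elim(2), folded m_def] D f_nonneg[OF elim(2)] support[OF elim(2)]
          finite[OF elim(2)] intervals[OF elim(2)]])
      fix I assume I: "I \<in> \<I> n"
      obtain a c where ac: "a < c" "I = {a<..<c}" using intervals[OF elim(2) I] by (auto simp: bounded_open_interval_def)
      note fa = facts[OF elim(2) I elim(3)]
      note su = u[OF I, unfolded suitable_def]
      show "\<exists>E\<in>events. prob E \<le> 3 * exp (- (u I)\<^sup>2) \<and> (\<forall>\<omega>\<in>space (M n) - E.
        sorted_wrt (<) (ext_list (lo n) (hi n) m (\<lambda>i. Y n i \<omega>)) \<longrightarrow> inj_on (\<lambda>i. Y n i \<omega>) {..<m} \<longrightarrow>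
        (\<exists>J\<in>D_plus n \<alpha> (ext_order_stats (lo n) (hi n) m (\<lambda>i. Y n i \<omega>)). J \<subseteq> I))"
        unfolding ac(2)
        by (rule interval_detected[OF elim(2) m_def indep[OF elim(2), folded m_def] D f_nonneg[OF elim(2)] support[OF elim(2)] ac(1),
              where F = "F n I" and l = "l n I" and b = "b n" and C = C and K = K and Q = "Q n I"])
           (use su fa C4 elim K(1) H_bound[OF elim(2) I] ac in \<open>auto simp: F_def l_def Q_def\<close>)
    qed
    moreover have "(\<Sum>I\<in>\<I> n. 3 * exp (- (u I)\<^sup>2)) \<le> 6 * exp (- b n)"
    proof -
      \<comment> \<open>Disjointness bounds the sum of the masses by one, and the reciprocals of \<open>#\<I>\<close> add up to at most one.\<close>
      have "(\<Sum>I\<in>\<I> n. 3 * exp (- (u I)\<^sup>2)) \<le> (\<Sum>I\<in>\<I> n. 3 * ((F n I + 1 / N n) * exp (- b n)))"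
        by (intro sum_mono mult_left_mono) (use u in \<open>auto simp: suitable_def\<close>)
      also have "\<dots> = 3 * exp (- b n) * ((\<Sum>I\<in>\<I> n. F n I) + N n * (1 / N n))"
        by (simp add: sum_distrib_left sum_distrib_right sum.distrib N_def algebra_simps)
      also have "\<dots> \<le> 3 * exp (- b n) * (1 + 1)"
      proof (intro mult_left_mono add_mono)
        show "(\<Sum>I\<in>\<I> n. F n I) \<le> 1"
          unfolding F_def df(3)[symmetric]
          by (rule sum_mass_le[OF f_nonneg[OF elim(2)] df(2) finite[OF elim(2)] nonoverlapping[OF elim(2)]])
             (use intervals[OF elim(2)] in \<open>force simp: bounded_open_interval_def\<close>)
      qed auto
      finally show ?thesis by simp
    qed
    ultimately show ?case by linarith
  qed
  have lim: "(\<lambda>n. 1 - 6 * exp (- b n)) \<longlonglongrightarrow> 1 - 6 * 0"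
    by (intro tendsto_intros filterlim_compose[OF exp_at_bot] filterlim_compose[OF filterlim_uminus_at_bot_at_top b_lim])
  show ?thesis
  proof (rule tendsto_sandwich[OF ev])
    show "eventually (\<lambda>n. measure (M n) {\<omega> \<in> space (M n). \<forall>I\<in>\<I> n. \<exists>J\<in>D_plus n \<alpha> (X n \<omega>). J \<subseteq> I} \<le> 1) sequentially"
      using eventually_ge_at_top[of 1] by eventually_elim (use prob in \<open>auto intro: prob_space.prob_le_1\<close>)
  qed (use lim in auto)
qed

end
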